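(* Let $\mathcal M$ be a non-empty set of probability mass functions on $\mathcal X$, let $\mathcal Q$ be a non-empty bounded set of rate matrices that has separately specified rows, let $\underline Q$ be its corresponding lower transition rate operator (the lower envelope of $\mathcal Q$), and let $L_t^s$ ($0\le t\le s$) be the lower transition operators corresponding to $\underline Q$. Then for all $t,s\in\mathbb R_{\ge 0}$ with $t\le s$, all $u\in\mathcal U_{<t}$, all $x_u\in\mathcal X_u$ and $x_t\in\mathcal X$, and all $f\in\mathcal L(\mathcal X)$: $$\underline{\mathbb E}^{\mathrm W}_{\mathcal Q,\mathcal M}[f(X_s)\mid X_t=x_t,X_u=x_u]=\underline{\mathbb E}^{\mathrm{WM}}_{\mathcal Q,\mathcal M}[f(X_s)\mid X_t=x_t,X_u=x_u]=[L_t^sf](x_t).$$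
   Context: State space and operators. $\mathcal X$ is a fixed finite non-empty state space; $\mathcal L(\mathcal X)$ is the set of all $f:\mathcal X\to\mathbb R$, with $\|f\|=\max_x|f(x)|$. A non-negatively homogeneous operator $A:\mathcal L(\mathcal X)\to\mathcal L(\mathcal X)$ (i.e. $A(\lambda f)=\lambda Af$ for $\lambda\ge0$) has norm $\|A\|=\sup\{\|Af\|:\|f\|=1\}$. Matrices are real, indexed by $\mathcal X\times\mathcal X$, and act by $[Af](x)=\sum_yA(x,y)f(y)$. $I$ is the identity. Rate matrices. A rate matrix is a matrix $Q$ with $\sum_yQ(x,y)=0$ for all $x$ and $Q(x,y)\ge0$ for $x\ne y$; $\mathcal R$ is the set of all of them. $\mathcal Q\subseteq\mathcal R$ is bounded if $\sup_{Q\in\mathcal Q}\|Q\|<\infty$. $\mathcal Q$ has separately specified rows if $\mathcal Q=\{Q\in\mathcal R:(\forall x\in\mathcal X)\,Q(x,\cdot)\in\mathcal Q_x\}$ with $\mathcal Q_x=\{Q(x,\cdot):Q\in\mathcal Q\}$. The lower envelope of a non-empty bounded $\mathcal Q$ is $[\underline Qf](x)=\inf\{[Qf](x):Q\in\mathcal Q\}$. Lower transition operators. A lower transition operator is a map $\underline T:\mathcal L(\mathcal X)\to\mathcal L(\mathcal X)$ with $[\underline Tf](x)\ge\min f$, $\underline T(f+g)\ge\underline Tf+\underline Tg$ and $\underline T(\lambda f)=\lambda\underline Tf$ for $\lambda\ge0$. For $t\le s$, $\mathcal U_{[t,s]}$ is the set of finite sequences $v:\ t=t_0<t_1<\dots<t_n=s$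 (for $t=s$ only the one-point sequence); $\Delta_i=t_i-t_{i-1}$, $\sigma(v)=\max_i\Delta_i$ (and $0$ if $n=0$), $\Phi_v=(I+\Delta_1\underline Q)\cdots(I+\Delta_n\underline Q)$ (composition; $I$ if $n=0$). The lower transition operator $L_t^s$ corresponding to $\underline Q$ is the (existing, unique) lower transition operator such that for every $\epsilon>0$ there is $\delta>0$ with $\|L_t^s-\Phi_v\|\le\epsilon$ for all $v\in\mathcal U_{[t,s]}$ with $\sigma(v)\le\delta$. Stochastic processes. $\mathcal U$ is the set of all finite (possibly empty) strictly increasing sequences in $\mathbb R_{\ge0}$, identified with finite subsets; $\mathcal U_{<t}$ consists of those with all elements $<t$. "$t>u$" means $t$ exceeds every element of $u$ (true if $u=\emptyset$). $\mathcal X_u=\prod_{t\in u}\mathcal X$, elements $x_u=(x_t)_{t\in u}$. $\Omega$ is a fixed set of paths $\omega:\mathbb R_{\ge0}\to\mathcal X$ such that for every non-empty $u\in\mathcal U$ and $x_u\in\mathcal X_u$ some $\omega\in\Omega$ satisfies $\omega|_u=x_u$. $(X_t=x)=\{\omega\in\Omega:\omega(t)=x\}$, $(X_u=x_u)=\{\omega\in\Omega:\omega|_u=x_u\}$ ($=\Omega$ if $u=\emptyset$). $\mathcal A_u$ is the algebra of subsets of $\Omega$ generated by the events $(X_t=x)$ with $x\in\mathcal X$ and $t\in u$ or $t>u$. $\mathcal C^{\mathrm{SP}}=\{(A,X_u=x_u):u\in\mathcal U,x_u\in\mathcal X_u,A\in\mathcal A_u\}$. A stochastic process is a map $P:\mathcal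 C^{\mathrm{SP}}\to\mathbb R$, written $P(A|C)$, that is coherent: for all $n\in\mathbb N$, $(A_i,C_i)\in\mathcal C^{\mathrm{SP}}$, $\lambda_i\in\mathbb R$ ($1\le i\le n$), $\max\{\sum_{i=1}^n\lambda_i\mathbb I_{C_i}(\omega)(P(A_i|C_i)-\mathbb I_{A_i}(\omega)):\omega\in\bigcup_iC_i\}\ge0$. $P(A)=P(A|\Omega)$. For $t\le s$, $u\in\mathcal U_{<t}$, $x_u\in\mathcal X_u$: $T_{t,x_u}^s(x,y)=P(X_s=y|X_t=x,X_u=x_u)$. $P$ is well-behaved if for all $t\ge0$, $u\in\mathcal U_{<t}$, $x_u\in\mathcal X_u$: $\limsup_{\Delta\to0^+}\frac1\Delta\|T_{t,x_u}^{t+\Delta}-I\|<\infty$ and, if $t>0$, $\limsup_{\Delta\to0^+}\frac1\Delta\|T_{t-\Delta,x_u}^{t}-I\|<\infty$. $P$ is a Markov chain if $P(X_s=y|X_t=x,X_u=x_u)=P(X_s=y|X_t=x)$ always. The outer partial derivative $\overline\partial T_{t,x_u}^t$ is the set of all $Q\in\mathcal R$ that are limits of $\frac1{\Delta_i}(T_{t,x_u}^{t+\Delta_i}-I)$ or, if $t>0$, of $\frac1{\Delta_i}(T_{t-\Delta_i,x_u}^t-I)$, for some sequence $\Delta_i\to0^+$. $P$ is consistent with $\mathcal Q$ if $\overline\partial T_{t,x_u}^t\subseteq\mathcal Q$ for all $t\ge0$, $u\in\mathcal U_{<t}$, $x_u\in\mathcal X_u$, and consistent with $\mathcal M$ if the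 mass function $x\mapsto P(X_0=x)$ is in $\mathcal M$. $\mathbb P^{\mathrm W}_{\mathcal Q,\mathcal M}$ (resp. $\mathbb P^{\mathrm{WM}}_{\mathcal Q,\mathcal M}$) is the set of all well-behaved stochastic processes (resp. well-behaved Markov chains) consistent with $\mathcal Q$ and $\mathcal M$. $\underline{\mathbb E}^{\mathrm W}_{\mathcal Q,\mathcal M}[\cdot|\cdot]$ and $\underline{\mathbb E}^{\mathrm{WM}}_{\mathcal Q,\mathcal M}[\cdot|\cdot]$ are the infima of the (conditional) expectations $\mathbb E_P[\cdot|\cdot]$ over $P$ in the respective set, where $\mathbb E_P[f(X_s)|X_t=x_t,X_u=x_u]=\sum_{y}f(y)P(X_s=y|X_t=x_t,X_u=x_u)$. *)

theory Defs
  imports "HOL-Probability.Probability"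
begin

text \<open>
  The state space is a type of class \<open>finite\<close>; real functions on it are vectors \<open>real^'x\<close>.
  The norm on them is the maximum norm \<open>infnorm\<close>, not the Euclidean \<open>norm\<close>, so \<open>onorm\<close>
  is not the right operator norm.
\<close>

definition opnorm :: "(real^'x::finite \<Rightarrow> real^'x) \<Rightarrow> real" where
  "opnorm A = (SUP f\<in>{f. infnorm f = 1}. infnorm (A f))"

definition matnorm :: "real^'x^'x::finite \<Rightarrow> real" where
  "matnorm A = opnorm (\<lambda>f. A *v f)"

definition rate_matrices :: "(real^'x^'x::finite) set" where
  "rate_matrices =
     {Q. (\<forall>x. (\<Sum>y\<in>UNIV. Q $ x $ y) = 0) \<and> (\<forall>x y. x \<noteq> y \<longrightarrow> 0 \<le> Q $ x $ y)}"

definition bounded_rates :: "(real^'x^'x::finite) set \<Rightarrow> bool" where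
  "bounded_rates \<Q> \<longleftrightarrow> bdd_above (matnorm ` \<Q>)"

definition separately_specified_rows :: "(real^'x^'x::finite) set \<Rightarrow> bool" where
  "separately_specified_rows \<Q> \<longleftrightarrow>
     \<Q> = {Q \<in> rate_matrices. \<forall>x. Q $ x \<in> (\<lambda>R. R $ x) ` \<Q>}"

definition lower_envelope :: "(real^'x^'x::finite) set \<Rightarrow> real^'x \<Rightarrow> real^'x" where
  "lower_envelope \<Q> f = (\<chi> x. INF Q\<in>\<Q>. (Q *v f) $ x)"

definition lower_transition_operator :: "(real^'x::finite \<Rightarrow> real^'x) \<Rightarrow> bool" where
  "lower_transition_operator T \<longleftrightarrow>
     (\<forall>f x. T f $ x \<ge> Min (range (\<lambda>y. f $ y))) \<and>
     (\<forall>f g x. T (f + g) $ x \<ge> T f $ x + T g $ x) \<and>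
     (\<forall>c f. c \<ge> 0 \<longrightarrow> T (c *\<^sub>R f) = c *\<^sub>R T f)"

text \<open>For \<open>t = s\<close> strict sortedness leaves only the one-point list.\<close>

definition partitions :: "real \<Rightarrow> real \<Rightarrow> real list set" where
  "partitions t s = {v. v \<noteq> [] \<and> sorted_wrt (<) v \<and> hd v = t \<and> last v = s}"

text \<open>The increments are positive, so inserting \<open>0\<close> only matters for one-point lists.\<close>

definition mesh :: "real list \<Rightarrow> real" where
  "mesh v = Max (insert 0 {v ! Suc i - v ! i | i. Suc i < length v})"

fun euler_product ::
  "(real^'x::finite \<Rightarrow> real^'x) \<Rightarrow> real list \<Rightarrow> real^'x \<Rightarrow> real^'x" where
  "euler_product Q (t # t' # ts) f =
     (let g = euler_product Q (t' # ts) f in g + (t' - t) *\<^sub>R Q g)"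
| "euler_product Q [t] f = f"
| "euler_product Q [] f = f"

definition lower_transition ::
  "(real^'x::finite \<Rightarrow> real^'x) \<Rightarrow> real \<Rightarrow> real \<Rightarrow> real^'x \<Rightarrow> real^'x" where
  "lower_transition Q t s = (THE T. lower_transition_operator T \<and>
     (\<forall>\<epsilon>>0. \<exists>\<delta>>0. \<forall>v\<in>partitions t s.
        mesh v \<le> \<delta> \<longrightarrow> opnorm (\<lambda>f. T f - euler_product Q v f) \<le> \<epsilon>))"

definition time_sets :: "real set set" where
  "time_sets = {u. finite u \<and> u \<subseteq> {0..}}"

definition time_sets_before :: "real \<Rightarrow> real set set" where
  "time_sets_before t = {u \<in> time_sets. \<forall>r\<in>u. r < t}"

definition states_at :: "real set \<Rightarrow> (real \<Rightarrow> 'x) set" where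
  "states_at u = (u \<rightarrow>\<^sub>E UNIV)"

text \<open>
  Paths are functions on the non-negative reals; extensionality on \<open>{0..}\<close> makes this exact.
\<close>

definition path_space :: "(real \<Rightarrow> 'x) set \<Rightarrow> bool" where
  "path_space \<Omega> \<longleftrightarrow> \<Omega> \<subseteq> ({0..} \<rightarrow>\<^sub>E UNIV) \<and>
     (\<forall>u\<in>time_sets. u \<noteq> {} \<longrightarrow> (\<forall>xu\<in>states_at u. \<exists>\<omega>\<in>\<Omega>. restrict \<omega> u = xu))"

definition ev :: "(real \<Rightarrow> 'x) set \<Rightarrow> real \<Rightarrow> 'x \<Rightarrow> (real \<Rightarrow> 'x) set" where
  "ev \<Omega> t x = {\<omega>\<in>\<Omega>. \<omega> t = x}"

definition evs :: "(real \<Rightarrow> 'x) set \<Rightarrow> real set \<Rightarrow> (real \<Rightarrow> 'x) \<Rightarrow> (real \<Rightarrow> 'x) set" where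
  "evs \<Omega> u xu = {\<omega>\<in>\<Omega>. \<forall>t\<in>u. \<omega> t = xu t}"

definition event_algebra :: "(real \<Rightarrow> 'x) set \<Rightarrow> real set \<Rightarrow> (real \<Rightarrow> 'x) set set" where
  "event_algebra \<Omega> u =
     algebra \<Omega> hull {ev \<Omega> t x | t x. 0 \<le> t \<and> (t \<in> u \<or> (\<forall>r\<in>u. r < t))}"

definition process_domain ::
  "(real \<Rightarrow> 'x) set \<Rightarrow> ((real \<Rightarrow> 'x) set \<times> (real \<Rightarrow> 'x) set) set" where
  "process_domain \<Omega> =
     {(A, evs \<Omega> u xu) | A u xu. u \<in> time_sets \<and> xu \<in> states_at u \<and> A \<in> event_algebra \<Omega> u}"

text \<open>A process is a map \<open>P\<close> on pairs, with \<open>P (A, C)\<close> standing for \<open>P(A|C)\<close>.\<close>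

type_synonym 'x process = "(real \<Rightarrow> 'x) set \<times> (real \<Rightarrow> 'x) set \<Rightarrow> real"

text \<open>
  The gamble in the coherence condition takes finitely many values, so the maximum exists
  whenever at least one conditioning event is involved, hence \<open>n \<ge> 1\<close>.
\<close>

definition coherent :: "(real \<Rightarrow> 'x) set \<Rightarrow> 'x process \<Rightarrow> bool" where
  "coherent \<Omega> P \<longleftrightarrow>
     (\<forall>(n::nat) A C (l :: nat \<Rightarrow> real).
        1 \<le> n \<longrightarrow> (\<forall>i\<in>{1..n}. (A i, C i) \<in> process_domain \<Omega>) \<longrightarrow>
        Max ((\<lambda>\<omega>. \<Sum>i=1..n. l i * indicator (C i) \<omega> * (P (A i, C i) - indicator (A i) \<omega>))
              ` (\<Union>i\<in>{1..n}. C i)) \<ge> 0)"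

definition stochastic_process :: "(real \<Rightarrow> 'x) set \<Rightarrow> 'x process \<Rightarrow> bool" where
  "stochastic_process \<Omega> P \<longleftrightarrow> P \<in> extensional (process_domain \<Omega>) \<and> coherent \<Omega> P"

text \<open>
  \<open>trans_mat \<Omega> P u xu t s\<close> is the matrix \<open>P(X_s = y | X_t = x, X_u = xu)\<close>; it is meaningful for
  \<open>u\<close> in \<open>time_sets_before t\<close> and \<open>0 \<le> t \<le> s\<close>. In the left-sided limits below, this holds
  for all sufficiently small \<open>\<Delta> > 0\<close>, and only those matter.
\<close>

definition trans_mat ::
  "(real \<Rightarrow> 'x::finite) set \<Rightarrow> 'x process \<Rightarrow> real set \<Rightarrow> (real \<Rightarrow> 'x) \<Rightarrow> real \<Rightarrow> real \<Rightarrow> real^'x^'x"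
  where
  "trans_mat \<Omega> P u xu t s = (\<chi> x y. P (ev \<Omega> s y, ev \<Omega> t x \<inter> evs \<Omega> u xu))"

definition well_behaved :: "(real \<Rightarrow> 'x::finite) set \<Rightarrow> 'x process \<Rightarrow> bool" where
  "well_behaved \<Omega> P \<longleftrightarrow> (\<forall>t\<ge>0. \<forall>u\<in>time_sets_before t. \<forall>xu\<in>states_at u.
     Limsup (at_right 0)
       (\<lambda>\<Delta>. ereal (1 / \<Delta> * matnorm (trans_mat \<Omega> P u xu t (t + \<Delta>) - mat 1))) < \<infinity> \<and>
     (t > 0 \<longrightarrow> Limsup (at_right 0)
       (\<lambda>\<Delta>. ereal (1 / \<Delta> * matnorm (trans_mat \<Omega> P u xu (t - \<Delta>) t - mat 1))) < \<infinity>))"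

definition markov :: "(real \<Rightarrow> 'x) set \<Rightarrow> 'x process \<Rightarrow> bool" where
  "markov \<Omega> P \<longleftrightarrow> (\<forall>t\<ge>0. \<forall>s\<ge>t. \<forall>u\<in>time_sets_before t. \<forall>xu\<in>states_at u. \<forall>x y.
     P (ev \<Omega> s y, ev \<Omega> t x \<inter> evs \<Omega> u xu) = P (ev \<Omega> s y, ev \<Omega> t x))"

definition outer_derivative ::
  "(real \<Rightarrow> 'x::finite) set \<Rightarrow> 'x process \<Rightarrow> real set \<Rightarrow> (real \<Rightarrow> 'x) \<Rightarrow> real \<Rightarrow> (real^'x^'x) set"
  where
  "outer_derivative \<Omega> P u xu t =
     {Q \<in> rate_matrices. \<exists>\<Delta>. (\<forall>i::nat. \<Delta> i > 0) \<and> \<Delta> \<longlonglongrightarrow> 0 \<and>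
        ((\<lambda>i. (1 / \<Delta> i) *\<^sub>R (trans_mat \<Omega> P u xu t (t + \<Delta> i) - mat 1)) \<longlonglongrightarrow> Q \<or>
         t > 0 \<and> (\<lambda>i. (1 / \<Delta> i) *\<^sub>R (trans_mat \<Omega> P u xu (t - \<Delta> i) t - mat 1)) \<longlonglongrightarrow> Q)}"

definition consistent_rates ::
  "(real \<Rightarrow> 'x::finite) set \<Rightarrow> 'x process \<Rightarrow> (real^'x^'x) set \<Rightarrow> bool" where
  "consistent_rates \<Omega> P \<Q> \<longleftrightarrow>
     (\<forall>t\<ge>0. \<forall>u\<in>time_sets_before t. \<forall>xu\<in>states_at u. outer_derivative \<Omega> P u xu t \<subseteq> \<Q>)"

definition consistent_initial ::
  "(real \<Rightarrow> 'x) set \<Rightarrow> 'x process \<Rightarrow> 'x pmf set \<Rightarrow> bool" where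
  "consistent_initial \<Omega> P \<M> \<longleftrightarrow> (\<lambda>x. P (ev \<Omega> 0 x, \<Omega>)) \<in> pmf ` \<M>"

definition processes_W ::
  "(real \<Rightarrow> 'x::finite) set \<Rightarrow> (real^'x^'x) set \<Rightarrow> 'x pmf set \<Rightarrow> 'x process set" where
  "processes_W \<Omega> \<Q> \<M> = {P. stochastic_process \<Omega> P \<and> well_behaved \<Omega> P \<and>
     consistent_rates \<Omega> P \<Q> \<and> consistent_initial \<Omega> P \<M>}"

definition processes_WM ::
  "(real \<Rightarrow> 'x::finite) set \<Rightarrow> (real^'x^'x) set \<Rightarrow> 'x pmf set \<Rightarrow> 'x process set" where
  "processes_WM \<Omega> \<Q> \<M> = {P \<in> processes_W \<Omega> \<Q> \<M>. markov \<Omega> P}"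

definition cond_expectation ::
  "(real \<Rightarrow> 'x::finite) set \<Rightarrow> 'x process \<Rightarrow> real^'x \<Rightarrow> real \<Rightarrow> real \<Rightarrow> 'x \<Rightarrow> real set \<Rightarrow> (real \<Rightarrow> 'x)
     \<Rightarrow> real" where
  "cond_expectation \<Omega> P f s t x u xu =
     (\<Sum>y\<in>UNIV. f $ y * P (ev \<Omega> s y, ev \<Omega> t x \<inter> evs \<Omega> u xu))"

definition lower_expectation_W ::
  "(real \<Rightarrow> 'x::finite) set \<Rightarrow> (real^'x^'x) set \<Rightarrow> 'x pmf set
     \<Rightarrow> real^'x \<Rightarrow> real \<Rightarrow> real \<Rightarrow> 'x \<Rightarrow> real set \<Rightarrow> (real \<Rightarrow> 'x) \<Rightarrow> real" where
  "lower_expectation_W \<Omega> \<Q> \<M> f s t x u xu =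
     (INF P\<in>processes_W \<Omega> \<Q> \<M>. cond_expectation \<Omega> P f s t x u xu)"

definition lower_expectation_WM ::
  "(real \<Rightarrow> 'x::finite) set \<Rightarrow> (real^'x^'x) set \<Rightarrow> 'x pmf set
     \<Rightarrow> real^'x \<Rightarrow> real \<Rightarrow> real \<Rightarrow> 'x \<Rightarrow> real set \<Rightarrow> (real \<Rightarrow> 'x) \<Rightarrow> real" where
  "lower_expectation_WM \<Omega> \<Q> \<M> f s t x u xu =
     (INF P\<in>processes_WM \<Omega> \<Q> \<M>. cond_expectation \<Omega> P f s t x u xu)"

end

theory Submission
  imports Defs
begin

text \<open>
  Let \<open>A\<close> be the lower envelope of \<open>\<Q>\<close> and \<open>g\<close> the solution of \<open>g' = A g\<close>, \<open>g 0 = f\<close>. Since \<open>A\<close> is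
  Lipschitz, Euler products of fine partitions of \<open>[t, s]\<close> converge to \<open>g (s - t)\<close>, which is therefore
  the value of the lower transition operator at \<open>f\<close>.

  For a process consistent with \<open>\<Q>\<close>, every limit of difference quotients of its transition matrices
  dominates \<open>A\<close>, so the conditional expectation of \<open>g (s - r)\<close> at \<open>X\<^sub>r\<close> decreases at most at an arbitrarily
  small rate in \<open>r\<close>, whatever the history; comparing \<open>r = t\<close> and \<open>r = s\<close> gives the lower bound. It is
  approached by Markov chains with piecewise constant rate matrices, chosen nearly optimal for \<open>g\<close>,
  which is possible because the rows of \<open>\<Q>\<close> are separately specified. Both arguments
  localise: it suffices to treat short intervals to the left and to the right of each time point.
\<close>

section \<open>Lipschitz differential equations\<close>

text \<open>Consistency with \<open>\<Q>\<close> is pointwise: for each time and history the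
  difference quotients accumulate in \<open>\<Q>\<close>, but at no rate uniform in time. Errors can
  therefore not be summed over a partition fixed in advance. Both bounds are phrased as transitive
  relations between the endpoints of an interval, with an error proportional to its length, and a
  compactness argument makes them global. In the lower bound the history grows: beyond time
  \<open>t\<close> the state at \<open>t\<close> belongs to the conditioning event, and the argument
  closes because \<open>g\<close> does not depend on the history. In the upper bound the obstacle is
  the existence of the chain as a process: it must assign coherent conditional probabilities even
  given events of probability zero, while \<Omega> is only known to realise finite histories. These
  probabilities are built directly as iterated finite sums over finitely many times; no measure on
  the path space appears.\<close>

definition solves :: "('a \<Rightarrow> 'a) \<Rightarrow> (real \<Rightarrow> 'a::real_normed_vector) \<Rightarrow> bool" where
  "solves A g \<longleftrightarrow> (\<forall>\<tau>\<ge>0. (g has_vector_derivative A (g \<tau>)) (at \<tau> within {0..}))"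

text \<open>The majorant is the derivative of \<open>c * exp (k * r)\<close>. Measured against the
  weight \<open>exp (k * \<tau>)\<close>, integration thus gains a factor \<open>1 / k\<close>,
  which is the source of the contraction below.\<close>

lemma norm_integral_le_exp:
  fixes \<phi> :: "real \<Rightarrow> 'a::euclidean_space"
  assumes "0 \<le> \<tau>" "continuous_on {0..\<tau>} \<phi>"
    and bound: "\<And>r. 0 \<le> r \<Longrightarrow> r \<le> \<tau> \<Longrightarrow> norm (\<phi> r) \<le> c * (k * exp (k * r))"
  shows "norm (integral {0..\<tau>} \<phi>) \<le> c * (exp (k * \<tau>) - 1)"
proof -
  have "((\<lambda>r. c * (k * exp (k * r))) has_integral (c * exp (k * \<tau>) - c * exp (k * 0))) {0..\<tau>}"
    by (intro fundamental_theorem_of_calculus)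
      (use assms in \<open>auto intro!: derivative_eq_intros simp: has_real_derivative_iff_has_vector_derivative[symmetric]\<close>)
  then have "norm (integral {0..\<tau>} \<phi>) \<le> c * exp (k * \<tau>) - c * exp (k * 0)"
    using assms by (intro integral_norm_bound_integral[THEN order_trans, of _ _ "\<lambda>r. c * (k * exp (k * r))"])
      (auto simp: integrable_continuous_real dest: integral_unique)
  then show ?thesis by (simp add: algebra_simps)
qed

lemma has_vector_derivative_indefinite_integral:
  fixes \<phi> :: "real \<Rightarrow> 'a::banach"
  assumes "continuous_on {0..} \<phi>" "0 \<le> \<tau>"
  shows "((\<lambda>u. integral {0..u} \<phi>) has_vector_derivative \<phi> \<tau>) (at \<tau> within {0..})"
proof -
  have "((\<lambda>u. integral {0..u} \<phi>) has_vector_derivative \<phi> \<tau>) (at \<tau> within {0..\<tau> + 1})"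
    using assms by (intro integral_has_vector_derivative continuous_on_subset[OF assms(1)]) auto
  moreover have "at \<tau> within {0..\<tau> + 1} = at \<tau> within {0..}"
    by (rule at_within_nhd[of _ "{..<\<tau> + 1}"]) auto
  ultimately show ?thesis by simp
qed

text \<open>The substitution \<open>g \<tau> = exp (2 L \<tau>) h \<tau>\<close> turns the integral equation into a contraction
  on all bounded continuous functions, so that the solution is obtained globally at once.\<close>

lemma lipschitz_ode_solution:
  fixes A :: "'a::euclidean_space \<Rightarrow> 'a"
  assumes lip: "\<And>x y. norm (A x - A y) \<le> L * norm (x - y)" and A0: "A 0 = 0" and L: "0 < L"
  obtains g where "solves A g" "g 0 = f"
proof -
  \<comment> \<open>An exponent of twice the Lipschitz constant gives the contraction factor
    \<open>L / k = 1 / 2\<close>.\<close>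
  define k where "k = 2 * L"
  have k: "0 < k" using L by (simp add: k_def)
  have contA: "continuous_on S A" for S
    by (rule lipschitz_on_continuous_on[of L])
      (use lip L in \<open>auto intro!: lipschitz_onI simp: dist_norm\<close>)
  have contA': "continuous_on S (\<lambda>r. A (\<phi> r))" if "continuous_on S \<phi>" for S and \<phi> :: "real \<Rightarrow> 'a"
    using continuous_on_compose2[OF contA[of UNIV] that] by auto
  define G where "G h \<tau> = f + integral {0..\<tau>} (\<lambda>r. A (exp (k * r) *\<^sub>R h r))"
    for h :: "real \<Rightarrow> 'a" and \<tau>
  have G_deriv: "(G h has_vector_derivative A (exp (k * \<tau>) *\<^sub>R h \<tau>)) (at \<tau> within {0..})"
    if "continuous_on UNIV h" "0 \<le> \<tau>" for h \<tau>
  proof -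
    have "continuous_on {0..} (\<lambda>r. A (exp (k * r) *\<^sub>R h r))"
      by (intro contA' continuous_intros continuous_on_subset[OF that(1)] subset_UNIV)
    from has_vector_derivative_add[OF has_vector_derivative_const
        has_vector_derivative_indefinite_integral[OF this that(2)], of f]
    show ?thesis by (simp add: G_def[abs_def])
  qed
  \<comment> \<open>The integral operator in the rescaled unknown. Freezing it at time 0 for
    negative arguments makes it act on functions on the whole line, as the type of bounded
    continuous functions requires.\<close>
  define F where "F h \<tau> = exp (- k * max 0 \<tau>) *\<^sub>R G h (max 0 \<tau>)" for h :: "real \<Rightarrow> 'a" and \<tau>
  have F_cont: "continuous_on UNIV (F h)" if "continuous_on UNIV h" for h
  proof -
    have "continuous_on {0..} (G h)"
      by (rule continuous_on_vector_derivative[OF G_deriv[OF that]]) simp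
    moreover have "continuous_on UNIV (\<lambda>\<tau>::real. max 0 \<tau>)"
      by (intro continuous_on_max continuous_on_const continuous_on_id)
    ultimately have "continuous_on UNIV (\<lambda>\<tau>. G h (max 0 \<tau>))"
      by (rule continuous_on_compose2) auto
    then show ?thesis unfolding F_def
      by (intro continuous_on_scaleR continuous_on_exp continuous_on_mult continuous_on_const
          continuous_on_max continuous_on_id)
  qed
  have F_diff: "norm (F h1 \<tau> - F h2 \<tau>) \<le> c / 2"
    if h: "continuous_on UNIV h1" "continuous_on UNIV h2" and c: "\<And>r. norm (h1 r - h2 r) \<le> c" for h1 h2 c \<tau>
  proof -
    define \<sigma> where "\<sigma> = max 0 \<tau>"
    have \<sigma>: "0 \<le> \<sigma>" by (simp add: \<sigma>_def)
    have c0: "0 \<le> c" using c[of 0] norm_ge_zero order_trans by blast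
    have cont: "continuous_on {0..\<sigma>} (\<lambda>r. A (exp (k * r) *\<^sub>R h r))" if "continuous_on UNIV h" for h
      by (intro contA' continuous_intros continuous_on_subset[OF that]) auto
    have "norm (integral {0..\<sigma>} (\<lambda>r. A (exp (k * r) *\<^sub>R h1 r) - A (exp (k * r) *\<^sub>R h2 r)))
        \<le> (c/2) * (exp (k * \<sigma>) - 1)"
    proof (rule norm_integral_le_exp[OF \<sigma>])
      show "continuous_on {0..\<sigma>} (\<lambda>r. A (exp (k * r) *\<^sub>R h1 r) - A (exp (k * r) *\<^sub>R h2 r))"
        by (intro continuous_intros cont h)
      fix r
      have "norm (A (exp (k * r) *\<^sub>R h1 r) - A (exp (k * r) *\<^sub>R h2 r))
          \<le> L * norm (exp (k * r) *\<^sub>R h1 r - exp (k * r) *\<^sub>R h2 r)" by (rule lip)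
      also have "\<dots> = L * (exp (k * r) * norm (h1 r - h2 r))"
        by (simp flip: scaleR_diff_right)
      also have "\<dots> \<le> L * (exp (k * r) * c)"
        using L c[of r] by (intro mult_left_mono) auto
      finally show "norm (A (exp (k * r) *\<^sub>R h1 r) - A (exp (k * r) *\<^sub>R h2 r)) \<le> c / 2 * (k * exp (k * r))"
        by (simp add: k_def mult_ac)
    qed
    also have "\<dots> \<le> (c/2) * exp (k * \<sigma>)" using c0 by (intro mult_left_mono) auto
    finally have "norm (G h1 \<sigma> - G h2 \<sigma>) \<le> (c/2) * exp (k * \<sigma>)"
      using h by (simp add: G_def integral_diff integrable_continuous_real cont)
    then have "exp (- k * \<sigma>) * norm (G h1 \<sigma> - G h2 \<sigma>) \<le> exp (- k * \<sigma>) * ((c/2) * exp (k * \<sigma>))"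
      by (intro mult_left_mono) auto
    also have "\<dots> = c / 2" by (simp add: exp_minus field_simps)
    finally show ?thesis
      unfolding F_def \<sigma>_def[symmetric] by (simp flip: scaleR_diff_right)
  qed
  have F0: "norm (F (\<lambda>_. 0) \<tau>) \<le> norm f" for \<tau>
    using k by (auto simp: F_def G_def A0 intro!: mult_left_le_one_le)
  \<comment> \<open>Boundedness follows from the contraction estimate against the zero function,
    whose image is a damped copy of \<open>f\<close> because \<open>A 0 = 0\<close>.\<close>
  have F_bcont: "F (apply_bcontfun h) \<in> bcontfun" for h
  proof (rule bcontfun_normI[OF F_cont])
    show "norm (F (apply_bcontfun h) \<tau>) \<le> norm h / 2 + norm f" for \<tau>
    proof -
      have "norm (F (apply_bcontfun h) \<tau> - F (\<lambda>_. 0) \<tau>) \<le> norm h / 2"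
        by (rule F_diff) (auto simp: norm_bounded)
      then show ?thesis using F0[of \<tau>] norm_triangle_sub[of "F (apply_bcontfun h) \<tau>" "F (\<lambda>_. 0) \<tau>"]
        by linarith
    qed
  qed auto
  have "\<exists>!h. Bcontfun (F (apply_bcontfun h)) = h"
  proof (rule banach_fix_type[of "1/2"], simp, simp, intro allI)
    fix h1 h2 :: "real \<Rightarrow>\<^sub>C 'a"
    show "dist (Bcontfun (F (apply_bcontfun h1))) (Bcontfun (F (apply_bcontfun h2))) \<le> 1 / 2 * dist h1 h2"
    proof (rule dist_bound)
      fix \<tau>
      have "norm (F (apply_bcontfun h1) \<tau> - F (apply_bcontfun h2) \<tau>) \<le> dist h1 h2 / 2"
        by (rule F_diff) (auto simp: dist_bounded simp flip: dist_norm)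
      then show "dist (apply_bcontfun (Bcontfun (F (apply_bcontfun h1))) \<tau>)
          (apply_bcontfun (Bcontfun (F (apply_bcontfun h2))) \<tau>) \<le> 1 / 2 * dist h1 h2"
        by (simp add: Bcontfun_inverse F_bcont dist_norm)
    qed
  qed
  then obtain h where "Bcontfun (F (apply_bcontfun h)) = h" by blast
  then have fixpoint: "F (apply_bcontfun h) = apply_bcontfun h"
    by (metis Bcontfun_inverse F_bcont)
  have "exp (k * \<tau>) *\<^sub>R apply_bcontfun h \<tau> = G (apply_bcontfun h) \<tau>" if "0 \<le> \<tau>" for \<tau>
  proof -
    have "exp (k * \<tau>) *\<^sub>R F (apply_bcontfun h) \<tau> = G (apply_bcontfun h) \<tau>"
      using that by (simp add: F_def flip: exp_add)
    then show ?thesis by (simp add: fixpoint)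
  qed
  then have "solves A (G (apply_bcontfun h))"
    unfolding solves_def using G_deriv[of "apply_bcontfun h"] by simp
  moreover have "G (apply_bcontfun h) 0 = f" by (simp add: G_def)
  ultimately show ?thesis using that by blast
qed

text \<open>Gronwall's inequality: by Cauchy-Schwarz and the Lipschitz bound,
  \<open>exp (- 2 * L * r)\<close> times the squared distance has nonpositive derivative. Squaring
  keeps the distance differentiable where it vanishes.\<close>

lemma solves_dist_le:
  fixes A :: "'a::euclidean_space \<Rightarrow> 'a"
  assumes lip: "\<And>x y. norm (A x - A y) \<le> L * norm (x - y)"
    and "solves A g1" "solves A g2" and "0 \<le> \<tau>"
  shows "norm (g1 \<tau> - g2 \<tau>) \<le> exp (L * \<tau>) * norm (g1 0 - g2 0)"
proof -
  define d where "d r = g1 r - g2 r" for r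
  define \<psi> where "\<psi> r = exp (- 2 * L * r) * (d r \<bullet> d r)" for r
  have d: "(d has_vector_derivative A (g1 r) - A (g2 r)) (at r within {0..})" if "0 \<le> r" for r
    unfolding d_def using assms(2,3) that by (auto simp: solves_def intro!: derivative_intros)
  define \<psi>' where "\<psi>' r = exp (- 2 * L * r) * (2 * (d r \<bullet> (A (g1 r) - A (g2 r))) - 2 * L * (d r \<bullet> d r))" for r
  have \<psi>: "(\<psi> has_derivative (\<lambda>h. h * \<psi>' r)) (at r within {0..\<tau>})" if "0 \<le> r" for r
  proof -
    have d': "(d has_derivative (\<lambda>h. h *\<^sub>R (A (g1 r) - A (g2 r)))) (at r within {0..\<tau>})"
      using d[OF that] by (auto simp: has_vector_derivative_def intro: has_derivative_subset)
    show ?thesis unfolding \<psi>_def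
      by (rule has_derivative_eq_rhs, (rule derivative_intros d')+)
        (auto simp: \<psi>'_def inner_commute algebra_simps)
  qed
  have "\<psi> \<tau> \<le> \<psi> 0"
  proof (cases "\<tau> = 0")
    case False
    then have "0 < \<tau>" using assms by simp
    from mvt_simple[OF this \<psi>]
    obtain z where z: "0 < z" "z < \<tau>" "\<psi> \<tau> - \<psi> 0 = \<tau> * \<psi>' z" by auto
    have "d z \<bullet> (A (g1 z) - A (g2 z)) \<le> norm (d z) * norm (A (g1 z) - A (g2 z))"
      by (rule norm_cauchy_schwarz)
    also have "\<dots> \<le> norm (d z) * (L * norm (d z))"
      using lip by (intro mult_left_mono) (auto simp: d_def)
    finally have "2 * (d z \<bullet> (A (g1 z) - A (g2 z))) - 2 * L * (d z \<bullet> d z) \<le> 0"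
      by (simp add: dot_square_norm power2_eq_square mult_ac)
    then have "\<psi> \<tau> - \<psi> 0 \<le> 0"
      unfolding z(3) \<psi>'_def using \<open>0 < \<tau>\<close> by (simp add: mult_nonneg_nonpos)
    then show ?thesis by simp
  qed simp
  then have "exp (- 2 * L * \<tau>) * (norm (d \<tau>))\<^sup>2 \<le> (norm (d 0))\<^sup>2"
    by (simp add: \<psi>_def dot_square_norm)
  then have "exp (2 * L * \<tau>) * (exp (- 2 * L * \<tau>) * (norm (d \<tau>))\<^sup>2) \<le> exp (2 * L * \<tau>) * (norm (d 0))\<^sup>2"
    by (rule mult_left_mono) simp
  then have "(norm (d \<tau>))\<^sup>2 \<le> (exp (L * \<tau>) * norm (d 0))\<^sup>2"
    by (simp add: power_mult_distrib exp_minus field_simps exp_double[of "L * \<tau>", symmetric])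
  then show ?thesis unfolding d_def by (rule power2_le_imp_le) simp
qed

lemma solves_unique:
  fixes A :: "'a::euclidean_space \<Rightarrow> 'a"
  assumes "\<And>x y. norm (A x - A y) \<le> L * norm (x - y)"
    and "solves A g1" "solves A g2" "g1 0 = g2 0" "0 \<le> \<tau>"
  shows "g1 \<tau> = g2 \<tau>"
  using solves_dist_le[OF assms(1-3,5)] assms(4) by simp

lemma solves_shift:
  assumes "solves A g" "0 \<le> c"
  shows "solves A (\<lambda>\<tau>. g (\<tau> + c))"
  unfolding solves_def
proof (intro allI impI)
  fix \<tau> :: real assume "0 \<le> \<tau>"
  then have "(g has_vector_derivative A (g (\<tau> + c))) (at (\<tau> + c) within {0..})"
    using assms by (simp add: solves_def)
  then have "(g has_vector_derivative A (g (\<tau> + c))) (at (\<tau> + c) within (\<lambda>r. r + c) ` {0..})"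
    by (rule has_vector_derivative_within_subset) (use assms(2) in auto)
  moreover have "((\<lambda>r. r + c) has_vector_derivative 1) (at \<tau> within {0..})"
    using has_vector_derivative_add[OF has_vector_derivative_id has_vector_derivative_const] by simp
  ultimately have "((g \<circ> (\<lambda>r. r + c)) has_vector_derivative (1 *\<^sub>R A (g (\<tau> + c)))) (at \<tau> within {0..})"
    by (intro vector_diff_chain_within)
  then show "((\<lambda>r. g (r + c)) has_vector_derivative A (g (\<tau> + c))) (at \<tau> within {0..})"
    by (simp add: o_def)
qed

text \<open>A single explicit Euler step has error of order \<open>h\<^sup>2\<close>: within the
  step \<open>g\<close> moves by at most \<open>h\<close> times its maximal speed, so the derivative
  \<open>A (g r)\<close> varies by at most \<open>L\<close> times that. Comparison with the zero
  solution bounds \<open>g\<close>, hence its speed, on \<open>[0, S]\<close>.\<close>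

lemma solves_local_error:
  fixes A :: "'a::euclidean_space \<Rightarrow> 'a"
  assumes lip: "\<And>x y. norm (A x - A y) \<le> L * norm (x - y)" and A0: "A 0 = 0" and L: "0 < L"
    and g: "solves A g" and \<tau>: "0 \<le> \<tau>" "0 \<le> h" "\<tau> + h \<le> S"
  shows "norm (g (\<tau> + h) - g \<tau> - h *\<^sub>R A (g \<tau>)) \<le> h\<^sup>2 * L\<^sup>2 * exp (L * S) * norm (g 0)"
proof -
  define B where "B = exp (L * S) * norm (g 0)"
  have zero: "solves A (\<lambda>_. 0)" by (simp add: solves_def A0)
  have bound: "norm (g r) \<le> B" if "0 \<le> r" "r \<le> S" for r
  proof -
    have "norm (g r) \<le> exp (L * r) * norm (g 0)"
      using solves_dist_le[OF lip g zero that(1)] by simp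
    also have "\<dots> \<le> B" unfolding B_def using that L by (intro mult_right_mono) auto
    finally show ?thesis .
  qed
  have deriv: "(g has_vector_derivative A (g r)) (at r within {\<tau>..\<tau> + h})" if "r \<in> {\<tau>..\<tau> + h}" for r
    by (rule has_vector_derivative_within_subset[of g _ _ "{0..}"])
      (use g \<tau> that in \<open>auto simp: solves_def\<close>)
  have normA: "norm (A x) \<le> L * norm x" for x using lip[of x 0] A0 by simp
  have diff: "norm (g r - g \<tau>) \<le> h * (L * B)" if r: "r \<in> {\<tau>..\<tau> + h}" for r
  proof -
    have "norm (g r - g \<tau>) \<le> (L * B) * norm (r - \<tau>)"
    proof (rule differentiable_bound[OF convex_real_interval(5)])
      show "(g has_derivative (\<lambda>x. x *\<^sub>R A (g q))) (at q within {\<tau>..\<tau> + h})" if "q \<in> {\<tau>..\<tau> + h}" for q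
        using deriv[OF that] by (simp add: has_vector_derivative_def)
      show "onorm (\<lambda>x. x *\<^sub>R A (g q)) \<le> L * B" if q: "q \<in> {\<tau>..\<tau> + h}" for q
      proof (rule onorm_bound)
        have "norm (A (g q)) \<le> L * norm (g q)" by (rule normA)
        also have "\<dots> \<le> L * B" using q \<tau> L bound[of q] by (intro mult_left_mono) auto
        finally show "norm (x *\<^sub>R A (g q)) \<le> L * B * norm x" for x
          by (simp add: mult.commute mult_left_mono)
      qed (use L in \<open>auto simp: B_def\<close>)
    qed (use \<tau> r in auto)
    also have "\<dots> \<le> (L * B) * h" using r L by (intro mult_left_mono) (auto simp: B_def)
    finally show ?thesis by (simp add: mult.commute)
  qed
  have "norm (g (\<tau> + h) - g \<tau> - ((\<tau> + h) - \<tau>) *\<^sub>R A (g \<tau>)) \<le> norm ((\<tau> + h) - \<tau>) * (L * (h * (L * B)))"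
  proof (rule vector_differentiable_bound_linearization[where S = "{\<tau>..\<tau> + h}" and f' = "\<lambda>r. A (g r)"])
    show "norm (A (g r) - A (g \<tau>)) \<le> L * (h * (L * B))" if "r \<in> {\<tau>..\<tau> + h}" for r
      using lip[of "g r" "g \<tau>"] mult_left_mono[OF diff[OF that], of L] L by linarith
  qed (use \<tau> deriv in \<open>auto simp: closed_segment_eq_real_ivl\<close>)
  then show ?thesis using \<tau> by (simp add: B_def power2_eq_square mult_ac)
qed

section \<open>Lower transition operators and Euler products\<close>

lemma infnorm_le_iff: "infnorm (v :: real^'n) \<le> c \<longleftrightarrow> (\<forall>i. \<bar>v $ i\<bar> \<le> c)"
proof
  assume "\<forall>i. \<bar>v $ i\<bar> \<le> c"
  then show "infnorm v \<le> c" unfolding infnorm_cart by (intro cSup_least) auto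
qed (meson component_le_infnorm_cart order_trans)

lemma abs_matrix_vector_component_le:
  "\<bar>(B *v f) $ x\<bar> \<le> (\<Sum>y\<in>UNIV. \<bar>(B :: real^'n^'m) $ x $ y\<bar>) * infnorm f"
proof -
  have "\<bar>(B *v f) $ x\<bar> \<le> (\<Sum>y\<in>UNIV. \<bar>B $ x $ y * f $ y\<bar>)"
    unfolding matrix_vector_mult_def by (simp add: sum_abs)
  also have "\<dots> \<le> (\<Sum>y\<in>UNIV. \<bar>B $ x $ y\<bar> * infnorm f)"
    by (intro sum_mono) (simp add: abs_mult component_le_infnorm_cart mult_left_mono)
  finally show ?thesis by (simp add: sum_distrib_right)
qed

lemma infnorm_matrix_vector_le:
  "infnorm (B *v f) \<le> (\<Sum>x\<in>UNIV. \<Sum>y\<in>UNIV. \<bar>(B :: real^'n^'m) $ x $ y\<bar>) * infnorm f"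
  unfolding infnorm_le_iff
proof
  fix x
  have "(\<Sum>y\<in>UNIV. \<bar>B $ x $ y\<bar>) \<le> (\<Sum>x\<in>UNIV. \<Sum>y\<in>UNIV. \<bar>B $ x $ y\<bar>)"
    by (rule member_le_sum[where f = "\<lambda>x. \<Sum>y\<in>UNIV. \<bar>B $ x $ y\<bar>"]) (auto intro: sum_nonneg)
  then show "\<bar>(B *v f) $ x\<bar> \<le> (\<Sum>x\<in>UNIV. \<Sum>y\<in>UNIV. \<bar>B $ x $ y\<bar>) * infnorm f"
    using abs_matrix_vector_component_le[of B f x] mult_right_mono[OF _ infnorm_pos_le]
    by (meson order_trans)
qed

text \<open>Shows that the unit sphere is nonempty, so that the supremum defining
  \<open>opnorm\<close> can be bounded from above.\<close>

lemma infnorm_one: "infnorm (1 :: real^'n) = 1"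
  by (rule antisym) (auto simp: infnorm_le_iff intro: order_trans[OF _ component_le_infnorm_cart])

lemma opnorm_le:
  fixes A :: "real^'x::finite \<Rightarrow> real^'x"
  assumes "\<And>f. infnorm f = 1 \<Longrightarrow> infnorm (A f) \<le> c"
  shows "opnorm A \<le> c"
  unfolding opnorm_def using assms infnorm_one by (intro cSUP_least) auto

text \<open>The constant \<open>c\<close> serves to make the supremum range over a set that is
  bounded above.\<close>

lemma infnorm_le_opnorm:
  fixes A :: "real^'x::finite \<Rightarrow> real^'x"
  assumes "\<And>f. infnorm f = 1 \<Longrightarrow> infnorm (A f) \<le> c" and "infnorm f = 1"
  shows "infnorm (A f) \<le> opnorm A"
  unfolding opnorm_def using assms by (intro cSUP_upper) (auto intro!: bdd_aboveI2)

lemma matnorm_le: "matnorm B \<le> (\<Sum>x\<in>UNIV. \<Sum>y\<in>UNIV. \<bar>B $ x $ y\<bar>)"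
  unfolding matnorm_def
proof (rule opnorm_le)
  fix f :: "real^'a" assume "infnorm f = 1"
  then show "infnorm (B *v f) \<le> (\<Sum>x\<in>UNIV. \<Sum>y\<in>UNIV. \<bar>B $ x $ y\<bar>)"
    using infnorm_matrix_vector_le[of B f] by simp
qed

lemma infnorm_axis: "infnorm (axis y 1 :: real^'n) = 1"
proof (rule antisym)
  show "infnorm (axis y 1 :: real^'n) \<le> 1" by (simp add: infnorm_le_iff axis_def)
  show "1 \<le> infnorm (axis y 1 :: real^'n)"
    using component_le_infnorm_cart[of "axis y 1 :: real^'n" y] by (simp add: axis_def)
qed

lemma matrix_vector_axis: "((B :: real^'n^'m) *v axis y 1) $ x = B $ x $ y"
  by (simp add: matrix_vector_mult_basis column_def)

text \<open>Tested on unit coordinate vectors. Through this bound, conditions on operator norms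
  become conditions on entries, where compactness in finite dimension is available.\<close>

lemma abs_entry_le_matnorm: "\<bar>B $ x $ y\<bar> \<le> matnorm B"
proof -
  have "infnorm (B *v f) \<le> (\<Sum>x\<in>UNIV. \<Sum>y\<in>UNIV. \<bar>B $ x $ y\<bar>)" if "infnorm f = 1" for f
    using infnorm_matrix_vector_le[of B f] that by simp
  from infnorm_le_opnorm[of "\<lambda>f. B *v f", OF this infnorm_axis]
  have "infnorm (B *v axis y 1) \<le> matnorm B" by (simp add: matnorm_def)
  then show ?thesis
    using component_le_infnorm_cart[of "B *v axis y 1" x] by (simp add: matrix_vector_axis)
qed

section \<open>Lower transition operators: monotonicity, nonexpansiveness, closure
  properties\<close>

lemma lto_mono:
  assumes T: "lower_transition_operator T" and "\<And>x. f $ x \<le> g $ x"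
  shows "T f $ x \<le> T g $ x"
proof -
  have "0 \<le> Min (range (\<lambda>y. (g - f) $ y))" using assms(2) by simp
  also have "\<dots> \<le> T (g - f) $ x" using T unfolding lower_transition_operator_def by blast
  also have "T (g - f) $ x + T f $ x \<le> T (g - f + f) $ x"
    using T unfolding lower_transition_operator_def by blast
  finally show ?thesis by simp
qed

lemma lto_ge:
  assumes T: "lower_transition_operator T" and "\<And>x. c \<le> f $ x"
  shows "c \<le> T f $ x"
proof -
  have "c \<le> Min (range (\<lambda>y. f $ y))" using assms(2) by simp
  then show ?thesis using T unfolding lower_transition_operator_def by (meson order_trans)
qed

lemma lto_zero: "lower_transition_operator T \<Longrightarrow> T 0 = 0"
  unfolding lower_transition_operator_def by (metis order_refl scaleR_zero_left)

text \<open>The lower estimate is the bound by the minimum; the upper one comes from conjugacy,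
  since superadditivity gives \<open>T f + T (- f) \<le> T 0 = 0\<close>.\<close>

lemma lto_infnorm_le:
  assumes T: "lower_transition_operator T"
  shows "infnorm (T f) \<le> infnorm f"
  unfolding infnorm_le_iff
proof
  fix x
  have "- infnorm f \<le> T h $ x" if "h = f \<or> h = - f" for h
    using that by (intro lto_ge[OF T]) (metis abs_le_iff component_le_infnorm_cart infnorm_neg minus_le_iff)
  moreover have "T f $ x + T (- f) $ x \<le> T (f + - f) $ x"
    using T unfolding lower_transition_operator_def by blast
  ultimately show "\<bar>T f $ x\<bar> \<le> infnorm f" using lto_zero[OF T] by (smt (verit) add.right_inverse zero_index)
qed

lemma lto_comp:
  assumes S: "lower_transition_operator S" and T: "lower_transition_operator T"
  shows "lower_transition_operator (\<lambda>f. S (T f))"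
  unfolding lower_transition_operator_def
proof (intro conjI allI impI)
  fix f g x
  show "Min (range (\<lambda>y. f $ y)) \<le> S (T f) $ x"
    using T by (intro lto_ge[OF S]) (auto simp: lower_transition_operator_def)
  have "S (T f) $ x + S (T g) $ x \<le> S (T f + T g) $ x"
    using S unfolding lower_transition_operator_def by blast
  also have "\<dots> \<le> S (T (f + g)) $ x"
    using T by (intro lto_mono[OF S]) (auto simp: lower_transition_operator_def)
  finally show "S (T f) $ x + S (T g) $ x \<le> S (T (f + g)) $ x" .
next
  fix c :: real and f assume "0 \<le> c"
  then show "S (T (c *\<^sub>R f)) = c *\<^sub>R S (T f)"
    using S T by (simp add: lower_transition_operator_def)
qed

lemma lto_limit:
  fixes T :: "real^'x::finite \<Rightarrow> real^'x"
  assumes Tn: "\<And>n. lower_transition_operator (Tn n)" and lim: "\<And>f. (\<lambda>n::nat. Tn n f) \<longlonglongrightarrow> T f"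
  shows "lower_transition_operator T"
  unfolding lower_transition_operator_def
proof (intro conjI allI impI)
  fix f g :: "real^'x" and x :: 'x
  note lim' = tendsto_vec_nth[OF lim]
  show "Min (range (\<lambda>y. f $ y)) \<le> T f $ x"
    by (rule LIMSEQ_le_const[OF lim']) (use Tn in \<open>auto simp: lower_transition_operator_def\<close>)
  show "T f $ x + T g $ x \<le> T (f + g) $ x"
    by (rule LIMSEQ_le[OF tendsto_add[OF lim' lim'] lim'])
      (use Tn in \<open>auto simp: lower_transition_operator_def\<close>)
next
  fix c :: real and f :: "real^'x" assume "0 \<le> c"
  then have "(\<lambda>n. Tn n (c *\<^sub>R f)) = (\<lambda>n. c *\<^sub>R Tn n f)"
    using Tn by (auto simp: lower_transition_operator_def)
  then have "(\<lambda>n. c *\<^sub>R Tn n f) \<longlonglongrightarrow> T (c *\<^sub>R f)" using lim[of "c *\<^sub>R f"] by simp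
  then show "T (c *\<^sub>R f) = c *\<^sub>R T f"
    using tendsto_scaleR[OF tendsto_const lim] by (rule LIMSEQ_unique)
qed

section \<open>Partitions, and convergence of Euler products to the flow\<close>

lemma fine_partition_exists:
  assumes "t \<le> s" "0 < \<delta>"
  obtains v where "v \<in> partitions t s" "mesh v \<le> \<delta>"
proof (cases "t = s")
  case True
  then have "[t] \<in> partitions t s" "mesh [t] \<le> \<delta>"
    using assms by (auto simp: partitions_def mesh_def)
  then show ?thesis by (rule that)
next
  case False
  obtain n :: nat where n: "(s - t) / \<delta> < n" using reals_Archimedean2 by blast
  with False assms have n0: "0 < n" by (cases n) (auto simp: field_simps)
  define c where "c = (s - t) / n"
  have c: "0 < c" "c \<le> \<delta>" using False assms n n0 by (auto simp: c_def field_simps)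
  define v where "v = map (\<lambda>i. t + real i * c) [0..<Suc n]"
  have "hd v = t" by (simp add: v_def hd_map del: upt_Suc)
  moreover have "last v = s" using n0 by (simp add: v_def last_map c_def)
  moreover have "sorted_wrt (<) v"
    unfolding v_def sorted_wrt_map using c by (intro sorted_wrt_mono_rel[OF _ sorted_wrt_upt]) auto
  moreover have "v \<noteq> []" by (simp add: v_def)
  ultimately have v: "v \<in> partitions t s" by (simp add: partitions_def)
  have "v ! Suc i - v ! i = c" if "Suc i < length v" for i
    using that by (simp add: v_def algebra_simps del: upt_Suc)
  then have "{v ! Suc i - v ! i |i. Suc i < length v} \<subseteq> {c}" by auto
  then have "finite {v ! Suc i - v ! i |i. Suc i < length v}" and "\<forall>x\<in>{v ! Suc i - v ! i |i. Suc i < length v}. x \<le> \<delta>"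
    using c by (auto intro: finite_subset)
  then have "mesh v \<le> \<delta>"
    unfolding mesh_def using assms by (subst Max_le_iff) auto
  with v show ?thesis by (rule that)
qed

text \<open>Unlike a maximum over the whole list, \<open>successively\<close> passes directly to
  tails, which suits the recursion of \<open>euler_product\<close>.\<close>

lemma partitions_successively:
  assumes "v \<in> partitions t s" "mesh v \<le> \<delta>"
  shows "successively (\<lambda>a b. a < b \<and> b - a \<le> \<delta>) v"
  unfolding successively_conv_nth
proof (intro allI impI)
  fix i assume i: "Suc i < length v"
  have "{v ! Suc i - v ! i |i. Suc i < length v} \<subseteq> (\<lambda>i. v ! Suc i - v ! i) ` {..<length v}" by auto
  then have "finite (insert 0 {v ! Suc i - v ! i |i. Suc i < length v})"
    using finite_subset by blast
  then have "v ! Suc i - v ! i \<le> mesh v"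
    unfolding mesh_def using i by (intro Max_ge) auto
  moreover have "v ! i < v ! Suc i"
    using assms(1) i by (auto simp: partitions_def sorted_wrt_iff_nth_less)
  ultimately show "v ! i < v ! Suc i \<and> v ! Suc i - v ! i \<le> \<delta>" using assms(2) by simp
qed

text \<open>A whole solution is chosen for each initial value and only then evaluated, so the choice
  is the same for all times.\<close>

definition flow :: "('a \<Rightarrow> 'a) \<Rightarrow> real \<Rightarrow> 'a \<Rightarrow> 'a::euclidean_space" where
  "flow A \<tau> f = (SOME g. solves A g \<and> g 0 = f) \<tau>"

text \<open>\<open>L\<close> plays two roles: it is the Lipschitz constant and it limits the step
  sizes for which an Euler step is a lower transition operator.\<close>

locale rate_operator =
  fixes A :: "real^'x::finite \<Rightarrow> real^'x" and L :: real
  assumes lip: "norm (A f - A g) \<le> L * norm (f - g)"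
    and L_pos: "0 < L"
    and step: "0 \<le> h \<Longrightarrow> h * L \<le> 1 \<Longrightarrow> lower_transition_operator (\<lambda>f. f + h *\<^sub>R A f)"
begin

text \<open>The Euler step of length \<open>1 / L\<close> is homogeneous and hence fixes 0.\<close>

lemma zero: "A 0 = 0"
  using lto_zero[OF step[of "1 / L"]] L_pos by simp

lemma flow_solves: "solves A (\<lambda>\<tau>. flow A \<tau> f)" and flow_0: "flow A 0 f = f"
proof -
  have "\<exists>g. solves A g \<and> g 0 = f"
    by (rule lipschitz_ode_solution[OF lip zero L_pos]) auto
  from someI_ex[OF this] show "solves A (\<lambda>\<tau>. flow A \<tau> f)" "flow A 0 f = f"
    by (simp_all add: flow_def)
qed

lemma flow_unique: "solves A g \<Longrightarrow> 0 \<le> \<tau> \<Longrightarrow> flow A \<tau> (g 0) = g \<tau>"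
  using solves_unique[OF lip flow_solves, of g "g 0"] by (simp add: flow_0)

lemma flow_add:
  assumes "0 \<le> a" "0 \<le> b"
  shows "flow A (a + b) f = flow A a (flow A b f)"
  using flow_unique[OF solves_shift[OF flow_solves assms(2)] assms(1)] by simp

lemma euler_product_lto:
  assumes "successively (\<lambda>a b. a < b \<and> b - a \<le> \<delta>) v" "\<delta> * L \<le> 1"
  shows "lower_transition_operator (euler_product A v)"
  using assms(1)
proof (induction v rule: induct_list012)
  case (3 a b v)
  have "(b - a) * L \<le> \<delta> * L" using 3(3) L_pos by (intro mult_right_mono) auto
  then have "lower_transition_operator (\<lambda>f. f + (b - a) *\<^sub>R A f)"
    using 3(3) assms(2) by (intro step) auto
  moreover have "euler_product A (a # b # v) = (\<lambda>f. euler_product A (b # v) f + (b - a) *\<^sub>R A (euler_product A (b # v) f))"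
    by (auto simp: Let_def)
  ultimately show ?case using lto_comp[of _ "euler_product A (b # v)"] 3 by simp
qed (auto simp: lower_transition_operator_def)

text \<open>A discrete Gronwall argument: each step multiplies the inherited error by at most
  \<open>1 + L * h \<le> exp (L * h)\<close> and adds a local error of at most a constant times
  \<open>\<delta> * h\<close>. The induction prepends times, because the last factor acts on
  \<open>f\<close> first. A fixed bound \<open>S\<close> on the total length keeps the constant of
  the local error the same in all steps.\<close>

lemma euler_product_error:
  assumes "successively (\<lambda>a b. a < b \<and> b - a \<le> \<delta>) v" "v \<noteq> []" "last v - hd v \<le> S" "0 \<le> \<delta>"
  shows "hd v \<le> last v \<and> norm (euler_product A v f - flow A (last v - hd v) f)
    \<le> L\<^sup>2 * exp (L * S) * norm f * \<delta> * (last v - hd v) * exp (L * (last v - hd v))"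
  using assms(1-3)
proof (induction v rule: induct_list012)
  case (3 a b v)
  define h where "h = b - a"
  define r where "r = last (b # v) - b"
  define C where "C = L\<^sup>2 * exp (L * S) * norm f"
  have C: "0 \<le> C" by (simp add: C_def)
  have h: "0 < h" "h \<le> \<delta>" using 3(3) by (auto simp: h_def)
  define e where "e = euler_product A (b # v) f"
  have IH: "0 \<le> r" "norm (e - flow A r f) \<le> C * \<delta> * r * exp (L * r)"
    using 3 by (auto simp: r_def e_def C_def)
  have rh: "last (a # b # v) - hd (a # b # v) = r + h" by (simp add: r_def h_def)
  have S: "r + h \<le> S" using 3(5) rh by simp
  have "norm (e + h *\<^sub>R A e - flow A (r + h) f)
      \<le> norm (e - flow A r f) + h * norm (A e - A (flow A r f))
        + norm (flow A (r + h) f - flow A r f - h *\<^sub>R A (flow A r f))"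
  proof -
    \<comment> \<open>Inherited error of the tail, its amplification by \<open>A\<close>, and the
      local error of one step started on the exact solution.\<close>
    have eq: "e + h *\<^sub>R A e - flow A (r + h) f = (e - flow A r f) + h *\<^sub>R (A e - A (flow A r f))
        - (flow A (r + h) f - flow A r f - h *\<^sub>R A (flow A r f))"
      by (simp add: algebra_simps)
    have "norm (h *\<^sub>R (A e - A (flow A r f))) = h * norm (A e - A (flow A r f))"
      using h by simp
    then show ?thesis unfolding eq
      using norm_triangle_ineq[of "e - flow A r f" "h *\<^sub>R (A e - A (flow A r f))"]
        norm_triangle_ineq4[of "(e - flow A r f) + h *\<^sub>R (A e - A (flow A r f))"
          "flow A (r + h) f - flow A r f - h *\<^sub>R A (flow A r f)"]
      by linarith
  qed
  also have "\<dots> \<le> C * \<delta> * r * exp (L * r) + h * (L * (C * \<delta> * r * exp (L * r))) + C * \<delta> * h"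
  proof (intro add_mono mult_left_mono)
    show "norm (A e - A (flow A r f)) \<le> L * (C * \<delta> * r * exp (L * r))"
      using lip[of e "flow A r f"] mult_left_mono[OF IH(2), of L] L_pos by linarith
    have "norm (flow A (r + h) f - flow A r f - h *\<^sub>R A (flow A r f)) \<le> h\<^sup>2 * L\<^sup>2 * exp (L * S) * norm f"
      using solves_local_error[OF lip zero L_pos flow_solves, of r h S f] IH h S by (simp add: flow_0)
    also have "\<dots> = C * h * h" by (simp add: C_def power2_eq_square)
    also have "\<dots> \<le> C * \<delta> * h" using C h by (intro mult_right_mono mult_left_mono) auto
    finally show "norm (flow A (r + h) f - flow A r f - h *\<^sub>R A (flow A r f)) \<le> C * \<delta> * h" .
  qed (use IH h in auto)
  also have "\<dots> = C * \<delta> * (r * (exp (L * r) * (1 + L * h)) + h)" by (simp add: algebra_simps)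
  also have "\<dots> \<le> C * \<delta> * (r * exp (L * (r + h)) + h * exp (L * (r + h)))"
  proof (intro mult_left_mono add_mono)
    have "exp (L * r) * (1 + L * h) \<le> exp (L * r) * exp (L * h)"
      by (intro mult_left_mono exp_ge_add_one_self) auto
    then show "exp (L * r) * (1 + L * h) \<le> exp (L * (r + h))" by (simp add: exp_add distrib_left)
    show "h \<le> h * exp (L * (r + h))" using h IH L_pos by simp
  qed (use IH h C assms(4) in auto)
  also have "\<dots> = C * \<delta> * (r + h) * exp (L * (r + h))" by (simp add: algebra_simps)
  finally have main: "norm (e + h *\<^sub>R A e - flow A (r + h) f) \<le> C * \<delta> * (r + h) * exp (L * (r + h))" .
  have e': "euler_product A (a # b # v) f = e + h *\<^sub>R A e" by (simp add: Let_def e_def h_def)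
  have "hd (a # b # v) \<le> last (a # b # v)" using rh IH h by linarith
  then show ?case using main unfolding rh e' C_def[symmetric] by blast
qed (auto simp: flow_0)

lemma euler_product_error_partition:
  assumes "v \<in> partitions t s" "mesh v \<le> \<delta>" "0 \<le> \<delta>"
  shows "norm (euler_product A v f - flow A (s - t) f)
    \<le> L\<^sup>2 * exp (L * (s - t)) * (s - t) * exp (L * (s - t)) * norm f * \<delta>"
  using euler_product_error[OF partitions_successively[OF assms(1,2)], of "s - t"] assms(1,3)
  by (simp add: partitions_def mult_ac)

text \<open>The defining inequalities are closed under pointwise limits, so the flow inherits them
  from Euler products.\<close>

lemma flow_lto:
  assumes "0 \<le> \<tau>"
  shows "lower_transition_operator (flow A \<tau>)"
proof -
  define K where "K = L\<^sup>2 * exp (L * \<tau>) * \<tau> * exp (L * \<tau>)"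
  \<comment> \<open>The bound \<open>1 / L\<close> makes every Euler step a lower transition
    operator; the other drives the error to 0.\<close>
  define d where "d n = min (1 / L) (1 / real (Suc n))" for n
  have d: "0 < d n" for n using L_pos by (simp add: d_def)
  have "\<exists>v. v \<in> partitions 0 \<tau> \<and> mesh v \<le> d n" for n
    using fine_partition_exists[OF assms d] by metis
  then obtain v where v: "\<And>n. v n \<in> partitions 0 \<tau>" "\<And>n. mesh (v n) \<le> d n" by metis
  have lim0: "(\<lambda>n. K * norm f * (1 / real (Suc n))) \<longlonglongrightarrow> 0" for f :: "real^'x"
    using tendsto_mult_right[OF LIMSEQ_Suc[OF lim_1_over_n], of "K * norm f"] by simp
  show ?thesis
  proof (rule lto_limit)
    show "lower_transition_operator (euler_product A (v n))" for n
      by (rule euler_product_lto[OF partitions_successively[OF v(1) v(2)]])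
        (use L_pos in \<open>auto simp: d_def min_def field_simps\<close>)
    fix f
    have "norm (euler_product A (v n) f - flow A \<tau> f) \<le> K * norm f * (1 / real (Suc n))" for n
    proof -
      have "norm (euler_product A (v n) f - flow A \<tau> f) \<le> K * norm f * d n"
        using euler_product_error_partition[OF v(1) v(2) less_imp_le[OF d]] by (simp add: K_def)
      also have "\<dots> \<le> K * norm f * (1 / real (Suc n))"
        using assms by (intro mult_left_mono) (auto simp: d_def K_def)
      finally show ?thesis .
    qed
    then have "(\<lambda>n. euler_product A (v n) f - flow A \<tau> f) \<longlonglongrightarrow> 0"
      by (intro Lim_null_comparison[OF _ lim0] always_eventually allI)
    then show "(\<lambda>n. euler_product A (v n) f) \<longlonglongrightarrow> flow A \<tau> f" by (simp add: LIM_zero_iff)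
  qed
qed

text \<open>Existence in the definite description is the Euler error estimate. For uniqueness, a
  competitor and the flow are compared on unit vectors with the Euler product of one partition that
  is fine enough for both; homogeneity extends the equality to all \<open>f\<close>.\<close>

lemma lower_transition_eq_flow:
  assumes "t \<le> s"
  shows "lower_transition A t s = flow A (s - t)"
  unfolding lower_transition_def
proof (rule the_equality, intro conjI allI impI)
  have lto: "lower_transition_operator (flow A (s - t))" using assms by (intro flow_lto) simp
  show "lower_transition_operator (flow A (s - t))" by (fact lto)
  \<comment> \<open>The factor \<open>sqrt DIM(real^'x)\<close> bounds the Euclidean norm of a
    vector whose maximum norm is 1.\<close>
  define K where "K = L\<^sup>2 * exp (L * (s - t)) * (s - t) * exp (L * (s - t)) * sqrt DIM(real^'x)"
  have K: "0 \<le> K" using assms by (simp add: K_def)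
  show conv: "\<exists>\<delta>>0. \<forall>v\<in>partitions t s. mesh v \<le> \<delta> \<longrightarrow> opnorm (\<lambda>f. flow A (s - t) f - euler_product A v f) \<le> \<epsilon>"
    if "0 < \<epsilon>" for \<epsilon>
  proof (intro exI conjI ballI impI)
    \<comment> \<open>The summand 1 avoids a division by 0, as \<open>K = 0\<close> when
      \<open>t = s\<close>.\<close>
    show \<delta>: "0 < \<epsilon> / (K + 1)" using that K by simp
    fix v assume v: "v \<in> partitions t s" "mesh v \<le> \<epsilon> / (K + 1)"
    show "opnorm (\<lambda>f. flow A (s - t) f - euler_product A v f) \<le> \<epsilon>"
    proof (rule opnorm_le)
      fix f :: "real^'x" assume f: "infnorm f = 1"
      have "infnorm (flow A (s - t) f - euler_product A v f) \<le> norm (euler_product A v f - flow A (s - t) f)"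
        by (metis infnorm_le_norm norm_minus_commute)
      also have "\<dots> \<le> L\<^sup>2 * exp (L * (s - t)) * (s - t) * exp (L * (s - t)) * norm f * (\<epsilon> / (K + 1))"
        by (rule euler_product_error_partition[OF v]) (use \<delta> in simp)
      also have "\<dots> \<le> K * (\<epsilon> / (K + 1))" unfolding K_def
        using norm_le_infnorm[of f] f \<delta> assms by (intro mult_right_mono mult_left_mono) (auto simp: K_def)
      also have "\<dots> \<le> \<epsilon>" using K that by (simp add: field_simps)
      finally show "infnorm (flow A (s - t) f - euler_product A v f) \<le> \<epsilon>" .
    qed
  qed
  fix T assume T: "lower_transition_operator T \<and> (\<forall>\<epsilon>>0. \<exists>\<delta>>0. \<forall>v\<in>partitions t s.
        mesh v \<le> \<delta> \<longrightarrow> opnorm (\<lambda>f. T f - euler_product A v f) \<le> \<epsilon>)"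
  then have T1: "lower_transition_operator T" by simp
  have eq1: "T f = flow A (s - t) f" if f: "infnorm f = 1" for f
  proof -
    have "infnorm (T f - flow A (s - t) f) \<le> \<epsilon>" if "0 < \<epsilon>" for \<epsilon>
    proof -
      have \<epsilon>: "0 < \<epsilon> / 2" using that by simp
      obtain \<delta> where "0 < \<delta>" and \<delta>1: "\<And>v. v \<in> partitions t s \<Longrightarrow> mesh v \<le> \<delta> \<Longrightarrow>
          opnorm (\<lambda>f. T f - euler_product A v f) \<le> \<epsilon> / 2"
        using conjunct2[OF T, rule_format, OF \<epsilon>] by blast
      moreover obtain \<delta>' where "0 < \<delta>'" and \<delta>2: "\<And>v. v \<in> partitions t s \<Longrightarrow> mesh v \<le> \<delta>' \<Longrightarrow>
          opnorm (\<lambda>f. flow A (s - t) f - euler_product A v f) \<le> \<epsilon> / 2"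
        using conv[OF \<epsilon>] by blast
      ultimately have \<delta>: "0 < \<delta>" "0 < \<delta>'" by simp_all
      obtain v where v: "v \<in> partitions t s" "mesh v \<le> min (1 / L) (min \<delta> \<delta>')"
        using fine_partition_exists[OF assms, of "min (1 / L) (min \<delta> \<delta>')"] \<delta> L_pos by auto
      have lto_v: "lower_transition_operator (euler_product A v)"
        by (rule euler_product_lto[OF partitions_successively[OF v]])
          (use L_pos in \<open>auto simp: min_def field_simps\<close>)
      \<comment> \<open>Both operators are nonexpansive, so their difference is bounded on the unit
        sphere and \<open>opnorm\<close> is an honest supremum. For the Euler product this uses the
        mesh bound \<open>1 / L\<close>.\<close>
      have bnd: "infnorm (S h - euler_product A v h) \<le> 2"
        if "lower_transition_operator S" "infnorm h = 1" for S h
        using infnorm_triangle[of "S h" "- euler_product A v h"] lto_infnorm_le[OF that(1), of h]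
          lto_infnorm_le[OF lto_v, of h] that(2) by (simp add: infnorm_neg)
      have "infnorm (T f - euler_product A v f) \<le> \<epsilon> / 2"
        using infnorm_le_opnorm[of "\<lambda>f. T f - euler_product A v f", OF bnd[OF T1] f] \<delta>1[of v] v by simp
      moreover have "infnorm (flow A (s - t) f - euler_product A v f) \<le> \<epsilon> / 2"
        using infnorm_le_opnorm[of "\<lambda>f. flow A (s - t) f - euler_product A v f", OF bnd[OF lto] f]
          \<delta>2[of v] v by simp
      ultimately show ?thesis
        using infnorm_triangle[of "T f - euler_product A v f" "euler_product A v f - flow A (s - t) f"]
        by (simp add: infnorm_sub)
    qed
    then have "infnorm (T f - flow A (s - t) f) \<le> 0" by (rule field_le_epsilon) simp
    then show ?thesis using infnorm_pos_lt[of "T f - flow A (s - t) f"] by auto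
  qed
  show "T = flow A (s - t)"
  proof
    fix f
    show "T f = flow A (s - t) f"
    proof (cases "f = 0")
      case True
      then show ?thesis using lto_zero[OF T1] lto_zero[OF lto] by simp
    next
      case False
      define c where "c = infnorm f"
      have c: "0 < c" using False by (simp add: c_def infnorm_pos_lt)
      have "infnorm ((1 / c) *\<^sub>R f) = 1" using c by (simp add: infnorm_mul c_def)
      then have "T ((1 / c) *\<^sub>R f) = flow A (s - t) ((1 / c) *\<^sub>R f)" by (rule eq1)
      then have "(1 / c) *\<^sub>R T f = (1 / c) *\<^sub>R flow A (s - t) f"
        using T1 lto c by (simp add: lower_transition_operator_def)
      then show ?thesis using c by simp
    qed
  qed
qed

end

section \<open>The lower envelope of a bounded set of rate matrices\<close>

lemma lower_envelope_le:
  assumes "bdd_below ((\<lambda>Q. (Q *v f) $ x) ` \<Q>)" "Q \<in> \<Q>"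
  shows "lower_envelope \<Q> f $ x \<le> (Q *v f) $ x"
  unfolding lower_envelope_def using cINF_lower[OF assms] by simp

lemma lower_envelope_ge:
  assumes "\<Q> \<noteq> {}" "\<And>Q. Q \<in> \<Q> \<Longrightarrow> c \<le> (Q *v f) $ x"
  shows "c \<le> lower_envelope \<Q> f $ x"
  unfolding lower_envelope_def using cINF_greatest[OF assms] by simp

text \<open>Besides \<open>\<Q>\<close> itself, singletons are instances; there the envelope is the
  matrix and the flow is its exponential.\<close>

locale rate_matrix_set =
  fixes \<Q> :: "(real^'x^'x::finite) set" and M :: real
  assumes nonempty: "\<Q> \<noteq> {}" and rates: "\<Q> \<subseteq> rate_matrices"
    and entry_le: "Q \<in> \<Q> \<Longrightarrow> \<bar>Q $ x $ y\<bar> \<le> M"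
begin

abbreviation lower where "lower \<equiv> lower_envelope \<Q>"

lemma M_nonneg: "0 \<le> M"
  using nonempty entry_le abs_ge_zero order_trans by blast

lemma component_le: "Q \<in> \<Q> \<Longrightarrow> \<bar>(Q *v f) $ x\<bar> \<le> CARD('x) * M * infnorm f"
proof -
  assume Q: "Q \<in> \<Q>"
  have "(\<Sum>y\<in>UNIV. \<bar>Q $ x $ y\<bar>) \<le> CARD('x) * M"
    using sum_bounded_above[of UNIV "\<lambda>y. \<bar>Q $ x $ y\<bar>" M] entry_le[OF Q] by simp
  then show ?thesis
    using abs_matrix_vector_component_le[of Q f x] mult_right_mono[OF _ infnorm_pos_le]
    by (meson order_trans)
qed

lemma bdd: "bdd_below ((\<lambda>Q. (Q *v f) $ x) ` \<Q>)"
  by (rule bdd_belowI2[of _ "- (CARD('x) * M * infnorm f)"]) (use component_le in \<open>auto simp: abs_le_iff minus_le_iff\<close>)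

lemma lower_le: "Q \<in> \<Q> \<Longrightarrow> lower f $ x \<le> (Q *v f) $ x"
  using lower_envelope_le[OF bdd] .

text \<open>An infimum of functionals with a common Lipschitz constant keeps that constant.\<close>

lemma lower_diff_le: "lower f $ x - lower g $ x \<le> CARD('x) * M * norm (f - g)"
proof -
  have "lower f $ x - CARD('x) * M * norm (f - g) \<le> lower g $ x"
  proof (rule lower_envelope_ge[OF nonempty])
    fix Q assume Q: "Q \<in> \<Q>"
    have "lower f $ x - (Q *v g) $ x \<le> (Q *v (f - g)) $ x"
      using lower_le[OF Q, of f x] by (simp add: matrix_vector_mult_diff_distrib)
    also have "\<dots> \<le> CARD('x) * M * infnorm (f - g)"
      using component_le[OF Q, of "f - g" x] by simp
    also have "\<dots> \<le> CARD('x) * M * norm (f - g)"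
      using M_nonneg by (intro mult_left_mono infnorm_le_norm) auto
    finally show "lower f $ x - CARD('x) * M * norm (f - g) \<le> (Q *v g) $ x" by simp
  qed
  then show ?thesis by simp
qed

lemma lower_superadditive: "lower f $ x + lower g $ x \<le> lower (f + g) $ x"
  by (rule lower_envelope_ge[OF nonempty])
    (auto simp: matrix_vector_right_distrib intro!: add_mono lower_le)

lemma lower_scale_le: "0 \<le> c \<Longrightarrow> c * lower f $ x \<le> lower (c *\<^sub>R f) $ x"
  by (rule lower_envelope_ge[OF nonempty])
    (auto simp: matrix_vector_mult_scaleR intro!: mult_left_mono lower_le)

lemma lower_zero: "lower 0 = 0"
  using nonempty by (simp add: lower_envelope_def vec_eq_iff)

lemma lower_scale: "0 \<le> c \<Longrightarrow> lower (c *\<^sub>R f) = c *\<^sub>R lower f"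
proof (cases "c = 0")
  case False
  assume "0 \<le> c"
  with False have c: "0 < c" by simp
  have "lower (c *\<^sub>R f) $ x = c * lower f $ x" for x
    \<comment> \<open>The reverse inequality is the same lemma for \<open>1 / c\<close> and
      \<open>c *\<^sub>R f\<close>.\<close>
    using lower_scale_le[of c f x] lower_scale_le[of "1 / c" "c *\<^sub>R f" x] c by (simp add: field_simps)
  then show ?thesis by (simp add: vec_eq_iff)
qed (simp add: lower_zero)

text \<open>Rows sum to zero, so \<open>f\<close> may be replaced by the nonnegative
  \<open>f - m\<close>. Off-diagonal entries then contribute nonnegatively, and the diagonal entry
  is at least \<open>- M\<close>. Consequently an Euler step with \<open>h * M \<le> 1\<close>
  respects lower bounds.\<close>

lemma lower_ge_min:
  assumes m: "\<And>y. m \<le> f $ y"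
  shows "- M * (f $ x - m) \<le> lower f $ x"
proof (rule lower_envelope_ge[OF nonempty])
  fix Q assume Q: "Q \<in> \<Q>"
  have row: "(\<Sum>y\<in>UNIV. Q $ x $ y) = 0" and off: "\<And>y. x \<noteq> y \<Longrightarrow> 0 \<le> Q $ x $ y"
    using rates Q by (auto simp: rate_matrices_def)
  have "- M * (f $ x - m) \<le> Q $ x $ x * (f $ x - m)"
    using entry_le[OF Q, of x x] m[of x] by (intro mult_right_mono) auto
  also have "\<dots> \<le> (\<Sum>y\<in>UNIV. Q $ x $ y * (f $ y - m))"
    by (subst sum.remove[of UNIV x]) (auto intro!: sum_nonneg mult_nonneg_nonneg off simp: m)
  also have "\<dots> = (\<Sum>y\<in>UNIV. Q $ x $ y * f $ y) - (\<Sum>y\<in>UNIV. Q $ x $ y) * m"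
    by (simp add: right_diff_distrib sum_subtractf sum_distrib_right)
  also have "\<dots> = (Q *v f) $ x" by (simp add: row matrix_vector_mult_def)
  finally show "- M * (f $ x - m) \<le> (Q *v f) $ x" .
qed

text \<open>The first summand is a Lipschitz constant in the Euclidean norm, summed over
  coordinates; \<open>M\<close> ensures \<open>h * M \<le> 1\<close> for admissible steps; 1 keeps
  the total positive when \<open>M = 0\<close>.\<close>

definition L where "L = real CARD('x) * (CARD('x) * M) + M + 1"

sublocale rate_operator lower L
proof
  show "0 < L" using M_nonneg unfolding L_def by (intro add_nonneg_pos add_nonneg_nonneg mult_nonneg_nonneg) auto
  fix f g
  have "norm (lower f - lower g) \<le> (\<Sum>x\<in>UNIV. \<bar>(lower f - lower g) $ x\<bar>)" by (rule norm_le_l1_cart)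
  also have "\<dots> \<le> (\<Sum>x\<in>(UNIV::'x set). CARD('x) * M * norm (f - g))"
    using lower_diff_le[of f _ g] lower_diff_le[of g _ f]
    by (intro sum_mono) (simp add: abs_le_iff norm_minus_commute)
  also have "\<dots> = (real CARD('x) * (CARD('x) * M)) * norm (f - g)" by simp
  also have "\<dots> \<le> L * norm (f - g)" unfolding L_def using M_nonneg by (intro mult_right_mono) auto
  finally show "norm (lower f - lower g) \<le> L * norm (f - g)" .
next
  fix h :: real assume h: "0 \<le> h" "h * L \<le> 1"
  have "0 \<le> real CARD('x) * (CARD('x) * M)" using M_nonneg by (intro mult_nonneg_nonneg) auto
  then have "h * M \<le> h * L" unfolding L_def using h M_nonneg by (intro mult_left_mono) linarith+
  with h have hM: "h * M \<le> 1" by linarith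
  show "lower_transition_operator (\<lambda>f. f + h *\<^sub>R lower f)"
    unfolding lower_transition_operator_def
  proof (intro conjI allI impI)
    fix f :: "real^'x" and x
    define m where "m = Min (range (\<lambda>y. f $ y))"
    have m: "m \<le> f $ y" for y by (simp add: m_def)
    have "(h * M) * (f $ x - m) \<le> 1 * (f $ x - m)" using hM m by (intro mult_right_mono) auto
    moreover have "h * (- M * (f $ x - m)) \<le> h * lower f $ x"
      using h by (intro mult_left_mono lower_ge_min m)
    ultimately show "m \<le> (f + h *\<^sub>R lower f) $ x" by (simp add: algebra_simps)
  next
    fix f g x
    have "h * (lower f $ x + lower g $ x) \<le> h * lower (f + g) $ x"
      using h by (intro mult_left_mono lower_superadditive)
    then show "(f + h *\<^sub>R lower f) $ x + (g + h *\<^sub>R lower g) $ x \<le> (f + g + h *\<^sub>R lower (f + g)) $ x"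
      by (simp add: algebra_simps)
  next
    fix c :: real and f assume "0 \<le> c"
    then show "c *\<^sub>R f + h *\<^sub>R lower (c *\<^sub>R f) = c *\<^sub>R (f + h *\<^sub>R lower f)"
      by (simp add: lower_scale algebra_simps)
  qed
qed

end

section \<open>Transition families\<close>

lemma solves_right_quotient:
  assumes "solves A g" "0 \<le> \<tau>"
  shows "((\<lambda>\<Delta>. (1 / \<Delta>) *\<^sub>R (g (\<tau> + \<Delta>) - g \<tau>)) \<longlongrightarrow> A (g \<tau>)) (at_right 0)"
proof -
  have "(g has_vector_derivative A (g \<tau>)) (at \<tau> within {\<tau><..})"
    by (rule has_vector_derivative_within_subset[of g _ _ "{0..}"]) (use assms in \<open>auto simp: solves_def\<close>)
  then have "((\<lambda>y. (1 / norm (y - \<tau>)) *\<^sub>R (g y - (g \<tau> + (y - \<tau>) *\<^sub>R A (g \<tau>)))) \<longlongrightarrow> 0) (at_right \<tau>)"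
    by (simp add: has_vector_derivative_def has_derivative_within)
  moreover have "filterlim (\<lambda>\<Delta>. \<tau> + \<Delta>) (at_right \<tau>) (at_right 0)"
    unfolding filterlim_at by (auto intro!: tendsto_eq_intros eventually_mono[OF eventually_at_right_less])
  ultimately have "((\<lambda>\<Delta>. (1 / norm \<Delta>) *\<^sub>R (g (\<tau> + \<Delta>) - (g \<tau> + \<Delta> *\<^sub>R A (g \<tau>)))) \<longlongrightarrow> 0) (at_right 0)"
    by (auto dest: filterlim_compose)
  from tendsto_add[OF this tendsto_const[of "A (g \<tau>)"]]
  have "((\<lambda>\<Delta>. (1 / norm \<Delta>) *\<^sub>R (g (\<tau> + \<Delta>) - (g \<tau> + \<Delta> *\<^sub>R A (g \<tau>))) + A (g \<tau>)) \<longlongrightarrow> A (g \<tau>)) (at_right 0)"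
    by simp
  then show ?thesis
    by (rule Lim_transform_eventually)
      (use eventually_at_right_less[of "0::real"] in \<open>eventually_elim, simp add: algebra_simps\<close>)
qed

lemma solves_left_quotient:
  assumes "solves A g" "0 < \<tau>"
  shows "((\<lambda>\<Delta>. (1 / \<Delta>) *\<^sub>R (g \<tau> - g (\<tau> - \<Delta>))) \<longlongrightarrow> A (g \<tau>)) (at_right 0)"
proof -
  have "(g has_vector_derivative A (g \<tau>)) (at \<tau> within {0..})"
    using assms by (auto simp: solves_def)
  then have "((\<lambda>y. (1 / norm (y - \<tau>)) *\<^sub>R (g y - (g \<tau> + (y - \<tau>) *\<^sub>R A (g \<tau>)))) \<longlongrightarrow> 0) (at \<tau> within {0..})"
    by (simp add: has_vector_derivative_def has_derivative_within)
  moreover have "at \<tau> within {0..} = at \<tau>"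
    using assms by (intro at_within_interior) simp
  ultimately have "((\<lambda>y. (1 / norm (y - \<tau>)) *\<^sub>R (g y - (g \<tau> + (y - \<tau>) *\<^sub>R A (g \<tau>)))) \<longlongrightarrow> 0) (at_left \<tau>)"
    by (intro tendsto_within_subset[of _ _ \<tau> UNIV "{..<\<tau>}"]) simp_all
  moreover have "filterlim (\<lambda>\<Delta>. \<tau> - \<Delta>) (at_left \<tau>) (at_right 0)"
    unfolding filterlim_at by (auto intro!: tendsto_eq_intros eventually_mono[OF eventually_at_right_less])
  ultimately have "((\<lambda>\<Delta>. (1 / norm \<Delta>) *\<^sub>R (g (\<tau> - \<Delta>) - (g \<tau> - \<Delta> *\<^sub>R A (g \<tau>)))) \<longlongrightarrow> 0) (at_right 0)"
    by (auto dest: filterlim_compose)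
  from tendsto_diff[OF tendsto_const[of "A (g \<tau>)"] this]
  have "((\<lambda>\<Delta>. A (g \<tau>) - (1 / norm \<Delta>) *\<^sub>R (g (\<tau> - \<Delta>) - (g \<tau> - \<Delta> *\<^sub>R A (g \<tau>)))) \<longlongrightarrow> A (g \<tau>)) (at_right 0)"
    by simp
  then show ?thesis
    by (rule Lim_transform_eventually)
      (use eventually_at_right_less[of "0::real"] in \<open>eventually_elim, simp add: algebra_simps\<close>)
qed

text \<open>The evolution system of a Markov chain. Times range over all reals, which removes
  boundary cases at 0. The left and right derivatives at a time may differ, which admits rate
  matrices that switch.\<close>

definition transition_family :: "(real^'x^'x::finite) set \<Rightarrow> (real \<Rightarrow> real \<Rightarrow> real^'x^'x) \<Rightarrow> bool" where
  "transition_family \<Q> T \<longleftrightarrow>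
     (\<forall>r s x y. r \<le> s \<longrightarrow> 0 \<le> T r s $ x $ y) \<and>
     (\<forall>r s x. r \<le> s \<longrightarrow> (\<Sum>y\<in>UNIV. T r s $ x $ y) = 1) \<and>
     (\<forall>r. T r r = mat 1) \<and>
     (\<forall>r s q. r \<le> s \<longrightarrow> s \<le> q \<longrightarrow> T r q = T r s ** T s q) \<and>
     (\<forall>t. \<exists>Q\<in>\<Q>. ((\<lambda>\<Delta>. (1 / \<Delta>) *\<^sub>R (T t (t + \<Delta>) - mat 1)) \<longlongrightarrow> Q) (at_right 0)) \<and>
     (\<forall>t. \<exists>Q\<in>\<Q>. ((\<lambda>\<Delta>. (1 / \<Delta>) *\<^sub>R (T (t - \<Delta>) t - mat 1)) \<longlongrightarrow> Q) (at_right 0))"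

lemmas
  transition_family_nonneg =
    transition_family_def[THEN iffD1, THEN conjunct1, rule_format] and
  transition_family_row_sum =
    transition_family_def[THEN iffD1, THEN conjunct2, THEN conjunct1, rule_format] and
  transition_family_same =
    transition_family_def[THEN iffD1, THEN conjunct2, THEN conjunct2, THEN conjunct1, rule_format] and
  transition_family_chapman =
    transition_family_def[THEN iffD1, THEN conjunct2, THEN conjunct2, THEN conjunct2, THEN conjunct1, rule_format] and
  transition_family_right =
    transition_family_def[THEN iffD1, THEN conjunct2, THEN conjunct2, THEN conjunct2, THEN conjunct2, THEN conjunct1, rule_format] and
  transition_family_left =
    transition_family_def[THEN iffD1, THEN conjunct2, THEN conjunct2, THEN conjunct2, THEN conjunct2, THEN conjunct2, rule_format]

lemma matrix_mult_component: "((A :: real^'n^'m) ** B) $ x $ y = (\<Sum>z\<in>UNIV. A $ x $ z * B $ z $ y)"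
  by (simp add: matrix_matrix_mult_def)

lemma stochastic_mult_row_sum:
  fixes A B :: "real^'x^'x::finite"
  assumes "\<And>x. (\<Sum>y\<in>UNIV. A $ x $ y) = 1" "\<And>x. (\<Sum>y\<in>UNIV. B $ x $ y) = 1"
  shows "(\<Sum>y\<in>UNIV. (A ** B) $ x $ y) = 1"
  unfolding matrix_mult_component by (subst sum.swap) (simp add: assms flip: sum_distrib_left)

lemma eventually_at_right_0_small: "0 < d \<Longrightarrow> \<forall>\<^sub>F \<Delta> in at_right 0. 0 < \<Delta> \<and> \<Delta> < (d :: real)"
  by (intro eventually_conj eventually_at_right_less order_tendstoD(2)[OF tendsto_ident_at])

text \<open>The evolution switches from \<open>T1\<close> to \<open>T2\<close> at time
  \<open>c\<close>. Derivatives are local, so away from \<open>c\<close> they are inherited; at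
  \<open>c\<close> the left one comes from \<open>T1\<close> and the right one from
  \<open>T2\<close>, and no compatibility between the two is required.\<close>

lemma transition_family_concat:
  fixes c :: real and T1 T2 :: "real \<Rightarrow> real \<Rightarrow> real^'x^'x::finite"
  assumes T1: "transition_family \<Q> T1" and T2: "transition_family \<Q> T2"
  defines "T \<equiv> \<lambda>r s. if s \<le> c then T1 r s else if c \<le> r then T2 r s else T1 r c ** T2 c s"
  shows "transition_family \<Q> T"
proof -
  note nonneg = transition_family_nonneg[OF T1] transition_family_nonneg[OF T2]
  note rows = transition_family_row_sum[OF T1] transition_family_row_sum[OF T2]
  note same = transition_family_same[OF T1] transition_family_same[OF T2]
  note chap = transition_family_chapman[OF T1] transition_family_chapman[OF T2]
  note small = eventually_at_right_0_small
  have cong: "\<exists>Q\<in>\<Q>. ((\<lambda>\<Delta>. (1 / \<Delta>) *\<^sub>R (F \<Delta> - mat 1)) \<longlongrightarrow> Q) (at_right 0)"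
    if ex: "\<exists>Q\<in>\<Q>. ((\<lambda>\<Delta>. (1 / \<Delta>) *\<^sub>R (F' \<Delta> - mat 1)) \<longlongrightarrow> Q) (at_right 0)"
      and eq: "\<forall>\<^sub>F \<Delta> in at_right 0. F' \<Delta> = F \<Delta>" for F F' :: "real \<Rightarrow> real^'x^'x"
  proof -
    obtain Q where "Q \<in> \<Q>" "((\<lambda>\<Delta>. (1 / \<Delta>) *\<^sub>R (F' \<Delta> - mat 1)) \<longlongrightarrow> Q) (at_right 0)" using ex by blast
    moreover from this(2) have "((\<lambda>\<Delta>. (1 / \<Delta>) *\<^sub>R (F \<Delta> - mat 1)) \<longlongrightarrow> Q) (at_right 0)"
      by (rule Lim_transform_eventually) (use eq in \<open>eventually_elim, simp\<close>)
    ultimately show ?thesis by blast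
  qed
  show ?thesis unfolding transition_family_def
  proof (intro conjI allI impI)
    show "0 \<le> T r s $ x $ y" if "r \<le> s" for r s x y
      using that by (auto simp: T_def matrix_mult_component intro!: sum_nonneg mult_nonneg_nonneg nonneg)
    show "(\<Sum>y\<in>UNIV. T r s $ x $ y) = 1" if "r \<le> s" for r s x
      using that by (auto simp: T_def intro!: rows stochastic_mult_row_sum)
    show "T r r = mat 1" for r by (simp add: T_def same)
    show "T r q = T r s ** T s q" if rs: "r \<le> s" "s \<le> q" for r s q
    proof -
      consider "q \<le> c" | "c < q" "c \<le> r" | "c < q" "r < c" "s \<le> c" | "c < q" "r < c" "c < s" by linarith
      then show ?thesis
      proof cases
        case 1
        then show ?thesis using rs chap(1)[OF rs] by (auto simp: T_def)
      next
        case 2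
        then show ?thesis using rs chap(2)[OF rs] same
          by (cases "s = c") (auto simp: T_def matrix_mul_lid)
      next
        case 3
        then show ?thesis using rs chap(1)[of r s c] same
          by (cases "s = c") (auto simp: T_def matrix_mul_assoc matrix_mul_rid)
      next
        case 4
        then show ?thesis using rs chap(2)[of c s q] by (simp add: T_def matrix_mul_assoc)
      qed
    qed
    fix t
    show "\<exists>Q\<in>\<Q>. ((\<lambda>\<Delta>. (1 / \<Delta>) *\<^sub>R (T t (t + \<Delta>) - mat 1)) \<longlongrightarrow> Q) (at_right 0)"
    proof (cases "t < c")
      case True
      then have "\<forall>\<^sub>F \<Delta> in at_right 0. T1 t (t + \<Delta>) = T t (t + \<Delta>)"
        using small[of "c - t"] by (auto elim!: eventually_mono simp: T_def)
      then show ?thesis by (rule cong[OF transition_family_right[OF T1]])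
    next
      case False
      then have "\<forall>\<^sub>F \<Delta> in at_right 0. T2 t (t + \<Delta>) = T t (t + \<Delta>)"
        using small[of 1] by (auto elim!: eventually_mono simp: T_def)
      then show ?thesis by (rule cong[OF transition_family_right[OF T2]])
    qed
    show "\<exists>Q\<in>\<Q>. ((\<lambda>\<Delta>. (1 / \<Delta>) *\<^sub>R (T (t - \<Delta>) t - mat 1)) \<longlongrightarrow> Q) (at_right 0)"
    proof (cases "t \<le> c")
      case True
      then have "\<forall>\<^sub>F \<Delta> in at_right 0. T1 (t - \<Delta>) t = T (t - \<Delta>) t"
        by (simp add: T_def)
      then show ?thesis by (rule cong[OF transition_family_left[OF T1]])
    next
      case False
      then have "\<forall>\<^sub>F \<Delta> in at_right 0. T2 (t - \<Delta>) t = T (t - \<Delta>) t"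
        using small[of "t - c"] by (auto elim!: eventually_mono simp: T_def)
      then show ?thesis by (rule cong[OF transition_family_left[OF T2]])
    qed
  qed
qed

lemma lower_envelope_singleton: "lower_envelope {Q} = (\<lambda>f. Q *v f)"
  by (simp add: lower_envelope_def fun_eq_iff vec_eq_iff)

text \<open>This is the matrix exponential, obtained as the flow of the singleton
  \<open>{Q}\<close>. Nonnegative entries hold because the flow is a lower transition operator;
  linearity, row sums and Chapman-Kolmogorov follow from uniqueness of solutions.\<close>

lemma transition_family_homogeneous:
  fixes Q :: "real^'x^'x::finite"
  assumes "Q \<in> rate_matrices" and Q: "Q \<in> \<Q>"
  shows "\<exists>T. transition_family \<Q> T \<and>
    (\<forall>t. ((\<lambda>\<Delta>. (1 / \<Delta>) *\<^sub>R (T t (t + \<Delta>) - mat 1)) \<longlongrightarrow> Q) (at_right 0)) \<and>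
    (\<forall>t. ((\<lambda>\<Delta>. (1 / \<Delta>) *\<^sub>R (T (t - \<Delta>) t - mat 1)) \<longlongrightarrow> Q) (at_right 0))"
proof -
  define M where "M = (\<Sum>x\<in>UNIV. \<Sum>y\<in>UNIV. \<bar>Q $ x $ y\<bar>)"
  interpret rate_matrix_set "{Q}" M
  proof
    fix R x y assume "R \<in> {Q}"
    then show "\<bar>R $ x $ y\<bar> \<le> M"
      using order_trans[OF abs_entry_le_matnorm matnorm_le] by (simp add: M_def)
  qed (use assms in auto)
  define \<Phi> where "\<Phi> = flow (\<lambda>f. Q *v f)"
  have solves: "solves (\<lambda>f. Q *v f) (\<lambda>\<tau>. \<Phi> \<tau> f)" and \<Phi>_0: "\<Phi> 0 f = f" for f
    using flow_solves flow_0 by (simp_all add: \<Phi>_def lower_envelope_singleton)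
  have uniq: "\<Phi> \<tau> (g 0) = g \<tau>" if "solves (\<lambda>f. Q *v f) g" "0 \<le> \<tau>" for g \<tau>
    using flow_unique that by (simp add: \<Phi>_def lower_envelope_singleton)
  have lto: "lower_transition_operator (\<Phi> \<tau>)" if "0 \<le> \<tau>" for \<tau>
    using flow_lto that by (simp add: \<Phi>_def lower_envelope_singleton)
  have add: "\<Phi> (a + b) f = \<Phi> a (\<Phi> b f)" if "0 \<le> a" "0 \<le> b" for a b f
    using flow_add that by (simp add: \<Phi>_def lower_envelope_singleton)
  have linear: "linear (\<Phi> \<tau>)" if \<tau>: "0 \<le> \<tau>" for \<tau>
  proof (rule linearI)
    fix f g :: "real^'x" and c :: real
    have "solves (\<lambda>f. Q *v f) (\<lambda>\<tau>. \<Phi> \<tau> f + \<Phi> \<tau> g)"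
      using solves unfolding solves_def
      by (auto simp: matrix_vector_right_distrib intro!: has_vector_derivative_add)
    from uniq[OF this \<tau>] show "\<Phi> \<tau> (f + g) = \<Phi> \<tau> f + \<Phi> \<tau> g" by (simp add: \<Phi>_0)
    have "solves (\<lambda>f. Q *v f) (\<lambda>\<tau>. c *\<^sub>R \<Phi> \<tau> f)"
      using solves unfolding solves_def
      by (auto simp: matrix_vector_mult_scaleR intro!: bounded_linear.has_vector_derivative[OF bounded_linear_scaleR_right])
    from uniq[OF this \<tau>] show "\<Phi> \<tau> (c *\<^sub>R f) = c *\<^sub>R \<Phi> \<tau> f" by (simp add: \<Phi>_0)
  qed
  have const: "\<Phi> \<tau> 1 = 1" if "0 \<le> \<tau>" for \<tau>
  proof -
    have "Q *v 1 = 0" using assms by (simp add: rate_matrices_def vec_eq_iff matrix_vector_mult_def)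
    then have "solves (\<lambda>f. Q *v f) (\<lambda>\<tau>. 1)" by (simp add: solves_def)
    from uniq[OF this that] show ?thesis .
  qed
  define T where "T r s = matrix (\<Phi> (s - r))" for r s
  have T_entry: "T r s $ x $ y = \<Phi> (s - r) (axis y 1) $ x" for r s x y
    by (simp add: T_def matrix_def)
  have T_0: "T r r = mat 1" for r by (simp add: vec_eq_iff T_entry \<Phi>_0 axis_def mat_def)
  have lim: "((\<lambda>\<Delta>. (1 / \<Delta>) *\<^sub>R (matrix (\<Phi> \<Delta>) - mat 1)) \<longlongrightarrow> Q) (at_right 0)"
  proof (intro vec_tendstoI)
    fix x y
    have "((\<lambda>\<Delta>. ((1 / \<Delta>) *\<^sub>R (\<Phi> (0 + \<Delta>) (axis y 1) - \<Phi> 0 (axis y 1))) $ x) \<longlongrightarrow> (Q *v \<Phi> 0 (axis y 1)) $ x) (at_right 0)"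
      by (intro tendsto_vec_nth solves_right_quotient[OF solves]) simp
    moreover have "((1 / \<Delta>) *\<^sub>R (matrix (\<Phi> \<Delta>) - mat 1)) $ x $ y
        = ((1 / \<Delta>) *\<^sub>R (\<Phi> (0 + \<Delta>) (axis y 1) - \<Phi> 0 (axis y 1))) $ x" for \<Delta>
      by (simp add: \<Phi>_0 matrix_def) (simp add: mat_def axis_def)
    ultimately show "((\<lambda>\<Delta>. ((1 / \<Delta>) *\<^sub>R (matrix (\<Phi> \<Delta>) - mat 1)) $ x $ y) \<longlongrightarrow> Q $ x $ y) (at_right 0)"
      by (simp only: \<Phi>_0 matrix_vector_axis)
  qed
  \<comment> \<open>Since \<open>T r s\<close> depends only on \<open>s - r\<close>, both one-sided
    quotients are the same function of the increment.\<close>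
  have lim': "((\<lambda>\<Delta>. (1 / \<Delta>) *\<^sub>R (T t (t + \<Delta>) - mat 1)) \<longlongrightarrow> Q) (at_right 0)"
    "((\<lambda>\<Delta>. (1 / \<Delta>) *\<^sub>R (T (t - \<Delta>) t - mat 1)) \<longlongrightarrow> Q) (at_right 0)" for t
    using lim by (simp_all add: T_def)
  have "transition_family \<Q> T"
    unfolding transition_family_def
  proof (intro conjI allI impI)
    show "0 \<le> T r s $ x $ y" if "r \<le> s" for r s x y
      unfolding T_entry using that by (intro lto_ge[OF lto]) (auto simp: axis_def)
    show "(\<Sum>y\<in>UNIV. T r s $ x $ y) = 1" if "r \<le> s" for r s x
    proof -
      have "(T r s *v 1) $ x = 1"
        using fun_cong[OF matrix_vector_mul(2)[OF linear], of "s - r" 1] that by (simp add: T_def const)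
      then show ?thesis by (simp add: matrix_vector_mult_def)
    qed
    show "T r q = T r s ** T s q" if "r \<le> s" "s \<le> q" for r s q
    proof -
      have "\<Phi> (q - r) = \<Phi> (s - r) \<circ> \<Phi> (q - s)"
        using add[of "s - r" "q - s"] that by (auto simp: fun_eq_iff)
      then show ?thesis using that by (simp add: T_def matrix_compose[OF linear linear])
    qed
    show "\<exists>Q\<in>\<Q>. ((\<lambda>\<Delta>. (1 / \<Delta>) *\<^sub>R (T t (t + \<Delta>) - mat 1)) \<longlongrightarrow> Q) (at_right 0)" for t
      using lim'(1) Q by (rule bexI)
    show "\<exists>Q\<in>\<Q>. ((\<lambda>\<Delta>. (1 / \<Delta>) *\<^sub>R (T (t - \<Delta>) t - mat 1)) \<longlongrightarrow> Q) (at_right 0)" for t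
      using lim'(2) Q by (rule bexI)
  qed (rule T_0)
  then show ?thesis using lim' by blast
qed

section \<open>Construction of processes from transition kernels\<close>

definition depends_on :: "((real \<Rightarrow> 'x) \<Rightarrow> 'b) \<Rightarrow> real set \<Rightarrow> bool" where
  "depends_on h D \<longleftrightarrow> (\<forall>\<eta> \<eta>'. (\<forall>t\<in>D. \<eta> t = \<eta>' t) \<longrightarrow> h \<eta> = h \<eta>')"

lemma depends_onD: "depends_on h D \<Longrightarrow> (\<And>t. t \<in> D \<Longrightarrow> \<eta> t = \<eta>' t) \<Longrightarrow> h \<eta> = h \<eta>'"
  by (auto simp: depends_on_def)

lemma finite_image_depends_on:
  fixes h :: "(real \<Rightarrow> 'x::finite) \<Rightarrow> 'b"
  assumes "depends_on h W" "finite W"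
  shows "finite (h ` S)"
proof (rule finite_subset)
  show "h ` S \<subseteq> h ` (W \<rightarrow>\<^sub>E UNIV)"
  proof
    fix b assume "b \<in> h ` S"
    then obtain \<eta> where "b = h \<eta>" by auto
    also have "h \<eta> = h (restrict \<eta> W)" by (rule depends_onD[OF assms(1)]) simp
    finally show "b \<in> h ` (W \<rightarrow>\<^sub>E UNIV)" by auto
  qed
qed (use assms(2) in \<open>simp add: finite_PiE\<close>)

text \<open>A finite-dimensional law as an iterated sum. \<open>r\<close> is the current time, and
  \<open>\<xi>\<close> carries both the given history and the states sampled so far, each of which
  overwrites the value at its time.\<close>

primrec path_expectation ::
  "(real \<Rightarrow> real \<Rightarrow> 'x::finite \<Rightarrow> 'x \<Rightarrow> real) \<Rightarrow> real \<Rightarrow> (real \<Rightarrow> 'x) \<Rightarrow> real list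
    \<Rightarrow> ((real \<Rightarrow> 'x) \<Rightarrow> real) \<Rightarrow> real" where
  "path_expectation K r \<xi> [] h = h \<xi>"
| "path_expectation K r \<xi> (w # ws) h = (\<Sum>y\<in>UNIV. K r w (\<xi> r) y * path_expectation K w (\<xi>(w := y)) ws h)"

text \<open>Values at the times in \<open>ws\<close> are overwritten before \<open>h\<close> reads
  them. Equal kernel rows are required rather than equal states at \<open>r\<close>, because at the
  artificial initial time the rows agree for all states.\<close>

lemma path_expectation_agree:
  assumes "depends_on h D" "\<And>t. t \<in> D - set ws \<Longrightarrow> \<xi> t = \<xi>' t" "\<And>w. K r w (\<xi> r) = K r w (\<xi>' r)"
  shows "path_expectation K r \<xi> ws h = path_expectation K r \<xi>' ws h"
  using assms(2,3)
proof (induction ws arbitrary: r \<xi> \<xi>')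
  case Nil
  then show ?case by (simp, intro depends_onD[OF assms(1)]) simp
next
  case (Cons w ws)
  have "path_expectation K w (\<xi>(w := y)) ws h = path_expectation K w (\<xi>'(w := y)) ws h" for y
    by (rule Cons.IH) (use Cons.prems(1) in auto)
  then show ?case using Cons.prems(2) by simp
qed

lemma path_expectation_mult_left:
  assumes "depends_on g D" "D \<inter> set ws = {}"
  shows "path_expectation K r \<xi> ws (\<lambda>\<eta>. g \<eta> * h \<eta>) = g \<xi> * path_expectation K r \<xi> ws h"
  using assms(2)
proof (induction ws arbitrary: r \<xi>)
  case (Cons w ws)
  have "g (\<xi>(w := y)) = g \<xi>" for y
    by (rule depends_onD[OF assms(1)]) (use Cons.prems in auto)
  then show ?case using Cons by (simp add: sum_distrib_left mult_ac)
qed simp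

lemma path_expectation_sum:
  "path_expectation K r \<xi> ws (\<lambda>\<eta>. \<Sum>i\<in>I. f i \<eta>) = (\<Sum>i\<in>I. path_expectation K r \<xi> ws (f i))"
proof (induction ws arbitrary: r \<xi>)
  case (Cons w ws)
  then show ?case by (simp add: fun_upd_def sum_distrib_left) (rule sum.swap)
qed simp

lemma path_expectation_mult_const:
  "path_expectation K r \<xi> ws (\<lambda>\<eta>. c * f \<eta>) = c * path_expectation K r \<xi> ws f"
  by (rule path_expectation_mult_left[of "\<lambda>_. c" "{}"]) (auto simp: depends_on_def)

lemma path_expectation_const_diff:
  assumes "\<And>r s x. (\<Sum>y\<in>UNIV. K r s x y) = 1"
  shows "path_expectation K r \<xi> ws (\<lambda>\<eta>. c - f \<eta>) = c - path_expectation K r \<xi> ws f"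
proof (induction ws arbitrary: r \<xi>)
  case (Cons w ws)
  then show ?case by (simp add: fun_upd_def right_diff_distrib sum_subtractf assms flip: sum_distrib_right)
qed simp

lemma path_expectation_append:
  "path_expectation K r \<xi> (ws @ vs) h
    = path_expectation K r \<xi> ws (\<lambda>\<eta>. path_expectation K (last (r # ws)) \<eta> vs h)"
  by (induction ws arbitrary: r \<xi>) auto

lemma path_expectation_nonpos:
  assumes "\<And>r s x y. 0 \<le> K r s x y" "\<And>\<eta>. h \<eta> \<le> 0"
  shows "path_expectation K r \<xi> ws h \<le> 0"
  by (induction ws arbitrary: r \<xi>) (auto intro!: sum_nonpos mult_nonneg_nonpos assms)

text \<open>The path that follows \<eta> along \<open>ws\<close> has positive weight under a
  positive kernel, and no other path can compensate for its negative value.\<close>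

lemma path_expectation_neg:
  assumes K: "\<And>r s x y. 0 < K r s x y" and "\<And>\<eta>. h \<eta> \<le> 0" "h (override_on \<xi> \<eta> (set ws)) < 0"
  shows "path_expectation K r \<xi> ws h < 0"
  using assms(3)
proof (induction ws arbitrary: r \<xi>)
  case (Cons w ws)
  have le: "path_expectation K r' \<xi>' ws h \<le> 0" for r' \<xi>'
    using path_expectation_nonpos[of K h] assms(2) K less_imp_le by metis
  have eq: "override_on (\<xi>(w := \<eta> w)) \<eta> (set ws) = override_on \<xi> \<eta> (set (w # ws))"
    by (auto simp: override_on_def)
  have "path_expectation K w (\<xi>(w := \<eta> w)) ws h < 0"
    by (rule Cons.IH) (use Cons.prems in \<open>simp only: eq\<close>)
  then have "K r w (\<xi> r) (\<eta> w) * path_expectation K w (\<xi>(w := \<eta> w)) ws h < 0"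
    using K by (simp add: mult_pos_neg)
  moreover have "(\<Sum>y\<in>UNIV - {\<eta> w}. K r w (\<xi> r) y * path_expectation K w (\<xi>(w := y)) ws h) \<le> 0"
    by (intro sum_nonpos mult_nonneg_nonpos le less_imp_le[OF K])
  ultimately show ?case by (simp add: sum.remove[of UNIV "\<eta> w"])
qed (simp add: override_on_def)

lemma tendsto_path_expectation:
  assumes "\<And>r s x y. ((\<lambda>\<epsilon>. K \<epsilon> r s x y) \<longlongrightarrow> K0 r s x y) F"
  shows "((\<lambda>\<epsilon>. path_expectation (K \<epsilon>) r \<xi> ws h) \<longlongrightarrow> path_expectation K0 r \<xi> ws h) F"
  by (induction ws arbitrary: r \<xi>) (auto intro!: tendsto_sum tendsto_mult assms)

lemma sorted_list_of_set_split:
  assumes "finite (W :: real set)"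
  shows "sorted_list_of_set W = sorted_list_of_set (W \<inter> {..m}) @ sorted_list_of_set (W \<inter> {m<..})"
proof (rule sorted_distinct_set_unique)
  have fin: "finite (W \<inter> {..m})" "finite (W \<inter> {m<..})" using assms by auto
  show "sorted (sorted_list_of_set (W \<inter> {..m}) @ sorted_list_of_set (W \<inter> {m<..}))"
    using fin by (auto simp: sorted_append)
  show "distinct (sorted_list_of_set (W \<inter> {..m}) @ sorted_list_of_set (W \<inter> {m<..}))"
    using fin by auto
  show "set (sorted_list_of_set W) = set (sorted_list_of_set (W \<inter> {..m}) @ sorted_list_of_set (W \<inter> {m<..}))"
    using fin assms by auto
qed (use assms in auto)

lemma last_sorted_list_of_set:
  assumes "finite (W :: real set)" "m \<in> W" "\<And>w. w \<in> W \<Longrightarrow> w \<le> m"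
  shows "last (sorted_list_of_set W) = m"
proof -
  have "last (sorted_list_of_set W) \<in> W"
    using assms by (metis empty_iff last_in_set set_sorted_list_of_set sorted_list_of_set_eq_Nil_iff)
  moreover have "m \<le> last (sorted_list_of_set W)"
  proof -
    have "m \<in> set (sorted_list_of_set W)" using assms by simp
    then show ?thesis using sorted_list_of_set(2)[of W]
      by (metis empty_iff empty_set in_set_conv_nth last_conv_nth less_Suc_eq_le diff_less length_pos_if_in_set sorted_nth_mono Suc_pred' less_numeral_extra(1) list.size(3))
  qed
  ultimately show ?thesis using assms(3) by (meson antisym)
qed

text \<open>Time \<open>-1\<close> stands for the moment before the process starts: the transition out of it does not
  depend on the state and produces the initial distribution. In this way conditioning on an empty
  set of times needs no separate treatment.\<close>

locale transition_kernel =
  fixes K :: "real \<Rightarrow> real \<Rightarrow> 'x::finite \<Rightarrow> 'x \<Rightarrow> real" and \<Omega> :: "(real \<Rightarrow> 'x) set"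
  assumes K_nonneg: "0 \<le> K r s x y"
    and K_sum: "(\<Sum>y\<in>UNIV. K r s x y) = 1"
    and K_chapman: "r < s \<Longrightarrow> s < q \<Longrightarrow> K r q x z = (\<Sum>y\<in>UNIV. K r s x y * K s q y z)"
    and K_initial: "K (- 1) s x = K (- 1) s x'"
    and path_space: "path_space \<Omega>"
begin

abbreviation E where "E \<equiv> path_expectation K"

text \<open>Marginalisation over a time that \<open>h\<close> does not read: a last time disappears
  because rows sum to 1, an intermediate one by Chapman-Kolmogorov.\<close>

lemma path_expectation_insort:
  assumes "sorted_wrt (<) (r # ws)" "r < v" "v \<notin> set ws" "depends_on h D" "v \<notin> D"
  shows "E r \<xi> (insort v ws) h = E r \<xi> ws h"
  using assms(1-3)
proof (induction ws arbitrary: r \<xi>)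
  case Nil
  have "h (\<xi>(v := y)) = h \<xi>" for y by (rule depends_onD[OF assms(4)]) (use assms(5) in auto)
  then show ?case by (simp add: K_sum flip: sum_distrib_right)
next
  case (Cons w ws)
  show ?case
  proof (cases "v < w")
    case True
    have agree: "E w (\<xi>(v := y, w := z)) ws h = E w (\<xi>(w := z)) ws h" for y z
      by (rule path_expectation_agree[OF assms(4)]) (use True assms(5) in auto)
    have "E r \<xi> (insort v (w # ws)) h
        = (\<Sum>y\<in>UNIV. \<Sum>z\<in>UNIV. K r v (\<xi> r) y * K v w y z * E w (\<xi>(w := z)) ws h)"
      using True by (simp add: agree sum_distrib_left mult.assoc)
    also have "\<dots> = (\<Sum>z\<in>UNIV. (\<Sum>y\<in>UNIV. K r v (\<xi> r) y * K v w y z) * E w (\<xi>(w := z)) ws h)"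
      by (subst sum.swap) (simp add: sum_distrib_right)
    also have "\<dots> = E r \<xi> (w # ws) h"
      using K_chapman[OF Cons.prems(2) True, symmetric] by simp
    finally show ?thesis .
  next
    case False
    then have "w < v" using Cons.prems(3) by auto
    with False Cons show ?thesis by auto
  qed
qed

lemma path_expectation_superset:
  assumes "finite W" "finite W'" "W \<subseteq> W'" "\<And>w. w \<in> W' \<Longrightarrow> r < w" "depends_on h D" "D \<inter> W' \<subseteq> W"
  shows "E r \<xi> (sorted_list_of_set W') h = E r \<xi> (sorted_list_of_set W) h"
proof -
  have "E r \<xi> (sorted_list_of_set (W \<union> F)) h = E r \<xi> (sorted_list_of_set W) h"
    if "finite F" "F \<subseteq> W' - W" for F
    using that
  proof (induction F rule: finite_induct)
    case (insert v F)
    have v: "v \<notin> W" "v \<in> W'" using insert by auto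
    have "sorted_list_of_set (W \<union> insert v F) = insort v (sorted_list_of_set (W \<union> F))"
      using insert v assms(1) by simp
    moreover have "E r \<xi> (insort v (sorted_list_of_set (W \<union> F))) h = E r \<xi> (sorted_list_of_set (W \<union> F)) h"
    proof (rule path_expectation_insort[OF _ _ _ assms(5)])
      show "sorted_wrt (<) (r # sorted_list_of_set (W \<union> F))"
        using insert assms(1,3,4) by (auto simp: strict_sorted_list_of_set)
    qed (use insert v assms in auto)
    ultimately show ?case using insert by simp
  qed simp
  from this[of "W' - W"] show ?thesis using assms(2,3) by (simp add: Un_absorb1)
qed

lemma path_through:
  assumes "finite W" "W \<subseteq> {0..}"
  obtains \<xi> where "\<xi> \<in> \<Omega>" "\<And>t. t \<in> W \<Longrightarrow> \<xi> t = \<eta> t"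
proof -
  \<comment> \<open>\<open>path_space\<close> provides paths only through nonempty sets of times;
    inserting 0 covers \<open>W = {}\<close>.\<close>
  let ?W = "insert 0 W"
  have "?W \<in> time_sets" "restrict \<eta> ?W \<in> states_at ?W"
    using assms by (auto simp: time_sets_def states_at_def)
  then obtain \<xi> where "\<xi> \<in> \<Omega>" and eq: "restrict \<xi> ?W = restrict \<eta> ?W"
    using conjunct2[OF path_space[unfolded path_space_def], rule_format, of ?W "restrict \<eta> ?W"] by auto
  moreover have "\<xi> t = \<eta> t" if "t \<in> W" for t
    using fun_cong[OF eq, of t] that by simp
  ultimately show ?thesis using that by blast
qed

definition determined :: "(real \<Rightarrow> 'x) set \<Rightarrow> real set \<Rightarrow> bool" where
  "determined A D \<longleftrightarrow> A \<subseteq> \<Omega> \<and> (\<forall>\<xi>\<in>\<Omega>. \<forall>\<xi>'\<in>A. (\<forall>t\<in>D. \<xi> t = \<xi>' t) \<longrightarrow> \<xi> \<in> A)"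

text \<open>Iterated sums visit functions that need not lie in \<Omega>. The indicator is extended
  to them by asking for a path in \<open>A\<close> with the same values on \<open>D\<close>.\<close>

definition ext_indicator :: "(real \<Rightarrow> 'x) set \<Rightarrow> real set \<Rightarrow> (real \<Rightarrow> 'x) \<Rightarrow> real" where
  "ext_indicator A D \<eta> = (if \<exists>\<xi>\<in>A. \<forall>t\<in>D. \<xi> t = \<eta> t then 1 else 0)"

lemma determined_mono: "determined A D \<Longrightarrow> D \<subseteq> D' \<Longrightarrow> determined A D'"
  unfolding determined_def by blast

lemma depends_on_ext_indicator: "depends_on (ext_indicator A D) D"
  by (auto simp: depends_on_def ext_indicator_def)

lemma ext_indicator_eq:
  assumes "determined A D" "\<xi> \<in> \<Omega>" "\<And>t. t \<in> D \<Longrightarrow> \<xi> t = \<eta> t"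
  shows "ext_indicator A D \<eta> = indicator A \<xi>"
  using assms unfolding determined_def ext_indicator_def indicator_def
  by (auto split: if_splits) metis

text \<open>Every finite assignment of states is realised in \<Omega>, so both extensions can be
  evaluated at one common genuine path.\<close>

lemma ext_indicator_superset:
  assumes "determined A D" "D \<subseteq> D'" "finite D'" "D' \<subseteq> {0..}"
  shows "ext_indicator A D' = ext_indicator A D"
proof
  fix \<eta> :: "real \<Rightarrow> 'x"
  obtain \<xi> where "\<xi> \<in> \<Omega>" "\<And>t. t \<in> D' \<Longrightarrow> \<xi> t = \<eta> t" using path_through[OF assms(3,4)] by metis
  moreover from this(2) have "\<And>t. t \<in> D \<Longrightarrow> \<xi> t = \<eta> t" using assms(2) by blast
  ultimately show "ext_indicator A D' \<eta> = ext_indicator A D \<eta>"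
    using ext_indicator_eq[OF assms(1), of \<xi> \<eta>] ext_indicator_eq[OF determined_mono[OF assms(1,2)], of \<xi> \<eta>]
    by simp
qed

definition future :: "real set \<Rightarrow> (real \<Rightarrow> 'x) set \<Rightarrow> real set \<Rightarrow> bool" where
  "future u A W \<longleftrightarrow> finite W \<and> W \<subseteq> {0..} \<and> (\<forall>w\<in>W. \<forall>r\<in>u. r < w) \<and> determined A (u \<union> W)"

definition last_time :: "real set \<Rightarrow> real" where "last_time u = Max (insert (- 1) u)"

text \<open>The chosen \<open>W\<close> has no influence on the value; two choices are compared
  through their union in \<open>cond_prob_eq\<close>.\<close>

definition cond_prob :: "real set \<Rightarrow> (real \<Rightarrow> 'x) \<Rightarrow> (real \<Rightarrow> 'x) set \<Rightarrow> real" where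
  "cond_prob u xu A = (let W = SOME W. future u A W in
     E (last_time u) xu (sorted_list_of_set W) (ext_indicator A (u \<union> W)))"

lemma last_time_less:
  assumes "u \<in> time_sets" "\<And>r. r \<in> u \<Longrightarrow> r < w" "0 \<le> w"
  shows "last_time u < w"
  using assms by (simp add: last_time_def time_sets_def)

lemma le_last_time: "u \<in> time_sets \<Longrightarrow> r \<in> u \<Longrightarrow> r \<le> last_time u"
  by (simp add: last_time_def time_sets_def)

lemma last_time_cases:
  assumes "u \<in> time_sets"
  obtains "u = {}" "last_time u = - 1" | "last_time u \<in> u" "0 \<le> last_time u"
proof (cases "u = {}")
  case True
  then show ?thesis using that by (simp add: last_time_def)
next
  case False
  then have "Max u \<in> u" using assms by (simp add: time_sets_def)
  then have "0 \<le> Max u" using assms by (auto simp: time_sets_def)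
  moreover have "last_time u = Max u"
    using False assms \<open>0 \<le> Max u\<close> by (simp add: last_time_def time_sets_def)
  ultimately show ?thesis using that(2) \<open>Max u \<in> u\<close> by simp
qed

text \<open>Events that admit such a finite set of later times form an algebra: unions merge the
  sets and complements keep them. Each generator involves a single time, in \<open>u\<close> or
  after it.\<close>

lemma event_algebra_future:
  assumes "A \<in> event_algebra \<Omega> u"
  shows "\<exists>W. future u A W"
proof (rule hull_induct[OF assms[unfolded event_algebra_def]])
  fix A assume "A \<in> {ev \<Omega> t x |t x. 0 \<le> t \<and> (t \<in> u \<or> (\<forall>r\<in>u. r < t))}"
  then obtain t x where A: "A = ev \<Omega> t x" "0 \<le> t" "t \<in> u \<or> (\<forall>r\<in>u. r < t)" by auto
  then have "future u A (if t \<in> u then {} else {t})"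
    by (auto simp: future_def determined_def ev_def)
  then show "\<exists>W. future u A W" by blast
next
  have un: "\<exists>W. future u (A \<union> B) W" if "future u A V" "future u B W" for A B V W
  proof
    have "determined A (u \<union> (V \<union> W))" "determined B (u \<union> (V \<union> W))"
      using that determined_mono[of _ "u \<union> _" "u \<union> (V \<union> W)"] by (auto simp: future_def)
    then show "future u (A \<union> B) (V \<union> W)"
      using that unfolding future_def determined_def by (auto 0 3)
  qed
  have diff: "future u (\<Omega> - A) W" if "future u A W" for A W
  proof -
    have "determined (\<Omega> - A) (u \<union> W)"
      unfolding determined_def
    proof (intro conjI ballI impI)
      fix \<xi> \<xi>' assume *: "\<xi> \<in> \<Omega>" "\<xi>' \<in> \<Omega> - A" "\<forall>t\<in>u \<union> W. \<xi> t = \<xi>' t"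
      have "\<xi> \<notin> A"
      proof
        assume "\<xi> \<in> A"
        moreover have "\<forall>t\<in>u \<union> W. \<xi>' t = \<xi> t" using * by auto
        ultimately have "\<xi>' \<in> A" using * that unfolding future_def determined_def by blast
        with * show False by simp
      qed
      with * show "\<xi> \<in> \<Omega> - A" by simp
    qed auto
    then show ?thesis using that by (simp add: future_def)
  qed
  have empty: "future u {} {}" by (simp add: future_def determined_def)
  show "algebra \<Omega> {A. \<exists>W. future u A W}" unfolding algebra_iff_Un
  proof (intro conjI ballI)
    show "{A. \<exists>W. future u A W} \<subseteq> Pow \<Omega>" by (auto simp: future_def determined_def)
  qed (use empty un diff in blast)+
qed

lemma cond_prob_eq_superset:
  assumes u: "u \<in> time_sets" and W: "future u A W" and "W \<subseteq> V" "finite V" "V \<subseteq> {0..}"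
    "\<And>w r. w \<in> V \<Longrightarrow> r \<in> u \<Longrightarrow> r < w"
  shows "E (last_time u) xu (sorted_list_of_set W) (ext_indicator A (u \<union> W))
    = E (last_time u) xu (sorted_list_of_set V) (ext_indicator A (u \<union> V))"
proof -
  have "ext_indicator A (u \<union> V) = ext_indicator A (u \<union> W)"
    using assms by (intro ext_indicator_superset) (auto simp: future_def time_sets_def)
  moreover have "E (last_time u) xu (sorted_list_of_set V) (ext_indicator A (u \<union> W))
      = E (last_time u) xu (sorted_list_of_set W) (ext_indicator A (u \<union> W))"
  proof (rule path_expectation_superset[OF _ _ _ _ depends_on_ext_indicator])
    show "last_time u < w" if "w \<in> V" for w
      using that assms by (intro last_time_less) auto
    show "(u \<union> W) \<inter> V \<subseteq> W" using assms(6) by blast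
  qed (use assms in \<open>auto simp: future_def\<close>)
  ultimately show ?thesis by simp
qed

lemma cond_prob_eq:
  assumes u: "u \<in> time_sets" and W: "future u A W"
  shows "cond_prob u xu A = E (last_time u) xu (sorted_list_of_set W) (ext_indicator A (u \<union> W))"
proof -
  define V where "V = (SOME W. future u A W)"
  have V: "future u A V" unfolding V_def using W by (rule someI)
  have "E (last_time u) xu (sorted_list_of_set W') (ext_indicator A (u \<union> W'))
      = E (last_time u) xu (sorted_list_of_set (V \<union> W)) (ext_indicator A (u \<union> (V \<union> W)))"
    if "W' = V \<or> W' = W" for W'
    by (rule cond_prob_eq_superset[OF u]) (use that V W in \<open>auto simp: future_def\<close>)
  then show ?thesis unfolding cond_prob_def V_def[symmetric] Let_def by metis
qed

text \<open>A process receives its conditioning event as a bare set, so a history that represents it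
  has to be chosen; \<open>process_eq\<close> shows that any choice gives the same value.\<close>

definition process :: "'x process" where
  "process = (\<lambda>(A, C)\<in>process_domain \<Omega>.
     SOME p. \<exists>u xu. u \<in> time_sets \<and> xu \<in> states_at u \<and> C = evs \<Omega> u xu \<and> A \<in> event_algebra \<Omega> u
       \<and> p = cond_prob u xu A)"

lemma processE:
  assumes "(A, C) \<in> process_domain \<Omega>"
  obtains u xu where "u \<in> time_sets" "xu \<in> states_at u" "C = evs \<Omega> u xu" "A \<in> event_algebra \<Omega> u"
    "process (A, C) = cond_prob u xu A"
proof -
  have "\<exists>p u xu. u \<in> time_sets \<and> xu \<in> states_at u \<and> C = evs \<Omega> u xu \<and> A \<in> event_algebra \<Omega> u
       \<and> p = cond_prob u xu A"
    using assms by (auto simp: process_domain_def)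
  from someI_ex[OF this] show ?thesis using that assms by (auto simp: process_def)
qed

text \<open>With two states available, a path in one event can be given a wrong state at any time
  that only the other event constrains. Hence an event determines its history.\<close>

lemma evs_inj:
  assumes "a \<noteq> (b :: 'x)" and "u \<in> time_sets" "xu \<in> states_at u" "v \<in> time_sets" "xv \<in> states_at v"
    and eq: "evs \<Omega> u xu = evs \<Omega> v xv"
  shows "u = v \<and> xu = xv"
proof -
  have sub: "v \<subseteq> u \<and> (\<forall>t\<in>v. xu t = xv t)"
    if u: "u \<in> time_sets" "v \<in> time_sets" and eq: "evs \<Omega> u xu = evs \<Omega> v xv" for u v xu xv
  proof -
    have "t \<in> u \<and> xu t = xv t" if t: "t \<in> v" for t
    proof -
      obtain c where c: "t \<notin> u \<Longrightarrow> c \<noteq> xv t" using assms(1) by metis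
      obtain \<xi> where \<xi>: "\<xi> \<in> \<Omega>" "\<And>r. r \<in> insert t u \<Longrightarrow> \<xi> r = (if r \<in> u then xu r else c)"
        by (rule path_through[of "insert t u" "\<lambda>r. if r \<in> u then xu r else c"])
          (use u t in \<open>auto simp: time_sets_def\<close>)
      then have "\<xi> \<in> evs \<Omega> u xu" by (simp add: evs_def)
      then have "\<xi> \<in> evs \<Omega> v xv" using eq by simp
      then have "\<xi> t = xv t" using t by (simp add: evs_def)
      then show ?thesis using \<xi>(2)[of t] c by (auto split: if_splits)
    qed
    then show ?thesis by blast
  qed
  from sub[OF assms(2,4) eq] sub[OF assms(4,2) eq[symmetric]]
  have "u = v" "\<And>t. t \<in> u \<Longrightarrow> xu t = xv t" by auto
  then show ?thesis using assms(3,5) unfolding states_at_def by (auto intro: PiE_ext)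
qed

lemma process_eq:
  assumes "u \<in> time_sets" "xu \<in> states_at u" "A \<in> event_algebra \<Omega> u"
  shows "process (A, evs \<Omega> u xu) = cond_prob u xu A"
proof -
  have "(A, evs \<Omega> u xu) \<in> process_domain \<Omega>" using assms by (auto simp: process_domain_def)
  then obtain v xv where v: "v \<in> time_sets" "xv \<in> states_at v" "evs \<Omega> u xu = evs \<Omega> v xv" "A \<in> event_algebra \<Omega> v"
    "process (A, evs \<Omega> u xu) = cond_prob v xv A" by (rule processE)
  show ?thesis
  proof (cases "\<exists>a b :: 'x. a \<noteq> b")
    case True
    then show ?thesis using evs_inj assms v by metis
  next
    case False
    \<comment> \<open>With only one state, different histories describe the same event; but all
      paths coincide, and every conditional probability is an indicator at the single path.\<close>
    then have single: "\<eta> = \<eta>'" for \<eta> \<eta>' :: "real \<Rightarrow> 'x" by (metis ext)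
    obtain \<xi> where "\<xi> \<in> \<Omega>" using path_through[of "{}"] by auto
    have "cond_prob w xw A = indicator A \<xi>" if w: "w \<in> time_sets" "A \<in> event_algebra \<Omega> w" for w xw
    proof -
      obtain W where W: "future w A W" using event_algebra_future[OF w(2)] by blast
      have "ext_indicator A (w \<union> W) = (\<lambda>\<eta>. indicator A \<xi> - 0)"
      proof
        fix \<eta>
        have "ext_indicator A (w \<union> W) \<eta> = indicator A \<xi>"
          by (rule ext_indicator_eq[OF _ \<open>\<xi> \<in> \<Omega>\<close>]) (use W single[of \<xi> \<eta>] in \<open>auto simp: future_def\<close>)
        then show "ext_indicator A (w \<union> W) \<eta> = indicator A \<xi> - 0" by simp
      qed
      then show ?thesis
        unfolding cond_prob_eq[OF w(1) W]
        using path_expectation_const_diff[of K _ _ _ "indicator A \<xi>" "\<lambda>_. 0", OF K_sum]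
          path_expectation_mult_const[of K _ _ _ 0 "\<lambda>_. 0"] by simp
    qed
    then show ?thesis using v assms by simp
  qed
qed

lemma ev_in_event_algebra:
  "0 \<le> t \<Longrightarrow> t \<in> u \<or> (\<forall>r\<in>u. r < t) \<Longrightarrow> ev \<Omega> t x \<in> event_algebra \<Omega> u"
  unfolding event_algebra_def by (rule hull_inc) auto

lemma process_ev:
  assumes "u \<in> time_sets" "xu \<in> states_at u" "0 \<le> s" "\<And>r. r \<in> u \<Longrightarrow> r < s"
  shows "process (ev \<Omega> s y, evs \<Omega> u xu) = K (last_time u) s (xu (last_time u)) y"
proof -
  have W: "future u (ev \<Omega> s y) {s}" using assms by (auto simp: future_def determined_def ev_def)
  have "ext_indicator (ev \<Omega> s y) (u \<union> {s}) = (\<lambda>\<eta>. if \<eta> s = y then 1 else 0)"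
  proof
    fix \<eta> :: "real \<Rightarrow> 'x"
    have "finite (u \<union> {s})" "u \<union> {s} \<subseteq> {0..}" using assms by (auto simp: time_sets_def)
    then obtain \<xi> where \<xi>: "\<xi> \<in> \<Omega>" "\<And>t. t \<in> u \<union> {s} \<Longrightarrow> \<xi> t = \<eta> t" using path_through by metis
    then show "ext_indicator (ev \<Omega> s y) (u \<union> {s}) \<eta> = (if \<eta> s = y then 1 else 0)"
      using ext_indicator_eq[of "ev \<Omega> s y" "u \<union> {s}" \<xi> \<eta>] W by (simp add: future_def ev_def indicator_def)
  qed
  then show ?thesis
    using assms by (simp add: process_eq ev_in_event_algebra cond_prob_eq[OF _ W] if_distrib cong: if_cong)
qed

lemma process_ev_present:
  assumes "u \<in> time_sets" "xu \<in> states_at u" "t \<in> u"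
  shows "process (ev \<Omega> t y, evs \<Omega> u xu) = (if xu t = y then 1 else 0)"
proof -
  have W: "future u (ev \<Omega> t y) {}" using assms by (auto simp: future_def determined_def ev_def)
  have "finite u" "u \<subseteq> {0..}" using assms by (auto simp: time_sets_def)
  then obtain \<xi> where \<xi>: "\<xi> \<in> \<Omega>" "\<And>t. t \<in> u \<Longrightarrow> \<xi> t = xu t" using path_through by metis
  then have "ext_indicator (ev \<Omega> t y) u xu = (if xu t = y then 1 else 0)"
    using ext_indicator_eq[of "ev \<Omega> t y" u \<xi> xu] W assms by (simp add: future_def ev_def indicator_def)
  then show ?thesis
    using assms cond_prob_eq[OF assms(1) W] by (simp add: process_eq ev_in_event_algebra time_sets_def subset_iff)
qed

text \<open>The tower property at \<open>last_time u\<close>: given the states up to then, either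
  the history differs from \<open>xu\<close> and the bet is off, or the inner expectation of
  \<open>h\<close> is exactly its price \<open>c\<close>. The kernel \<open>K'\<close> is arbitrary
  because perturbed kernels may violate Chapman-Kolmogorov; accordingly \<open>V\<close> consists of
  all times of \<open>W\<close> after \<open>u\<close>.\<close>

lemma path_expectation_called_off:
  assumes sum: "\<And>r s x. (\<Sum>y\<in>UNIV. K' r s x y) = 1" and initial: "\<And>s x x'. K' (- 1) s x = K' (- 1) s x'"
    and u: "u \<in> time_sets" "u \<subseteq> W" and W: "finite W" "W \<subseteq> {0..}"
    and V: "V = W \<inter> {last_time u<..}" and h: "depends_on h (u \<union> V)"
    and c: "c = path_expectation K' (last_time u) xu (sorted_list_of_set V) h"
  shows "path_expectation K' (- 1) \<xi> (sorted_list_of_set W)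
    (\<lambda>\<eta>. (if \<forall>t\<in>u. \<eta> t = xu t then 1 else 0) * (c - h \<eta>)) = 0"
proof -
  define m where "m = last_time u"
  define g where "g \<eta> = (if \<forall>t\<in>u. \<eta> t = xu t then 1 else 0 :: real)" for \<eta>
  have fin: "finite V" "finite (W \<inter> {..m})" using W V by auto
  have last: "last (- 1 # sorted_list_of_set (W \<inter> {..m})) = m"
    using u(1)
  proof (cases rule: last_time_cases)
    case 1
    then have "W \<inter> {..m} = {}" using W by (auto simp: m_def)
    then show ?thesis using 1 by (simp add: m_def)
  next
    case 2
    then have m: "m \<in> W \<inter> {..m}" using u by (auto simp: m_def)
    then have "last (sorted_list_of_set (W \<inter> {..m})) = m"
      by (intro last_sorted_list_of_set) (use fin in auto)
    moreover have "sorted_list_of_set (W \<inter> {..m}) \<noteq> []"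
      using m fin by (simp only: sorted_list_of_set_eq_Nil_iff) auto
    ultimately show ?thesis by simp
  qed
  have inner: "path_expectation K' m \<eta> (sorted_list_of_set V) (\<lambda>\<eta>. g \<eta> * (c - h \<eta>)) = 0" for \<eta>
  proof -
    have "depends_on g u" by (auto simp: depends_on_def g_def)
    moreover have "u \<inter> set (sorted_list_of_set V) = {}"
      using fin V le_last_time[OF u(1)] by fastforce
    ultimately have "path_expectation K' m \<eta> (sorted_list_of_set V) (\<lambda>\<eta>. g \<eta> * (c - h \<eta>))
        = g \<eta> * (c - path_expectation K' m \<eta> (sorted_list_of_set V) h)"
      by (simp add: path_expectation_mult_left path_expectation_const_diff[OF sum])
    also have "\<dots> = 0"
    proof (cases "\<forall>t\<in>u. \<eta> t = xu t")
      case True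
      \<comment> \<open>For empty \<open>u\<close> the time \<open>m\<close> is -1, where \<eta> and
        \<open>xu\<close> may differ but the kernel ignores the state.\<close>
      have "K' m w (\<eta> m) = K' m w (xu m)" for w
        using u(1)
      proof (cases rule: last_time_cases)
        case 1
        then show ?thesis unfolding m_def using initial by metis
      next
        case 2
        then show ?thesis using True by (simp add: m_def)
      qed
      then have "path_expectation K' m \<eta> (sorted_list_of_set V) h = c"
        unfolding c m_def[symmetric]
        by (intro path_expectation_agree[OF h]) (use True fin in auto)
      then show ?thesis by simp
    next
      case False
      then have "g \<eta> = 0" by (auto simp: g_def)
      then show ?thesis by simp
    qed
    finally show ?thesis .
  qed
  have "path_expectation K' (- 1) \<xi> (sorted_list_of_set W) (\<lambda>\<eta>. g \<eta> * (c - h \<eta>))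
      = path_expectation K' (- 1) \<xi> (sorted_list_of_set (W \<inter> {..m})) (\<lambda>\<eta>. 0)"
    unfolding sorted_list_of_set_split[OF W(1), of m] path_expectation_append last
      V[symmetric, folded m_def] inner ..
  also have "\<dots> = 0" using path_expectation_mult_const[of K' _ _ _ 0 "\<lambda>_. 0"] by simp
  finally show ?thesis by (simp add: g_def)
qed

text \<open>Conditioning events may have probability zero, but mixing the transition probabilities with the
  uniform distribution makes every finite history possible. The perturbed gamble has expectation zero,
  so it cannot be negative on the union of the conditioning events.\<close>

lemma process_coherent: "coherent \<Omega> process"
  unfolding coherent_def
proof (intro allI impI)
  fix n :: nat and A C :: "nat \<Rightarrow> (real \<Rightarrow> 'x) set" and l :: "nat \<Rightarrow> real"
  assume n: "1 \<le> n" and dom: "\<forall>i\<in>{1..n}. (A i, C i) \<in> process_domain \<Omega>"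
  define G where "G \<xi> = (\<Sum>i = 1..n. l i * indicator (C i) \<xi> * (process (A i, C i) - indicator (A i) \<xi>))" for \<xi>
  define U where "U = (\<Union>i\<in>{1..n}. C i)"
  have "\<forall>i\<in>{1..n}. \<exists>p. fst p \<in> time_sets \<and> C i = evs \<Omega> (fst p) (fst (snd p)) \<and> future (fst p) (A i) (snd (snd p))
      \<and> process (A i, C i) = cond_prob (fst p) (fst (snd p)) (A i)"
  proof
    fix i assume "i \<in> {1..n}"
    with dom obtain u xu where u: "u \<in> time_sets" "C i = evs \<Omega> u xu" "A i \<in> event_algebra \<Omega> u"
      "process (A i, C i) = cond_prob u xu (A i)" by (metis processE)
    obtain W where "future u (A i) W" using event_algebra_future[OF u(3)] by blast
    with u show "\<exists>p. fst p \<in> time_sets \<and> C i = evs \<Omega> (fst p) (fst (snd p)) \<and> future (fst p) (A i) (snd (snd p))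
      \<and> process (A i, C i) = cond_prob (fst p) (fst (snd p)) (A i)"
      by (intro exI[of _ "(u, xu, W)"]) simp
  qed
  from bchoice[OF this] obtain p where p: "\<forall>i\<in>{1..n}. fst (p i) \<in> time_sets \<and> C i = evs \<Omega> (fst (p i)) (fst (snd (p i)))
      \<and> future (fst (p i)) (A i) (snd (snd (p i)))
      \<and> process (A i, C i) = cond_prob (fst (p i)) (fst (snd (p i))) (A i)" by blast
  define u where "u i = fst (p i)" for i
  define xu where "xu i = fst (snd (p i))" for i
  define F where "F i = snd (snd (p i))" for i
  have u: "u i \<in> time_sets" "C i = evs \<Omega> (u i) (xu i)" "future (u i) (A i) (F i)"
    "process (A i, C i) = cond_prob (u i) (xu i) (A i)" if "i \<in> {1..n}" for i
    using p[THEN bspec, OF that] unfolding u_def xu_def F_def by blast+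
  define W where "W = (\<Union>i\<in>{1..n}. u i \<union> F i)"
  have W: "finite W" "W \<subseteq> {0..}"
    using u unfolding W_def by (auto simp: time_sets_def future_def subset_iff)
  have uW: "u i \<subseteq> W" "F i \<subseteq> W" if "i \<in> {1..n}" for i using that by (auto simp: W_def)
  \<comment> \<open>All bets are evaluated on the common set \<open>W\<close>; \<open>V i\<close> is
    the part that is still random given the history of bet \<open>i\<close>.\<close>
  define V where "V i = W \<inter> {last_time (u i)<..}" for i
  have FV: "F i \<subseteq> V i" if i: "i \<in> {1..n}" for i
  proof
    fix w assume w: "w \<in> F i"
    then have "last_time (u i) < w"
      using u(3)[OF i] by (intro last_time_less u i) (auto simp: future_def)
    then show "w \<in> V i" using w uW[OF i] by (auto simp: V_def)
  qed
  have h: "ext_indicator (A i) (u i \<union> V i) = ext_indicator (A i) W"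
    and hF: "determined (A i) W" if i: "i \<in> {1..n}" for i
  proof -
    have det: "determined (A i) (u i \<union> F i)" using u(3)[OF i] by (simp add: future_def)
    have "ext_indicator (A i) W = ext_indicator (A i) (u i \<union> V i)"
      using determined_mono[OF det, of "u i \<union> V i"] FV[OF i] uW[OF i]
      by (intro ext_indicator_superset W) (auto simp: V_def)
    then show "ext_indicator (A i) (u i \<union> V i) = ext_indicator (A i) W" by simp
    show "determined (A i) W" using determined_mono[OF det] uW[OF i] by simp
  qed
  define Ke where "Ke \<epsilon> r s x y = (1 - \<epsilon>) * K r s x y + \<epsilon> / CARD('x)" for \<epsilon> r s x y
  have Ke_sum: "(\<Sum>y\<in>UNIV. Ke \<epsilon> r s x y) = 1" for \<epsilon> r s x
    by (simp add: Ke_def sum.distrib K_sum flip: sum_distrib_left)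
  have Ke_initial: "Ke \<epsilon> (- 1) s x = Ke \<epsilon> (- 1) s x'" for \<epsilon> s x x'
    unfolding Ke_def using K_initial[of s x x'] by simp
  have Ke_pos: "0 < Ke \<epsilon> r s x y" if "0 < \<epsilon>" "\<epsilon> < 1" for \<epsilon> r s x y
    unfolding Ke_def using that K_nonneg by (intro add_nonneg_pos) auto
  have Ke_0: "Ke 0 = K" by (simp add: Ke_def fun_eq_iff)
  \<comment> \<open>Prices recomputed for the perturbed kernel on the full grid. At \<epsilon> = 0
    they are the values of the process, by Chapman-Kolmogorov for \<open>K\<close>.\<close>
  define c where "c \<epsilon> i = path_expectation (Ke \<epsilon>) (last_time (u i)) (xu i) (sorted_list_of_set (V i)) (ext_indicator (A i) W)" for \<epsilon> i
  have c0: "process (A i, C i) = c 0 i" if i: "i \<in> {1..n}" for i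
  proof -
    have "process (A i, C i) = E (last_time (u i)) (xu i) (sorted_list_of_set (V i)) (ext_indicator (A i) (u i \<union> V i))"
      unfolding u(4)[OF i] cond_prob_eq[OF u(1,3)[OF i]]
    proof (rule cond_prob_eq_superset[OF u(1,3)[OF i] FV[OF i]])
      show "r < w" if "w \<in> V i" "r \<in> u i" for w r
        using le_last_time[OF u(1)[OF i] that(2)] that(1) by (simp add: V_def)
    qed (use W in \<open>auto simp: V_def\<close>)
    then show ?thesis by (simp add: c_def h[OF i] Ke_0)
  qed
  have c_lim: "((\<lambda>\<epsilon>. c \<epsilon> i) \<longlongrightarrow> c 0 i) (at_right 0)" for i
    unfolding c_def
  proof (rule tendsto_path_expectation)
    show "((\<lambda>\<epsilon>. Ke \<epsilon> r s x y) \<longlongrightarrow> Ke 0 r s x y) (at_right 0)" for r s x y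
      unfolding Ke_def by (intro tendsto_intros) auto
  qed
  define g where "g i \<eta> = (if \<forall>t\<in>u i. \<eta> t = xu i t then 1 else 0 :: real)" for i \<eta>
  define H where "H \<epsilon> \<eta> = (\<Sum>i = 1..n. l i * (g i \<eta> * (c \<epsilon> i - ext_indicator (A i) W \<eta>)))" for \<epsilon> \<eta>
  have H_zero: "path_expectation (Ke \<epsilon>) (- 1) \<xi> (sorted_list_of_set W) (H \<epsilon>) = 0" for \<epsilon> \<xi>
  proof -
    have "path_expectation (Ke \<epsilon>) (- 1) \<xi> (sorted_list_of_set W) (\<lambda>\<eta>. g i \<eta> * (c \<epsilon> i - ext_indicator (A i) W \<eta>)) = 0"
      if i: "i \<in> {1..n}" for i
      unfolding g_def
    proof (rule path_expectation_called_off[of "Ke \<epsilon>", OF Ke_sum Ke_initial u(1)[OF i] uW(1)[OF i] W])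
      show "V i = W \<inter> {last_time (u i)<..}" by (simp add: V_def)
      show "depends_on (ext_indicator (A i) W) (u i \<union> V i)"
        unfolding h[OF i, symmetric] by (rule depends_on_ext_indicator)
    qed (simp add: c_def)
    then show ?thesis
      unfolding H_def[abs_def] path_expectation_sum path_expectation_mult_const by simp
  qed
  have H_dep: "depends_on (H \<epsilon>) W" for \<epsilon>
    unfolding depends_on_def
  proof (intro allI impI)
    fix \<eta> \<eta>' :: "real \<Rightarrow> 'x" assume "\<forall>t\<in>W. \<eta> t = \<eta>' t"
    moreover from this have "(\<forall>t\<in>u i. \<eta> t = xu i t) \<longleftrightarrow> (\<forall>t\<in>u i. \<eta>' t = xu i t)" if "i \<in> {1..n}" for i
      using uW(1)[OF that] by (metis subsetD)
    ultimately have "g i \<eta> = g i \<eta>' \<and> ext_indicator (A i) W \<eta> = ext_indicator (A i) W \<eta>'" if "i \<in> {1..n}" for i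
      using depends_onD[OF depends_on_ext_indicator, of W \<eta> \<eta>'] that by (simp add: g_def)
    then show "H \<epsilon> \<eta> = H \<epsilon> \<eta>'" unfolding H_def by (intro sum.cong) auto
  qed
  have H_G: "G \<xi> = H 0 \<xi>" if "\<xi> \<in> \<Omega>" for \<xi>
    unfolding G_def H_def
  proof (rule sum.cong[OF refl])
    fix i assume i: "i \<in> {1..n}"
    have "ext_indicator (A i) W \<xi> = indicator (A i) \<xi>"
      by (rule ext_indicator_eq[OF hF[OF i] that]) simp
    moreover have "g i \<xi> = indicator (C i) \<xi>"
      using that by (simp add: u(2)[OF i] g_def evs_def indicator_def)
    ultimately show "l i * indicator (C i) \<xi> * (process (A i, C i) - indicator (A i) \<xi>)
        = l i * (g i \<xi> * (c 0 i - ext_indicator (A i) W \<xi>))"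
      using c0[OF i] by simp
  qed
  have U: "U \<subseteq> \<Omega>" using u(2) by (auto simp: U_def evs_def)
  have "G ` U = H 0 ` U" using H_G U by (intro image_cong) auto
  then have fin: "finite (G ` U)" using finite_image_depends_on[OF H_dep W(1)] by simp
  show "0 \<le> Max (G ` U)"
  proof (rule ccontr)
    assume neg: "\<not> 0 \<le> Max (G ` U)"
    define \<mu> where "\<mu> = Max (G ` U)"
    have \<mu>: "\<mu> < 0" using neg by (simp add: \<mu>_def)
    \<comment> \<open>Although \<eta> may lie outside \<Omega>, a path in \<Omega> agreeing with it
      on \<open>W\<close> lies in a conditioning event, so the maximum applies.\<close>
    have H0: "H 0 \<eta> \<le> \<mu>" if i: "i \<in> {1..n}" and \<eta>: "g i \<eta> \<noteq> 0" for i \<eta>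
    proof -
      obtain \<xi> where \<xi>: "\<xi> \<in> \<Omega>" "\<And>t. t \<in> W \<Longrightarrow> \<xi> t = \<eta> t" by (rule path_through[OF W, of \<eta>]) blast
      have "\<forall>t\<in>u i. \<eta> t = xu i t" using \<eta> by (simp add: g_def split: if_splits)
      then have "\<xi> \<in> C i" unfolding u(2)[OF i] evs_def using \<xi> uW(1)[OF i] by auto
      then have "\<xi> \<in> U" using i by (auto simp: U_def)
      moreover have "H 0 \<eta> = H 0 \<xi>" by (rule depends_onD[OF H_dep]) (simp add: \<xi>)
      ultimately show ?thesis
        unfolding \<mu>_def using H_G[OF \<xi>(1)] fin by (metis Max_ge imageI)
    qed
    \<comment> \<open>The effect of changing the prices, bounded uniformly in \<eta>; it vanishes
      with \<epsilon> and is eventually smaller than the gap \<open>- \<mu>\<close>.\<close>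
    define e where "e \<epsilon> = (\<Sum>i = 1..n. \<bar>l i\<bar> * \<bar>c \<epsilon> i - c 0 i\<bar>)" for \<epsilon>
    have "(e \<longlongrightarrow> (\<Sum>i = 1..n. \<bar>l i\<bar> * \<bar>c 0 i - c 0 i\<bar>)) (at_right 0)"
      unfolding e_def[abs_def] by (intro tendsto_intros c_lim)
    then have "\<forall>\<^sub>F \<epsilon> in at_right 0. e \<epsilon> < - \<mu>" using \<mu> by (intro order_tendstoD(2)) auto
    moreover have "\<forall>\<^sub>F \<epsilon> in at_right 0. \<epsilon> < (1::real)"
      by (rule order_tendstoD(2)[OF tendsto_ident_at]) simp
    ultimately have "\<forall>\<^sub>F \<epsilon> in at_right 0. e \<epsilon> < - \<mu> \<and> 0 < \<epsilon> \<and> \<epsilon> < 1"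
      using eventually_at_right_less[of "0::real"] by eventually_elim auto
    then obtain \<epsilon> where \<epsilon>: "e \<epsilon> < - \<mu>" "0 < \<epsilon>" "\<epsilon> < 1"
      using eventually_happens'[OF trivial_limit_at_right_real] by blast
    have H_le: "H \<epsilon> \<eta> \<le> H 0 \<eta> + e \<epsilon>" for \<eta>
      unfolding H_def e_def sum.distrib[symmetric]
    proof (rule sum_mono)
      fix i assume "i \<in> {1..n}"
      have "l i * (c \<epsilon> i - c 0 i) \<le> \<bar>l i\<bar> * \<bar>c \<epsilon> i - c 0 i\<bar>" by (metis abs_ge_self abs_mult)
      then show "l i * (g i \<eta> * (c \<epsilon> i - ext_indicator (A i) W \<eta>))
          \<le> l i * (g i \<eta> * (c 0 i - ext_indicator (A i) W \<eta>)) + \<bar>l i\<bar> * \<bar>c \<epsilon> i - c 0 i\<bar>"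
        by (simp add: g_def algebra_simps)
    qed
    have H_neg: "H \<epsilon> \<eta> < 0" if "i \<in> {1..n}" "g i \<eta> \<noteq> 0" for i \<eta>
      using H_le[of \<eta>] H0[OF that] \<epsilon>(1) by linarith
    have H_nonpos: "H \<epsilon> \<eta> \<le> 0" for \<eta>
    proof (cases "\<exists>i\<in>{1..n}. g i \<eta> \<noteq> 0")
      case True
      then show ?thesis using H_neg less_imp_le by blast
    next
      case False
      then show ?thesis unfolding H_def by (intro sum_nonpos) simp
    qed
    \<comment> \<open>The path \<open>xu 1\<close> satisfies the first conditioning event, so the
      gamble is strictly negative somewhere with positive weight.\<close>
    have "path_expectation (Ke \<epsilon>) (- 1) (xu 1) (sorted_list_of_set W) (H \<epsilon>) < 0"
    proof (rule path_expectation_neg[OF Ke_pos[OF \<epsilon>(2,3)] H_nonpos])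
      have 1: "1 \<in> {1..n}" using n by simp
      have "g 1 (override_on (xu 1) (xu 1) (set (sorted_list_of_set W))) \<noteq> 0"
        by (simp add: g_def override_on_def)
      then show "H \<epsilon> (override_on (xu 1) (xu 1) (set (sorted_list_of_set W))) < 0" by (rule H_neg[OF 1])
    qed
    then show False using H_zero by simp
  qed
qed

lemma stochastic_process_process: "stochastic_process \<Omega> process"
  unfolding stochastic_process_def using process_coherent by (simp add: process_def)

end

section \<open>Consequences of coherence\<close>

text \<open>Coherence for the stakes \<open>l\<close> and for their negatives gives
  \<open>c \<ge> 0\<close> and \<open>- c \<ge> 0\<close>. Equational laws of probability thus
  reduce to finding stakes for which the randomness cancels.\<close>

lemma coherent_sum_const:
  fixes P :: "'x process"
  assumes coh: "coherent \<Omega> P" and I: "finite I" "i0 \<in> I" "C i0 \<noteq> {}"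
    and dom: "\<And>i. i \<in> I \<Longrightarrow> (A i, C i) \<in> process_domain \<Omega>"
    and const: "\<And>\<omega>. \<omega> \<in> (\<Union>i\<in>I. C i) \<Longrightarrow>
      (\<Sum>i\<in>I. l i * indicator (C i) \<omega> * (P (A i, C i) - indicator (A i) \<omega>)) = c"
  shows "c = 0"
proof -
  obtain h where h: "bij_betw h {1..card I} I" using ex_bij_betw_nat_finite_1[OF I(1)] by blast
  have card: "1 \<le> card I" using I by (auto simp: card_gt_0_iff Suc_le_eq)
  have hI: "h i \<in> I" if "i \<in> {1..card I}" for i using h that by (meson bij_betwE)
  define U where "U = (\<Union>i\<in>{1..card I}. C (h i))"
  have U: "U = (\<Union>i\<in>I. C i)" unfolding U_def using bij_betw_imp_surj_on[OF h] by (metis image_image)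
  have ge: "0 \<le> d" if "d = c \<and> k = l \<or> d = - c \<and> k = (\<lambda>i. - l i)" for d k
  proof -
    have "0 \<le> Max ((\<lambda>\<omega>. \<Sum>i = 1..card I. k (h i) * indicator (C (h i)) \<omega> * (P (A (h i), C (h i)) - indicator (A (h i)) \<omega>)) ` U)"
      using coh[unfolded coherent_def, rule_format, of "card I" "A \<circ> h" "C \<circ> h" "k \<circ> h"] card dom hI
      by (simp add: U_def)
    also have "(\<lambda>\<omega>. \<Sum>i = 1..card I. k (h i) * indicator (C (h i)) \<omega> * (P (A (h i), C (h i)) - indicator (A (h i)) \<omega>)) ` U
        = (\<lambda>\<omega>. d) ` U"
    proof (rule image_cong[OF refl])
      fix \<omega> assume \<omega>: "\<omega> \<in> U"
      have "(\<Sum>i = 1..card I. k (h i) * indicator (C (h i)) \<omega> * (P (A (h i), C (h i)) - indicator (A (h i)) \<omega>))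
          = (\<Sum>i\<in>I. k i * indicator (C i) \<omega> * (P (A i, C i) - indicator (A i) \<omega>))"
        by (rule sum.reindex_bij_betw[OF h])
      also have "\<dots> = d" using const[of \<omega>] \<omega> that by (auto simp: U sum_negf)
      finally show "(\<Sum>i = 1..card I. k (h i) * indicator (C (h i)) \<omega> * (P (A (h i), C (h i)) - indicator (A (h i)) \<omega>)) = d" .
    qed
    also have "(\<lambda>\<omega>. d) ` U = {d}" using I by (auto simp: U)
    finally show ?thesis by simp
  qed
  from ge[of c l] ge[of "- c" "\<lambda>i. - l i"] show "c = 0" by simp
qed

lemma coherent_nonneg:
  fixes P :: "'x process"
  assumes coh: "coherent \<Omega> P" and dom: "(A, C) \<in> process_domain \<Omega>" and C: "C \<noteq> {}"
  shows "0 \<le> P (A, C)"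
proof -
  have "0 \<le> Max ((\<lambda>\<omega>. indicator C \<omega> * (P (A, C) - indicator A \<omega>)) ` C)"
    using coh[unfolded coherent_def, rule_format, of 1 "\<lambda>_. A" "\<lambda>_. C" "\<lambda>_. 1"] dom by simp
  also have "\<dots> \<le> P (A, C)"
  proof (subst Max_le_iff)
    have "(\<lambda>\<omega>. indicator C \<omega> * (P (A, C) - indicator A \<omega>)) ` C \<subseteq> {P (A, C), P (A, C) - 1}"
      by (auto simp: indicator_def)
    then show "finite ((\<lambda>\<omega>. indicator C \<omega> * (P (A, C) - indicator A \<omega>)) ` C)"
      by (rule finite_subset) simp
  qed (use C in \<open>auto simp: indicator_def\<close>)
  finally show ?thesis .
qed

lemma ev_Int_evs: "t \<notin> u \<Longrightarrow> ev \<Omega> t x \<inter> evs \<Omega> u xu = evs \<Omega> (insert t u) (xu(t := x))"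
  by (auto simp: ev_def evs_def)

lemma states_at_insert: "xu \<in> states_at u \<Longrightarrow> xu(t := x) \<in> states_at (insert t u)"
  unfolding states_at_def by (auto simp: PiE_def extensional_def)

lemma time_sets_before_notin: "u \<in> time_sets_before t \<Longrightarrow> t \<notin> u"
  by (auto simp: time_sets_before_def)

lemma insert_time_sets_before:
  "u \<in> time_sets_before t \<Longrightarrow> 0 \<le> t \<Longrightarrow> t < r \<Longrightarrow> insert t u \<in> time_sets_before r"
  by (force simp: time_sets_before_def time_sets_def)

lemma evs_nonempty:
  assumes "path_space \<Omega>" "u \<in> time_sets" "xu \<in> states_at u"
  shows "evs \<Omega> u xu \<noteq> {}"
proof (cases "u = {}")
  case True
  have "{0} \<in> time_sets" "restrict xu {0} \<in> states_at {0}" by (auto simp: time_sets_def states_at_def)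
  then have "\<Omega> \<noteq> {}" using assms(1) by (fastforce simp: path_space_def)
  then show ?thesis using True by (simp add: evs_def)
next
  case False
  then obtain \<omega> where \<omega>: "\<omega> \<in> \<Omega>" "restrict \<omega> u = xu"
    using conjunct2[OF assms(1)[unfolded path_space_def]] assms(2,3) by blast
  then have "\<omega> t = xu t" if "t \<in> u" for t using that by auto
  then show ?thesis using \<omega> by (auto simp: evs_def)
qed

lemma ev_domain:
  assumes "u \<in> time_sets" "xu \<in> states_at u" "0 \<le> t" "t \<in> u \<or> (\<forall>r\<in>u. r < t)"
  shows "(ev \<Omega> t x, evs \<Omega> u xu) \<in> process_domain \<Omega>"
proof -
  have "ev \<Omega> t x \<in> event_algebra \<Omega> u"
    unfolding event_algebra_def by (rule hull_inc) (use assms in auto)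
  then show ?thesis using assms by (auto simp: process_domain_def)
qed

lemma sum_indicator_ev:
  fixes c :: "'x::finite \<Rightarrow> real"
  assumes "\<omega> \<in> \<Omega>"
  shows "(\<Sum>y\<in>UNIV. c y * indicator (ev \<Omega> t y) \<omega>) = c (\<omega> t)"
proof -
  have "(\<Sum>y\<in>UNIV. c y * indicator (ev \<Omega> t y) \<omega>) = (\<Sum>y\<in>UNIV. if \<omega> t = y then c y else 0)"
    using assms by (intro sum.cong) (auto simp: ev_def indicator_def)
  then show ?thesis by simp
qed

locale coherent_process =
  fixes \<Omega> :: "(real \<Rightarrow> 'x::finite) set" and P :: "'x process"
  assumes path_space: "path_space \<Omega>" and coherent: "coherent \<Omega> P"
begin

lemma prob_sum:
  assumes "u \<in> time_sets" "xu \<in> states_at u" "0 \<le> t" "t \<in> u \<or> (\<forall>r\<in>u. r < t)"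
  shows "(\<Sum>y\<in>UNIV. P (ev \<Omega> t y, evs \<Omega> u xu)) = 1"
proof -
  have "(\<Sum>y\<in>UNIV. P (ev \<Omega> t y, evs \<Omega> u xu)) - 1 = 0"
  proof (rule coherent_sum_const[OF coherent, of UNIV undefined "\<lambda>_. evs \<Omega> u xu" "\<lambda>y. ev \<Omega> t y" "\<lambda>_. 1"])
    fix \<omega> assume "\<omega> \<in> (\<Union>i\<in>(UNIV::'x set). evs \<Omega> u xu)"
    then have \<omega>: "\<omega> \<in> evs \<Omega> u xu" "\<omega> \<in> \<Omega>" by (auto simp: evs_def)
    then show "(\<Sum>y\<in>UNIV. 1 * indicator (evs \<Omega> u xu) \<omega> * (P (ev \<Omega> t y, evs \<Omega> u xu) - indicator (ev \<Omega> t y) \<omega>))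
        = (\<Sum>y\<in>UNIV. P (ev \<Omega> t y, evs \<Omega> u xu)) - 1"
      using sum_indicator_ev[OF \<omega>(2), of "\<lambda>_. 1" t] by (simp add: sum_subtractf)
  qed (use assms in \<open>auto intro!: ev_domain dest: evs_nonempty[OF path_space]\<close>)
  then show ?thesis by simp
qed

lemma prob_present:
  assumes "u \<in> time_sets" "xu \<in> states_at u" "t \<in> u"
  shows "P (ev \<Omega> t y, evs \<Omega> u xu) = (if xu t = y then 1 else 0)"
proof -
  have t: "0 \<le> t" using assms by (auto simp: time_sets_def)
  have "P (ev \<Omega> t y, evs \<Omega> u xu) - (if xu t = y then 1 else 0) = 0"
  proof (rule coherent_sum_const[OF coherent, of "{()}" "()" "\<lambda>_. evs \<Omega> u xu" "\<lambda>_. ev \<Omega> t y" "\<lambda>_. 1"])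
    show "(\<Sum>i\<in>{()}. 1 * indicator (evs \<Omega> u xu) \<omega> * (P (ev \<Omega> t y, evs \<Omega> u xu) - indicator (ev \<Omega> t y) \<omega>))
        = P (ev \<Omega> t y, evs \<Omega> u xu) - (if xu t = y then 1 else 0)"
      if "\<omega> \<in> (\<Union>i\<in>{()}. evs \<Omega> u xu)" for \<omega>
      using that assms(3) by (auto simp: evs_def ev_def indicator_def)
  qed (use assms t in \<open>auto intro!: ev_domain dest: evs_nonempty[OF path_space]\<close>)
  then show ?thesis by simp
qed

text \<open>Bet on \<open>X\<^sub>s = y\<close> given \<open>C\<close>, against it given each
  refined history \<open>D z\<close>, and against each \<open>X\<^sub>r = z\<close> given
  \<open>C\<close> with stake \<open>P (ev \<Omega> s y, D z)\<close>. On \<open>C\<close> all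
  indicators cancel.\<close>

lemma prob_tower:
  assumes u: "u \<in> time_sets" "xu \<in> states_at u" and r: "0 \<le> r" "\<forall>q\<in>u. q < r" and s: "r < s"
  shows "P (ev \<Omega> s y, evs \<Omega> u xu)
    = (\<Sum>z\<in>UNIV. P (ev \<Omega> r z, evs \<Omega> u xu) * P (ev \<Omega> s y, evs \<Omega> (insert r u) (xu(r := z))))"
proof -
  define C where "C = evs \<Omega> u xu"
  define D where "D z = evs \<Omega> (insert r u) (xu(r := z))" for z
  have r_u: "r \<notin> u" using r by auto
  have D: "D z = ev \<Omega> r z \<inter> C" for z unfolding D_def C_def ev_Int_evs[OF r_u] ..
  have ur: "insert r u \<in> time_sets" "xu(r := z) \<in> states_at (insert r u)" for z
    using u r states_at_insert by (auto simp: time_sets_def)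
  have domC: "(ev \<Omega> q z, C) \<in> process_domain \<Omega>" if "q = r \<or> q = s" for q z
    unfolding C_def using that u r s by (intro ev_domain) auto
  have domD: "(ev \<Omega> s z, D w) \<in> process_domain \<Omega>" for z w
    unfolding D_def using r s by (intro ev_domain ur) auto
  \<comment> \<open>\<open>None\<close>, \<open>Inl\<close> and \<open>Inr\<close> index these three
    groups of bets.\<close>
  define B :: "('x + 'x) option \<Rightarrow> (real \<Rightarrow> 'x) set" where
    "B i = (case i of Some (Inr z) \<Rightarrow> ev \<Omega> r z | _ \<Rightarrow> ev \<Omega> s y)" for i
  define E :: "('x + 'x) option \<Rightarrow> (real \<Rightarrow> 'x) set" where
    "E i = (case i of Some (Inl z) \<Rightarrow> D z | _ \<Rightarrow> C)" for i
  define l :: "('x + 'x) option \<Rightarrow> real" where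
    "l i = (case i of None \<Rightarrow> 1 | Some (Inl z) \<Rightarrow> - 1 | Some (Inr z) \<Rightarrow> - P (ev \<Omega> s y, D z))" for i
  have split: "(\<Sum>i\<in>UNIV. f i) = f None + ((\<Sum>z\<in>UNIV. f (Some (Inl z))) + (\<Sum>z\<in>UNIV. f (Some (Inr z))))"
    for f :: "('x + 'x) option \<Rightarrow> real"
    by (simp add: UNIV_option_conv sum.reindex UNIV_Plus_UNIV[symmetric] sum.Plus del: UNIV_Plus_UNIV)
  have "P (ev \<Omega> s y, C) - (\<Sum>z\<in>UNIV. P (ev \<Omega> s y, D z) * P (ev \<Omega> r z, C)) = 0"
  proof (rule coherent_sum_const[OF coherent, of UNIV None E B l])
    show "E None \<noteq> {}" using evs_nonempty[OF path_space u] by (simp add: E_def C_def)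
    show "(B i, E i) \<in> process_domain \<Omega>" for i
      by (auto simp: B_def E_def domC domD split: option.split sum.split)
    fix \<omega> assume "\<omega> \<in> (\<Union>i\<in>UNIV. E i)"
    moreover have "E i \<subseteq> C" for i by (auto simp: E_def D split: option.split sum.split)
    ultimately have C: "\<omega> \<in> C" by blast
    then have \<Omega>: "\<omega> \<in> \<Omega>" by (simp add: C_def evs_def)
    have ind_D: "indicator (D z) \<omega> = (indicator (ev \<Omega> r z) \<omega> :: real)" for z
      using C by (simp add: D indicator_def)
    have "(\<Sum>z\<in>UNIV. - 1 * indicator (D z) \<omega> * (P (ev \<Omega> s y, D z) - indicator (ev \<Omega> s y) \<omega>))
        = (\<Sum>z\<in>UNIV. - (P (ev \<Omega> s y, D z) - indicator (ev \<Omega> s y) \<omega>) * indicator (ev \<Omega> r z) \<omega>)"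
      by (intro sum.cong) (simp_all add: ind_D algebra_simps)
    also have "\<dots> = - (P (ev \<Omega> s y, D (\<omega> r)) - indicator (ev \<Omega> s y) \<omega>)"
      by (rule sum_indicator_ev[OF \<Omega>])
    finally have "(\<Sum>z\<in>UNIV. - 1 * indicator (D z) \<omega> * (P (ev \<Omega> s y, D z) - indicator (ev \<Omega> s y) \<omega>))
        = - (P (ev \<Omega> s y, D (\<omega> r)) - indicator (ev \<Omega> s y) \<omega>)" .
    moreover have "(\<Sum>z\<in>UNIV. - P (ev \<Omega> s y, D z) * indicator C \<omega> * (P (ev \<Omega> r z, C) - indicator (ev \<Omega> r z) \<omega>))
        = (\<Sum>z\<in>UNIV. - (P (ev \<Omega> s y, D z) * P (ev \<Omega> r z, C)) + P (ev \<Omega> s y, D z) * indicator (ev \<Omega> r z) \<omega>)"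
      using C by (intro sum.cong) (simp_all add: algebra_simps)
    moreover have "\<dots> = - (\<Sum>z\<in>UNIV. P (ev \<Omega> s y, D z) * P (ev \<Omega> r z, C)) + P (ev \<Omega> s y, D (\<omega> r))"
      by (simp only: sum.distrib sum_negf sum_indicator_ev[OF \<Omega>])
    ultimately show "(\<Sum>i\<in>UNIV. l i * indicator (E i) \<omega> * (P (B i, E i) - indicator (B i) \<omega>))
        = P (ev \<Omega> s y, C) - (\<Sum>z\<in>UNIV. P (ev \<Omega> s y, D z) * P (ev \<Omega> r z, C))"
      using C by (simp add: split l_def E_def B_def)
  qed auto
  then show ?thesis unfolding C_def D_def by (simp add: mult.commute)
qed

lemma trans_mat_evs:
  assumes "u \<in> time_sets_before t"
  shows "trans_mat \<Omega> P u xu t s $ x $ y = P (ev \<Omega> s y, evs \<Omega> (insert t u) (xu(t := x)))"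
  unfolding trans_mat_def by (simp add: ev_Int_evs time_sets_before_notin[OF assms])

context
  fixes u :: "real set" and xu :: "real \<Rightarrow> 'x" and t :: real
  assumes u: "u \<in> time_sets_before t" "xu \<in> states_at u" "0 \<le> t"
begin

lemma insert_in_time_sets: "insert t u \<in> time_sets"
  using u by (auto simp: time_sets_before_def time_sets_def)

lemma trans_mat_nonneg: "t \<le> s \<Longrightarrow> 0 \<le> trans_mat \<Omega> P u xu t s $ x $ y"
  unfolding trans_mat_evs[OF u(1)] using u
  by (intro coherent_nonneg[OF coherent] ev_domain evs_nonempty[OF path_space] insert_in_time_sets states_at_insert)
    (force simp: time_sets_before_def)+

lemma trans_mat_row_sum: "t \<le> s \<Longrightarrow> (\<Sum>y\<in>UNIV. trans_mat \<Omega> P u xu t s $ x $ y) = 1"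
  unfolding trans_mat_evs[OF u(1)] using u
  by (intro prob_sum insert_in_time_sets states_at_insert) (force simp: time_sets_before_def)+

lemma trans_mat_same: "trans_mat \<Omega> P u xu t t = mat 1"
  by (simp add: vec_eq_iff trans_mat_evs[OF u(1)] prob_present insert_in_time_sets states_at_insert u mat_def)

text \<open>Chapman-Kolmogorov without the Markov property: the second factor still conditions on
  the state at \<open>t\<close>.\<close>

lemma trans_mat_tower:
  assumes "t < r" "r \<le> s"
  shows "trans_mat \<Omega> P u xu t s $ x $ y
    = (\<Sum>z\<in>UNIV. trans_mat \<Omega> P u xu t r $ x $ z * trans_mat \<Omega> P (insert t u) (xu(t := x)) r s $ z $ y)"
proof (cases "r = s")
  case True
  have "insert t u \<in> time_sets_before s" using u assms True by (intro insert_time_sets_before) auto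
  then show ?thesis
    using True assms u
    by (simp add: trans_mat_evs[of "insert t u"] prob_present states_at_insert insert_time_sets_before
        if_distrib time_sets_before_def time_sets_def cong: if_cong)
next
  case False
  have before: "insert t u \<in> time_sets_before r" using u assms by (intro insert_time_sets_before) auto
  show ?thesis
    unfolding trans_mat_evs[OF u(1)] trans_mat_evs[OF before]
    using u assms False by (intro prob_tower insert_in_time_sets states_at_insert) (auto simp: time_sets_before_def)
qed

end

end

section \<open>Bounds on expectations\<close>

text \<open>Compactness of \<open>[t, s]\<close> in the form of Bolzano's principle: intervals
  around a point split at that point into a left and a right piece. The admissible lengths may vary
  from point to point.\<close>

lemma interval_chain:
  fixes R :: "real \<Rightarrow> real \<Rightarrow> bool"
  assumes "t \<le> s"
    and refl: "\<And>x. t \<le> x \<Longrightarrow> x \<le> s \<Longrightarrow> R x x"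
    and trans: "\<And>a b c. t \<le> a \<Longrightarrow> a \<le> b \<Longrightarrow> b \<le> c \<Longrightarrow> c \<le> s \<Longrightarrow> R a b \<Longrightarrow> R b c \<Longrightarrow> R a c"
    and right: "\<And>x. t \<le> x \<Longrightarrow> x < s \<Longrightarrow> \<forall>\<^sub>F \<Delta> in at_right 0. R x (x + \<Delta>)"
    and left: "\<And>x. t < x \<Longrightarrow> x \<le> s \<Longrightarrow> \<forall>\<^sub>F \<Delta> in at_right 0. R (x - \<Delta>) x"
  shows "R t s"
proof -
  \<comment> \<open>The guard makes intervals that leave \<open>[t, s]\<close> harmless in the local
    hypothesis.\<close>
  define S where "S a b \<longleftrightarrow> (t \<le> a \<and> a \<le> b \<and> b \<le> s \<longrightarrow> R a b)" for a b
  from \<open>t \<le> s\<close> have "S t s"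
  proof (induction rule: Bolzano)
    case (trans a b c)
    then show ?case unfolding S_def using assms(3)[of a b c] by auto
  next
    case (local x)
    have "\<exists>d>0. \<forall>\<Delta>. 0 < \<Delta> \<longrightarrow> \<Delta> < d \<longrightarrow> x + \<Delta> \<le> s \<longrightarrow> R x (x + \<Delta>)"
    proof (cases "x < s")
      case True
      then show ?thesis using right[of x] local unfolding eventually_at_right_field by auto
    next
      case False
      then show ?thesis by (auto intro!: exI[of _ 1])
    qed
    then obtain d1 where d1: "0 < d1" "\<And>\<Delta>. 0 < \<Delta> \<Longrightarrow> \<Delta> < d1 \<Longrightarrow> x + \<Delta> \<le> s \<Longrightarrow> R x (x + \<Delta>)" by blast
    have "\<exists>d>0. \<forall>\<Delta>. 0 < \<Delta> \<longrightarrow> \<Delta> < d \<longrightarrow> t \<le> x - \<Delta> \<longrightarrow> R (x - \<Delta>) x"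
    proof (cases "t < x")
      case True
      then show ?thesis using left[of x] local unfolding eventually_at_right_field by auto
    next
      case False
      then show ?thesis by (auto intro!: exI[of _ 1])
    qed
    then obtain d2 where d2: "0 < d2" "\<And>\<Delta>. 0 < \<Delta> \<Longrightarrow> \<Delta> < d2 \<Longrightarrow> t \<le> x - \<Delta> \<Longrightarrow> R (x - \<Delta>) x" by blast
    show ?case
    proof (intro exI[of _ "min d1 d2"] conjI allI impI)
      fix a b assume ab: "a \<le> x \<and> x \<le> b \<and> b - a < min d1 d2"
      show "S a b" unfolding S_def
      proof
        assume ts: "t \<le> a \<and> a \<le> b \<and> b \<le> s"
        have "R a x" using d2(2)[of "x - a"] refl[of x] ab ts by (cases "a = x") auto
        moreover have "R x b" using d1(2)[of "b - x"] refl[of x] ab ts by (cases "b = x") auto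
        ultimately show "R a b" using assms(3)[of a x b] ab ts by auto
      qed
    qed (use d1 d2 in auto)
  qed
  then show ?thesis using \<open>t \<le> s\<close> by (simp add: S_def)
qed

lemma tendsto_matrix_vector:
  fixes F :: "'b \<Rightarrow> real^'n^'m"
  assumes "(F \<longlongrightarrow> Q) net" "(v \<longlongrightarrow> w) net"
  shows "((\<lambda>i. F i *v v i) \<longlongrightarrow> Q *v w) net"
  unfolding matrix_vector_mult_def
  by (intro vec_tendstoI) (auto intro!: tendsto_sum tendsto_mult tendsto_vec_nth assms)

text \<open>\<open>outer_derivative\<close> admits only limits that are rate matrices, so this has
  to be known before consistency can place a limit in \<open>\<Q>\<close>.\<close>

lemma stochastic_derivative_rate_matrix:
  fixes B :: "nat \<Rightarrow> real^'x^'x::finite"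
  assumes lim: "(\<lambda>i. (1 / d i) *\<^sub>R (B i - mat 1)) \<longlonglongrightarrow> Q" and d: "\<And>i. 0 < d i"
    and nonneg: "\<And>i x y. 0 \<le> B i $ x $ y" and rows: "\<And>i x. (\<Sum>y\<in>UNIV. B i $ x $ y) = 1"
  shows "Q \<in> rate_matrices"
proof -
  have lim': "(\<lambda>i. ((1 / d i) *\<^sub>R (B i - mat 1)) $ x $ y) \<longlonglongrightarrow> Q $ x $ y" for x y
    by (intro tendsto_vec_nth lim)
  have "(\<Sum>y\<in>UNIV. Q $ x $ y) = 0" for x
  proof -
    have "(\<Sum>y\<in>UNIV. ((1 / d i) *\<^sub>R (B i - mat 1)) $ x $ y) = 0" for i
      by (simp add: mat_def sum_subtractf rows flip: sum_divide_distrib)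
    moreover have "(\<lambda>i. \<Sum>y\<in>UNIV. ((1 / d i) *\<^sub>R (B i - mat 1)) $ x $ y) \<longlonglongrightarrow> (\<Sum>y\<in>UNIV. Q $ x $ y)"
      by (intro tendsto_sum lim')
    ultimately have "(\<lambda>i. 0) \<longlonglongrightarrow> (\<Sum>y\<in>UNIV. Q $ x $ y)" by simp
    then show ?thesis using LIMSEQ_unique tendsto_const by blast
  qed
  moreover have "0 \<le> Q $ x $ y" if "x \<noteq> y" for x y
    by (rule LIMSEQ_le_const[OF lim'[of x y]])
      (use that nonneg d in \<open>auto simp: mat_def less_imp_le\<close>)
  ultimately show ?thesis by (simp add: rate_matrices_def)
qed

context rate_matrix_set
begin

text \<open>Otherwise the bound fails along increments tending to 0; boundedness yields a convergent
  subsequence of quotients, whose limit lies in \<open>\<Q>\<close> but falls below the envelope.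
  The vector \<open>v\<close> may move with the increment, as it does in steps to the right.\<close>

lemma eventually_difference_quotient_ge:
  fixes F :: "real \<Rightarrow> real^'x^'x" and v :: "real \<Rightarrow> real^'x"
  assumes v: "(v \<longlongrightarrow> w) (at_right 0)"
    and bounded: "\<forall>\<^sub>F \<Delta> in at_right 0. norm ((1 / \<Delta>) *\<^sub>R (F \<Delta> - mat 1)) \<le> B"
    and limits: "\<And>d Q. (\<And>i::nat. 0 < d i) \<Longrightarrow> d \<longlonglongrightarrow> 0 \<Longrightarrow>
      (\<lambda>i. (1 / d i) *\<^sub>R (F (d i) - mat 1)) \<longlonglongrightarrow> Q \<Longrightarrow> Q \<in> \<Q>"
    and "0 < \<epsilon>"
  shows "\<forall>\<^sub>F \<Delta> in at_right 0. lower w $ x - \<epsilon> \<le> (((1 / \<Delta>) *\<^sub>R (F \<Delta> - mat 1)) *v v \<Delta>) $ x"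
proof (rule ccontr)
  define G where "G \<Delta> = (1 / \<Delta>) *\<^sub>R (F \<Delta> - mat 1)" for \<Delta>
  assume "\<not> ?thesis"
  then have freq: "\<exists>\<^sub>F \<Delta> in at_right 0. \<not> lower w $ x - \<epsilon> \<le> (G \<Delta> *v v \<Delta>) $ x"
    by (simp add: frequently_def G_def)
  have "\<exists>\<Delta>. 0 < \<Delta> \<and> \<Delta> < 1 / real (Suc n) \<and> norm (G \<Delta>) \<le> B \<and> (G \<Delta> *v v \<Delta>) $ x \<le> lower w $ x - \<epsilon>" for n
  proof -
    have "\<forall>\<^sub>F \<Delta> in at_right 0. (0 < \<Delta> \<and> \<Delta> < 1 / real (Suc n)) \<and> norm (G \<Delta>) \<le> B"
      by (rule eventually_conj[OF eventually_at_right_0_small]) (use bounded in \<open>simp_all add: G_def\<close>)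
    from frequently_eventually_conj[OF freq this] show ?thesis
      by (auto dest!: frequently_ex intro: less_imp_le)
  qed
  then obtain d where d: "\<And>n. 0 < d n" "\<And>n. d n < 1 / real (Suc n)" "\<And>n. norm (G (d n)) \<le> B"
      "\<And>n. (G (d n) *v v (d n)) $ x \<le> lower w $ x - \<epsilon>" by metis
  have d0: "d \<longlonglongrightarrow> 0"
    by (rule tendsto_sandwich[OF _ _ tendsto_const LIMSEQ_Suc[OF lim_1_over_n]])
      (intro always_eventually allI less_imp_le d)+
  have "bounded (range (\<lambda>n. G (d n)))" using d(3) by (auto simp: bounded_iff)
  then obtain Q r where r: "strict_mono r" and Q: "((\<lambda>n. G (d n)) \<circ> r) \<longlonglongrightarrow> Q"
    using bounded_imp_convergent_subsequence by blast
  have dr: "(\<lambda>i. d (r i)) \<longlonglongrightarrow> 0" using LIMSEQ_subseq_LIMSEQ[OF d0 r] by (simp add: o_def)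
  have lim: "(\<lambda>i. G (d (r i))) \<longlonglongrightarrow> Q" using Q by (simp add: o_def)
  have "Q \<in> \<Q>" by (rule limits[of "\<lambda>i. d (r i)"]) (use d dr lim in \<open>simp_all add: G_def\<close>)
  have "(\<lambda>i. v (d (r i))) \<longlonglongrightarrow> w"
    by (rule filterlim_compose[OF v]) (use dr d less_imp_neq[OF d(1)] in \<open>auto simp: filterlim_at\<close>)
  then have "(\<lambda>i. (G (d (r i)) *v v (d (r i))) $ x) \<longlonglongrightarrow> (Q *v w) $ x"
    by (intro tendsto_vec_nth tendsto_matrix_vector lim)
  then have "(Q *v w) $ x \<le> lower w $ x - \<epsilon>"
    by (rule LIMSEQ_le_const2) (use d(4) in auto)
  then show False using lower_le[OF \<open>Q \<in> \<Q>\<close>, of w x] \<open>0 < \<epsilon>\<close> by simp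
qed

abbreviation V where "V \<equiv> flow lower"

lemma V_right: "0 \<le> \<tau> \<Longrightarrow> ((\<lambda>\<Delta>. (1 / \<Delta>) *\<^sub>R (V (\<tau> + \<Delta>) f - V \<tau> f)) \<longlongrightarrow> lower (V \<tau> f)) (at_right 0)"
  using solves_right_quotient[OF flow_solves] by simp

lemma V_left: "0 < \<tau> \<Longrightarrow> ((\<lambda>\<Delta>. (1 / \<Delta>) *\<^sub>R (V \<tau> f - V (\<tau> - \<Delta>) f)) \<longlongrightarrow> lower (V \<tau> f)) (at_right 0)"
  using solves_left_quotient[OF flow_solves] by simp

lemma V_left_continuous:
  assumes "0 < \<tau>"
  shows "((\<lambda>\<Delta>. V (\<tau> - \<Delta>) f) \<longlongrightarrow> V \<tau> f) (at_right 0)"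
proof -
  have "((\<lambda>\<Delta>. V \<tau> f - \<Delta> *\<^sub>R ((1 / \<Delta>) *\<^sub>R (V \<tau> f - V (\<tau> - \<Delta>) f))) \<longlongrightarrow> V \<tau> f - 0 *\<^sub>R lower (V \<tau> f)) (at_right 0)"
    by (intro tendsto_intros V_left assms)
  moreover have "\<forall>\<^sub>F \<Delta> in at_right 0. V \<tau> f - \<Delta> *\<^sub>R ((1 / \<Delta>) *\<^sub>R (V \<tau> f - V (\<tau> - \<Delta>) f)) = V (\<tau> - \<Delta>) f"
    using eventually_at_right_less[of "0::real"] by eventually_elim simp
  ultimately have "((\<lambda>\<Delta>. V (\<tau> - \<Delta>) f) \<longlongrightarrow> V \<tau> f - 0 *\<^sub>R lower (V \<tau> f)) (at_right 0)"
    by (rule Lim_transform_eventually)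
  then show ?thesis by simp
qed

text \<open>\<open>v\<close> and \<open>v'\<close> are the values at the right and left end of a
  short interval. Steps to the right fix \<open>v'\<close>, steps to the left fix \<open>v\<close>,
  and both are covered. The error is shared equally between the quotient of \<open>F\<close> and
  that of the values.\<close>

lemma step_lower_bound:
  fixes F :: "real \<Rightarrow> real^'x^'x"
  assumes bounded: "\<forall>\<^sub>F \<Delta> in at_right 0. norm ((1 / \<Delta>) *\<^sub>R (F \<Delta> - mat 1)) \<le> B"
    and limits: "\<And>d Q. (\<And>i::nat. 0 < d i) \<Longrightarrow> d \<longlonglongrightarrow> 0 \<Longrightarrow>
      (\<lambda>i. (1 / d i) *\<^sub>R (F (d i) - mat 1)) \<longlonglongrightarrow> Q \<Longrightarrow> Q \<in> \<Q>"
    and \<epsilon>: "0 < \<epsilon>"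
    and v: "(v \<longlongrightarrow> w) (at_right 0)"
    and v': "((\<lambda>\<Delta>. (1 / \<Delta>) *\<^sub>R (v' \<Delta> - v \<Delta>)) \<longlongrightarrow> lower w) (at_right 0)"
  shows "\<forall>\<^sub>F \<Delta> in at_right 0. \<forall>x. v' \<Delta> $ x - \<epsilon> * \<Delta> \<le> (F \<Delta> *v v \<Delta>) $ x"
proof (rule eventually_all_finite)
  fix x
  have "\<forall>\<^sub>F \<Delta> in at_right 0. lower w $ x - \<epsilon> / 2 \<le> (((1 / \<Delta>) *\<^sub>R (F \<Delta> - mat 1)) *v v \<Delta>) $ x"
    by (rule eventually_difference_quotient_ge[OF v bounded limits]) (use \<epsilon> in auto)
  moreover have "\<forall>\<^sub>F \<Delta> in at_right 0. ((1 / \<Delta>) *\<^sub>R (v' \<Delta> - v \<Delta>)) $ x < lower w $ x + \<epsilon> / 2"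
    by (rule order_tendstoD(2)[OF tendsto_vec_nth[OF v']]) (use \<epsilon> in simp)
  ultimately show "\<forall>\<^sub>F \<Delta> in at_right 0. v' \<Delta> $ x - \<epsilon> * \<Delta> \<le> (F \<Delta> *v v \<Delta>) $ x"
    using eventually_at_right_less[of "0::real"]
  proof eventually_elim
    case (elim \<Delta>)
    have "(((1 / \<Delta>) *\<^sub>R (F \<Delta> - mat 1)) *v v \<Delta>) $ x = ((F \<Delta> *v v \<Delta>) $ x - v \<Delta> $ x) / \<Delta>"
      by (simp add: scaleR_matrix_vector_assoc[symmetric] matrix_vector_mult_diff_rdistrib)
    with elim have "(v' \<Delta> $ x - v \<Delta> $ x) / \<Delta> - \<epsilon> \<le> ((F \<Delta> *v v \<Delta>) $ x - v \<Delta> $ x) / \<Delta>" by simp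
    then have "(v' \<Delta> $ x - v \<Delta> $ x - \<epsilon> * \<Delta>) / \<Delta> \<le> ((F \<Delta> *v v \<Delta>) $ x - v \<Delta> $ x) / \<Delta>"
      using elim(3) by (simp add: diff_divide_distrib)
    then show ?case using elim(3) by (simp add: divide_le_cancel)
  qed
qed

lemma step_upper_bound:
  fixes F :: "real \<Rightarrow> real^'x^'x"
  assumes F: "((\<lambda>\<Delta>. (1 / \<Delta>) *\<^sub>R (F \<Delta> - mat 1)) \<longlongrightarrow> Q) (at_right 0)"
    and Q: "\<And>x. (Q *v w) $ x < lower w $ x + \<epsilon>"
    and v: "(v \<longlongrightarrow> w) (at_right 0)"
    and v': "((\<lambda>\<Delta>. (1 / \<Delta>) *\<^sub>R (v' \<Delta> - v \<Delta>)) \<longlongrightarrow> lower w) (at_right 0)"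
  shows "\<forall>\<^sub>F \<Delta> in at_right 0. \<forall>x. (F \<Delta> *v v \<Delta>) $ x \<le> v' \<Delta> $ x + \<epsilon> * \<Delta>"
proof (rule eventually_all_finite)
  fix x
  have "((\<lambda>\<Delta>. (((1 / \<Delta>) *\<^sub>R (F \<Delta> - mat 1)) *v v \<Delta>) $ x - ((1 / \<Delta>) *\<^sub>R (v' \<Delta> - v \<Delta>)) $ x)
      \<longlongrightarrow> (Q *v w) $ x - lower w $ x) (at_right 0)"
    by (intro tendsto_diff tendsto_vec_nth tendsto_matrix_vector F v v')
  moreover have "(Q *v w) $ x - lower w $ x < \<epsilon>" using Q[of x] by simp
  ultimately have "\<forall>\<^sub>F \<Delta> in at_right 0. (((1 / \<Delta>) *\<^sub>R (F \<Delta> - mat 1)) *v v \<Delta>) $ x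
      - ((1 / \<Delta>) *\<^sub>R (v' \<Delta> - v \<Delta>)) $ x < \<epsilon>" by (rule order_tendstoD(2))
  then show "\<forall>\<^sub>F \<Delta> in at_right 0. (F \<Delta> *v v \<Delta>) $ x \<le> v' \<Delta> $ x + \<epsilon> * \<Delta>"
    using eventually_at_right_less[of "0::real"]
  proof eventually_elim
    case (elim \<Delta>)
    have "(((1 / \<Delta>) *\<^sub>R (F \<Delta> - mat 1)) *v v \<Delta>) $ x = ((F \<Delta> *v v \<Delta>) $ x - v \<Delta> $ x) / \<Delta>"
      by (simp add: scaleR_matrix_vector_assoc[symmetric] matrix_vector_mult_diff_rdistrib)
    with elim have "((F \<Delta> *v v \<Delta>) $ x - v \<Delta> $ x) / \<Delta> - (v' \<Delta> $ x - v \<Delta> $ x) / \<Delta> < \<epsilon>" by simp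
    then have "((F \<Delta> *v v \<Delta>) $ x - v \<Delta> $ x) / \<Delta> \<le> (v' \<Delta> $ x - v \<Delta> $ x + \<epsilon> * \<Delta>) / \<Delta>"
      using elim(2) by (simp add: diff_divide_distrib add_divide_distrib)
    then show ?case using elim(2) by (simp add: divide_le_cancel)
  qed
qed

lemma process_lower_bound:
  assumes path_space: "path_space \<Omega>" and P: "P \<in> processes_W \<Omega> \<Q> \<M>"
    and t: "0 \<le> t" "t \<le> s" and u: "u \<in> time_sets_before t" "xu \<in> states_at u"
  shows "V (s - t) f $ x \<le> cond_expectation \<Omega> P f s t x u xu"
proof -
  interpret coherent_process \<Omega> P
    using P path_space by unfold_locales (auto simp: processes_W_def stochastic_process_def)
  note P' = P[unfolded processes_W_def, simplified]
  have bounded: "\<exists>B. \<forall>\<^sub>F \<Delta> in at_right 0. norm ((1 / \<Delta>) *\<^sub>R (F \<Delta> - mat 1)) \<le> B"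
    if finite: "Limsup (at_right 0) (\<lambda>\<Delta>. ereal (1 / \<Delta> * matnorm (F \<Delta> - mat 1))) < \<infinity>" for F :: "real \<Rightarrow> real^'x^'x"
  proof -
    obtain B where B: "Limsup (at_right 0) (\<lambda>\<Delta>. ereal (1 / \<Delta> * matnorm (F \<Delta> - mat 1))) < ereal B"
      using ereal_dense2[OF finite] by blast
    have "\<forall>\<^sub>F \<Delta> in at_right 0. ereal (1 / \<Delta> * matnorm (F \<Delta> - mat 1)) < ereal B"
      using Limsup_lessD[OF B] .
    then have "\<forall>\<^sub>F \<Delta> in at_right 0. norm ((1 / \<Delta>) *\<^sub>R (F \<Delta> - mat 1)) \<le> (\<Sum>x\<in>(UNIV :: 'x set). \<Sum>y\<in>(UNIV :: 'x set). B)"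
      using eventually_at_right_less[of "0::real"]
    proof eventually_elim
      case (elim \<Delta>)
      define R where "R = (1 / \<Delta>) *\<^sub>R (F \<Delta> - mat 1)"
      have "norm R \<le> (\<Sum>x\<in>UNIV. norm (R $ x))" by (simp add: norm_vec_def L2_set_le_sum)
      also have "\<dots> \<le> (\<Sum>x\<in>UNIV. \<Sum>y\<in>UNIV. \<bar>R $ x $ y\<bar>)" by (intro sum_mono norm_le_l1_cart)
      also have "\<dots> \<le> (\<Sum>x\<in>(UNIV :: 'x set). \<Sum>y\<in>(UNIV :: 'x set). B)"
      proof (intro sum_mono)
        fix x y
        have "\<bar>R $ x $ y\<bar> = 1 / \<Delta> * \<bar>(F \<Delta> - mat 1) $ x $ y\<bar>" using elim by (simp add: R_def abs_mult)
        also have "\<dots> \<le> 1 / \<Delta> * matnorm (F \<Delta> - mat 1)"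
          using elim by (intro mult_left_mono abs_entry_le_matnorm) auto
        also have "\<dots> \<le> B" using elim by simp
        finally show "\<bar>R $ x $ y\<bar> \<le> B" .
      qed
      finally show ?case by (simp add: R_def)
    qed
    then show ?thesis by blast
  qed
  have right: "\<forall>\<^sub>F \<Delta> in at_right 0. \<forall>z. v' \<Delta> $ z - \<epsilon> * \<Delta> \<le> (trans_mat \<Omega> P w xw r (r + \<Delta>) *v v \<Delta>) $ z"
    if w: "w \<in> time_sets_before r" "xw \<in> states_at w" "0 \<le> r" and "0 < \<epsilon>" "(v \<longlongrightarrow> w') (at_right 0)"
      "((\<lambda>\<Delta>. (1 / \<Delta>) *\<^sub>R (v' \<Delta> - v \<Delta>)) \<longlongrightarrow> lower w') (at_right 0)" for w xw r \<epsilon> v v' w'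
  proof -
    have "Limsup (at_right 0) (\<lambda>\<Delta>. ereal (1 / \<Delta> * matnorm (trans_mat \<Omega> P w xw r (r + \<Delta>) - mat 1))) < \<infinity>"
      using P' w by (simp add: well_behaved_def)
    then obtain B where "\<forall>\<^sub>F \<Delta> in at_right 0. norm ((1 / \<Delta>) *\<^sub>R (trans_mat \<Omega> P w xw r (r + \<Delta>) - mat 1)) \<le> B"
      using bounded[of "\<lambda>\<Delta>. trans_mat \<Omega> P w xw r (r + \<Delta>)"] by blast
    then show ?thesis
    proof (rule step_lower_bound[OF _ _ that(4-6)])
      fix d :: "nat \<Rightarrow> real" and Q
      assume d: "\<And>i. 0 < d i" "d \<longlonglongrightarrow> 0" and Q: "(\<lambda>i. (1 / d i) *\<^sub>R (trans_mat \<Omega> P w xw r (r + d i) - mat 1)) \<longlonglongrightarrow> Q"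
      have "Q \<in> rate_matrices"
        by (rule stochastic_derivative_rate_matrix[OF Q d(1)])
          (use less_imp_le[OF d(1)] in \<open>auto intro!: trans_mat_nonneg[OF w] trans_mat_row_sum[OF w]\<close>)
      then have "Q \<in> outer_derivative \<Omega> P w xw r"
        using d Q by (auto simp: outer_derivative_def)
      then show "Q \<in> \<Q>" using P' w by (auto simp: consistent_rates_def)
    qed
  qed
  have left: "\<forall>\<^sub>F \<Delta> in at_right 0. \<forall>z. v' \<Delta> $ z - \<epsilon> * \<Delta> \<le> (trans_mat \<Omega> P w xw (r - \<Delta>) r *v v \<Delta>) $ z"
    if w: "w \<in> time_sets_before q" "xw \<in> states_at w" "0 \<le> q" "q < r" and "0 < \<epsilon>" "(v \<longlongrightarrow> w') (at_right 0)"
      "((\<lambda>\<Delta>. (1 / \<Delta>) *\<^sub>R (v' \<Delta> - v \<Delta>)) \<longlongrightarrow> lower w') (at_right 0)" for w xw q r \<epsilon> v v' w'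
  proof -
    have wr: "w \<in> time_sets_before r'" if "q \<le> r'" for r' using w that by (force simp: time_sets_before_def)
    have "Limsup (at_right 0) (\<lambda>\<Delta>. ereal (1 / \<Delta> * matnorm (trans_mat \<Omega> P w xw (r - \<Delta>) r - mat 1))) < \<infinity>"
      using P' w wr[of r] by (simp add: well_behaved_def)
    then obtain B where "\<forall>\<^sub>F \<Delta> in at_right 0. norm ((1 / \<Delta>) *\<^sub>R (trans_mat \<Omega> P w xw (r - \<Delta>) r - mat 1)) \<le> B"
      using bounded[of "\<lambda>\<Delta>. trans_mat \<Omega> P w xw (r - \<Delta>) r"] by blast
    then show ?thesis
    proof (rule step_lower_bound[OF _ _ that(5-7)])
      fix d :: "nat \<Rightarrow> real" and Q
      assume d: "\<And>i. 0 < d i" "d \<longlonglongrightarrow> 0" and Q: "(\<lambda>i. (1 / d i) *\<^sub>R (trans_mat \<Omega> P w xw (r - d i) r - mat 1)) \<longlonglongrightarrow> Q"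
      \<comment> \<open>Early increments may reach back into the history, where the transition
        matrix has no meaning; the sequence is cut off before the limit is examined.\<close>
      have "\<forall>\<^sub>F i in sequentially. d i < r - q"
        by (rule order_tendstoD(2)[OF d(2)]) (use w in simp)
      then obtain N where N: "\<And>i. N \<le> i \<Longrightarrow> d i < r - q" by (auto simp: eventually_sequentially)
      have Q': "(\<lambda>i. (1 / d (i + N)) *\<^sub>R (trans_mat \<Omega> P w xw (r - d (i + N)) r - mat 1)) \<longlonglongrightarrow> Q"
        using LIMSEQ_ignore_initial_segment[OF Q, of N] .
      have "Q \<in> rate_matrices"
      proof (rule stochastic_derivative_rate_matrix[OF Q' d(1)])
        fix i x y
        have *: "w \<in> time_sets_before (r - d (i + N))" "xw \<in> states_at w" "0 \<le> r - d (i + N)" "r - d (i + N) \<le> r"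
          using N[of "i + N"] d(1)[of "i + N"] w by (auto intro!: wr)
        show "0 \<le> trans_mat \<Omega> P w xw (r - d (i + N)) r $ x $ y" by (rule trans_mat_nonneg[OF *])
        show "(\<Sum>y\<in>UNIV. trans_mat \<Omega> P w xw (r - d (i + N)) r $ x $ y) = 1" by (rule trans_mat_row_sum[OF *])
      qed
      then have "Q \<in> outer_derivative \<Omega> P w xw r"
        using d Q w by (auto simp: outer_derivative_def)
      moreover have "outer_derivative \<Omega> P w xw r \<subseteq> \<Q>"
        using P' w wr[of r] by (simp add: consistent_rates_def)
      ultimately show "Q \<in> \<Q>" by blast
    qed
  qed
  define D where "D r z = trans_mat \<Omega> P u xu t r $ x $ z" for r z
  define \<phi> where "\<phi> r = (\<Sum>z\<in>UNIV. D r z * V (s - r) f $ z)" for r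
  \<comment> \<open>For times after \<open>t\<close>, the given state at \<open>t\<close> has become
    part of the history.\<close>
  define u' where "u' = insert t u"
  define xu' where "xu' = xu(t := x)"
  have u': "u' \<in> time_sets_before r" "xu' \<in> states_at u'" if "t < r" for r
    using insert_time_sets_before[OF u(1) t(1) that] states_at_insert[OF u(2)] by (auto simp: u'_def xu'_def)
  have tower: "\<phi> r' = (\<Sum>z\<in>UNIV. D r z * (trans_mat \<Omega> P u' xu' r r' *v V (s - r') f) $ z)"
    if "t < r" "r \<le> r'" for r r'
  proof -
    have "\<phi> r' = (\<Sum>y\<in>UNIV. \<Sum>z\<in>UNIV. D r z * (trans_mat \<Omega> P u' xu' r r' $ z $ y * V (s - r') f $ y))"
      unfolding \<phi>_def D_def u'_def xu'_def trans_mat_tower[OF u t(1) that]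
      by (simp add: sum_distrib_right mult.assoc)
    also have "\<dots> = (\<Sum>z\<in>UNIV. D r z * (trans_mat \<Omega> P u' xu' r r' *v V (s - r') f) $ z)"
      by (subst sum.swap) (simp add: matrix_vector_mult_def sum_distrib_left)
    finally show ?thesis .
  qed
  have step: "\<phi> r - \<epsilon> * \<Delta> \<le> \<phi> r'"
    if "t < r" "r \<le> r'" and le: "\<forall>z. V (s - r) f $ z - \<epsilon> * \<Delta> \<le> (trans_mat \<Omega> P u' xu' r r' *v V (s - r') f) $ z"
    for r r' \<epsilon> \<Delta>
  proof -
    have "\<phi> r - \<epsilon> * \<Delta> = (\<Sum>z\<in>UNIV. D r z * (V (s - r) f $ z - \<epsilon> * \<Delta>))"
      using trans_mat_row_sum[OF u t(1), of r x] that
      by (simp add: \<phi>_def D_def right_diff_distrib sum_subtractf flip: sum_distrib_right)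
    also have "\<dots> \<le> \<phi> r'"
      unfolding tower[OF that(1,2)] D_def using le that
      by (intro sum_mono mult_left_mono trans_mat_nonneg[OF u t(1)]) auto
    finally show ?thesis .
  qed
  have start: "\<phi> t = V (s - t) f $ x"
    by (simp add: \<phi>_def D_def trans_mat_same[OF u t(1)] mat_def if_distrib[of "\<lambda>c. c * _"] cong: if_cong)
  have "\<phi> s = cond_expectation \<Omega> P f s t x u xu"
    by (simp add: \<phi>_def D_def flow_0 cond_expectation_def trans_mat_def mult.commute)
  moreover note start
  moreover have "\<phi> t \<le> \<phi> s + e" if e: "0 < e" for e
  proof -
    \<comment> \<open>The accumulated loss \<open>\<epsilon> * (s - t)\<close> stays below
      \<open>e\<close>; adding 1 covers \<open>t = s\<close>.\<close>
    define \<epsilon> where "\<epsilon> = e / (s - t + 1)"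
    have \<epsilon>: "0 < \<epsilon>" using e t by (simp add: \<epsilon>_def)
    have "\<phi> t - \<epsilon> * (s - t) \<le> \<phi> s"
      using t(2)
    proof (rule interval_chain[where R = "\<lambda>a b. \<phi> a - \<epsilon> * (b - a) \<le> \<phi> b"])
      show "\<phi> a - \<epsilon> * (c - a) \<le> \<phi> c"
        if "\<phi> a - \<epsilon> * (b - a) \<le> \<phi> b" "\<phi> b - \<epsilon> * (c - b) \<le> \<phi> c" for a b c
        using that by (simp add: algebra_simps)
    next
      fix r assume r: "t \<le> r" "r < s"
      have quot: "((\<lambda>\<Delta>. V (s - r - \<Delta>) f) \<longlongrightarrow> V (s - r) f) (at_right 0)"
        "((\<lambda>\<Delta>. (1 / \<Delta>) *\<^sub>R (V (s - r) f - V (s - r - \<Delta>) f)) \<longlongrightarrow> lower (V (s - r) f)) (at_right 0)"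
        using r by (intro V_left_continuous V_left; simp)+
      show "\<forall>\<^sub>F \<Delta> in at_right 0. \<phi> r - \<epsilon> * (r + \<Delta> - r) \<le> \<phi> (r + \<Delta>)"
      \<comment> \<open>At \<open>r = t\<close> the state \<open>x\<close> is still the current one,
        so the transition matrix for the original history is used instead of
        \<open>step\<close>.\<close>
      proof (cases "r = t")
        case True
        from right[OF u t(1) \<epsilon> quot[unfolded True]] show ?thesis
        proof eventually_elim
          case (elim \<Delta>)
          then show ?case
            unfolding True start
            by (simp add: \<phi>_def D_def matrix_vector_mult_def algebra_simps)
        qed
      next
        case False
        with r t have tr: "t < r" "0 \<le> r" by auto
        from right[OF u'[OF tr(1)] tr(2) \<epsilon> quot] eventually_at_right_less[of "0::real"] show ?thesis
        proof eventually_elim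
          case (elim \<Delta>)
          then show ?case using step[of r "r + \<Delta>" \<epsilon> \<Delta>] tr by (simp add: algebra_simps)
        qed
      qed
    next
      fix r assume r: "t < r" "r \<le> s"
      \<comment> \<open>Any time strictly between \<open>t\<close> and \<open>r\<close> would serve:
        it separates the history \<open>u'\<close> from the left neighbourhood of
        \<open>r\<close>.\<close>
      define q where "q = (t + r) / 2"
      have q: "t < q" "q < r" "0 \<le> q" using r t by (auto simp: q_def)
      have rt: "0 < r - t" using r by simp
      have quot: "((\<lambda>\<Delta>. (1 / \<Delta>) *\<^sub>R (V (s - r + \<Delta>) f - V (s - r) f)) \<longlongrightarrow> lower (V (s - r) f)) (at_right 0)"
        using r by (intro V_right) simp
      from left[OF u'[OF q(1)] q(3,2) \<epsilon> tendsto_const quot] eventually_at_right_0_small[OF rt]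
      show "\<forall>\<^sub>F \<Delta> in at_right 0. \<phi> (r - \<Delta>) - \<epsilon> * (r - (r - \<Delta>)) \<le> \<phi> r"
      proof eventually_elim
        case (elim \<Delta>)
        then show ?case using step[of "r - \<Delta>" r \<epsilon> \<Delta>] by (simp add: algebra_simps)
      qed
    qed simp
    moreover have "\<epsilon> * (s - t) \<le> e" using e t by (simp add: \<epsilon>_def field_simps)
    ultimately show ?thesis by simp
  qed
  ultimately show ?thesis using field_le_epsilon[of "\<phi> t" "\<phi> s"] by simp
qed

end

section \<open>Near-optimal Markov chains\<close>

context rate_matrix_set
begin

text \<open>Near-minimisers are chosen separately for each state and glued row by row; separately
  specified rows keep the result in \<open>\<Q>\<close>. The slack is there because infima need not
  be attained.\<close>

lemma near_optimal_rate_matrix: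
  assumes rows: "separately_specified_rows \<Q>" and \<epsilon>: "0 < \<epsilon>"
  shows "\<exists>Q\<in>\<Q>. \<forall>x. (Q *v w) $ x < lower w $ x + \<epsilon>"
proof -
  have "\<exists>R\<in>\<Q>. (R *v w) $ x < lower w $ x + \<epsilon>" for x
  proof (rule ccontr)
    assume "\<not> ?thesis"
    then have "lower w $ x + \<epsilon> \<le> lower w $ x"
      by (intro lower_envelope_ge[OF nonempty]) (auto simp: not_less)
    then show False using \<epsilon> by simp
  qed
  then obtain R where R: "\<And>x. R x \<in> \<Q>" "\<And>x. (R x *v w) $ x < lower w $ x + \<epsilon>" by metis
  define Q where "Q = (\<chi> x. R x $ x)"
  have "R x \<in> rate_matrices" for x using R(1) rates by blast
  then have "Q \<in> rate_matrices" by (simp add: rate_matrices_def Q_def)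
  then have "Q \<in> {Q \<in> rate_matrices. \<forall>x. Q $ x \<in> (\<lambda>R. R $ x) ` \<Q>}"
    using R(1) by (auto simp: Q_def)
  then have "Q \<in> \<Q>" using rows unfolding separately_specified_rows_def by blast
  moreover have "(Q *v w) $ x = (R x *v w) $ x" for x
    by (simp add: Q_def matrix_vector_mult_def)
  ultimately show ?thesis using R(2) by (intro bexI[of _ Q]) simp_all
qed

text \<open>The relation between endpoints asserts only that some family exists, so each short
  interval may use its own homogeneous one. Transitivity concatenates the families, and the errors
  add because stochastic matrices preserve constants.\<close>

lemma transition_family_upper_bound:
  assumes rows: "separately_specified_rows \<Q>" and \<epsilon>: "0 < \<epsilon>" and "t \<le> s"
  obtains T where "transition_family \<Q> T" "\<And>x. (T t s *v f) $ x \<le> V (s - t) f $ x + \<epsilon> * (s - t)"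
proof -
  define R where "R a b \<longleftrightarrow> (\<exists>T. transition_family \<Q> T \<and>
      (\<forall>x. (T a b *v V (s - b) f) $ x \<le> V (s - a) f $ x + \<epsilon> * (b - a)))" for a b
  have "R t s" using \<open>t \<le> s\<close>
  proof (rule interval_chain)
    fix x
    obtain Q where "Q \<in> \<Q>" using nonempty by blast
    then obtain T where "transition_family \<Q> T"
      using transition_family_homogeneous[OF subsetD[OF rates], of Q \<Q>] by auto
    then show "R x x" unfolding R_def by (auto simp: transition_family_same intro!: exI[of _ T])
  next
    fix a b c assume abc: "a \<le> b" "b \<le> c" and "R a b" "R b c"
    then obtain T1 T2 where T: "transition_family \<Q> T1" "transition_family \<Q> T2"
      and T1: "\<And>x. (T1 a b *v V (s - b) f) $ x \<le> V (s - a) f $ x + \<epsilon> * (b - a)"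
      and T2: "\<And>x. (T2 b c *v V (s - c) f) $ x \<le> V (s - b) f $ x + \<epsilon> * (c - b)"
      by (auto simp: R_def)
    define T where "T r s = (if s \<le> b then T1 r s else if b \<le> r then T2 r s else T1 r b ** T2 b s)" for r s
    have fam: "transition_family \<Q> T"
      unfolding T_def[abs_def] by (rule transition_family_concat[OF T])
    have "T a c = T1 a b ** T2 b c"
      using transition_family_chapman[OF fam abc] abc transition_family_same[OF T(1)] transition_family_same[OF T(2)]
      by (cases "b = c") (auto simp: T_def)
    moreover have "((T1 a b ** T2 b c) *v V (s - c) f) $ x \<le> V (s - a) f $ x + \<epsilon> * (c - a)" for x
    proof -
      have "((T1 a b ** T2 b c) *v V (s - c) f) $ x = (\<Sum>y\<in>UNIV. T1 a b $ x $ y * (T2 b c *v V (s - c) f) $ y)"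
        by (simp add: matrix_vector_mul_assoc[symmetric] matrix_vector_mult_def[of "T1 a b"])
      also have "\<dots> \<le> (\<Sum>y\<in>UNIV. T1 a b $ x $ y * (V (s - b) f $ y + \<epsilon> * (c - b)))"
        using abc by (intro sum_mono mult_left_mono T2 transition_family_nonneg[OF T(1)])
      also have "\<dots> = (T1 a b *v V (s - b) f) $ x + \<epsilon> * (c - b)"
        using transition_family_row_sum[OF T(1) abc(1), of x]
        by (simp add: distrib_left sum.distrib matrix_vector_mult_def flip: sum_distrib_right)
      also have "\<dots> \<le> V (s - a) f $ x + \<epsilon> * (c - a)" using T1[of x] by (simp add: algebra_simps)
      finally show ?thesis .
    qed
    ultimately show "R a c" unfolding R_def using fam by (intro exI[of _ T]) simp
  next
    fix r assume r: "t \<le> r" "r < s"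
    obtain Q where Q: "Q \<in> \<Q>" "\<forall>x. (Q *v V (s - r) f) $ x < lower (V (s - r) f) $ x + \<epsilon>"
      using near_optimal_rate_matrix[OF rows \<epsilon>] by (rule bexE)
    obtain T where T: "transition_family \<Q> T"
      "\<And>t. ((\<lambda>\<Delta>. (1 / \<Delta>) *\<^sub>R (T t (t + \<Delta>) - mat 1)) \<longlongrightarrow> Q) (at_right 0)"
      using transition_family_homogeneous[OF subsetD[OF rates Q(1)] Q(1)] by auto
    have "\<forall>\<^sub>F \<Delta> in at_right 0. \<forall>x. (T r (r + \<Delta>) *v V (s - r - \<Delta>) f) $ x \<le> V (s - r) f $ x + \<epsilon> * \<Delta>"
      by (rule step_upper_bound[OF T(2) Q(2)[rule_format]]) (use r in \<open>intro V_left_continuous V_left; simp\<close>)+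
    then show "\<forall>\<^sub>F \<Delta> in at_right 0. R r (r + \<Delta>)"
    proof eventually_elim
      case (elim \<Delta>)
      then show ?case unfolding R_def using T(1) by (intro exI[of _ T]) (simp add: algebra_simps)
    qed
  next
    fix r assume r: "t < r" "r \<le> s"
    obtain Q where Q: "Q \<in> \<Q>" "\<forall>x. (Q *v V (s - r) f) $ x < lower (V (s - r) f) $ x + \<epsilon>"
      using near_optimal_rate_matrix[OF rows \<epsilon>] by (rule bexE)
    obtain T where T: "transition_family \<Q> T"
      "\<And>t. ((\<lambda>\<Delta>. (1 / \<Delta>) *\<^sub>R (T (t - \<Delta>) t - mat 1)) \<longlongrightarrow> Q) (at_right 0)"
      using transition_family_homogeneous[OF subsetD[OF rates Q(1)] Q(1)] by auto
    have "\<forall>\<^sub>F \<Delta> in at_right 0. \<forall>x. (T (r - \<Delta>) r *v V (s - r) f) $ x \<le> V (s - r + \<Delta>) f $ x + \<epsilon> * \<Delta>"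
      by (rule step_upper_bound[OF T(2) Q(2)[rule_format] tendsto_const]) (use r in \<open>intro V_right; simp\<close>)
    then show "\<forall>\<^sub>F \<Delta> in at_right 0. R (r - \<Delta>) r"
    proof eventually_elim
      case (elim \<Delta>)
      then show ?case unfolding R_def using T(1) by (intro exI[of _ T]) (simp add: algebra_simps)
    qed
  qed
  then show ?thesis using that flow_0 by (auto simp: R_def)
qed

end

lemma Limsup_matnorm_quotient_finite:
  fixes F :: "real \<Rightarrow> real^'x^'x::finite"
  assumes "((\<lambda>\<Delta>. (1 / \<Delta>) *\<^sub>R (F \<Delta> - mat 1)) \<longlongrightarrow> Q) (at_right 0)"
  shows "Limsup (at_right 0) (\<lambda>\<Delta>. ereal (1 / \<Delta> * matnorm (F \<Delta> - mat 1))) < \<infinity>"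
proof -
  define S where "S B = (\<Sum>x\<in>UNIV. \<Sum>y\<in>UNIV. \<bar>B $ x $ y\<bar>)" for B :: "real^'x^'x"
  have "((\<lambda>\<Delta>. S ((1 / \<Delta>) *\<^sub>R (F \<Delta> - mat 1))) \<longlongrightarrow> S Q) (at_right 0)"
    unfolding S_def by (intro tendsto_intros assms)
  then have "\<forall>\<^sub>F \<Delta> in at_right 0. S ((1 / \<Delta>) *\<^sub>R (F \<Delta> - mat 1)) < S Q + 1"
    by (rule order_tendstoD) simp
  then have "\<forall>\<^sub>F \<Delta> in at_right 0. ereal (1 / \<Delta> * matnorm (F \<Delta> - mat 1)) \<le> ereal (S Q + 1)"
    using eventually_at_right_less[of "0::real"]
  proof eventually_elim
    case (elim \<Delta>)
    have "1 / \<Delta> * matnorm (F \<Delta> - mat 1) \<le> 1 / \<Delta> * S (F \<Delta> - mat 1)"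
      unfolding S_def using elim by (intro mult_left_mono matnorm_le) auto
    also have "\<dots> = S ((1 / \<Delta>) *\<^sub>R (F \<Delta> - mat 1))"
      using elim by (simp add: S_def sum_distrib_left abs_mult)
    finally show ?case using elim by simp
  qed
  then have "Limsup (at_right 0) (\<lambda>\<Delta>. ereal (1 / \<Delta> * matnorm (F \<Delta> - mat 1))) \<le> ereal (S Q + 1)"
    by (rule Limsup_bounded)
  then show ?thesis by (rule le_less_trans) simp
qed

lemma time_sets_before_earlier:
  assumes "u \<in> time_sets_before t" "0 < t"
  shows "\<forall>\<^sub>F \<Delta> in at_right 0. u \<in> time_sets_before (t - \<Delta>) \<and> 0 < \<Delta> \<and> 0 \<le> t - \<Delta>"
proof -
  have fin: "finite (insert 0 u)" using assms by (simp add: time_sets_before_def time_sets_def)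
  define m where "m = Max (insert 0 u)"
  have "m < t" unfolding m_def using fin assms by (subst Max_less_iff) (auto simp: time_sets_before_def)
  moreover have m: "r \<le> m" if "r \<in> insert 0 u" for r unfolding m_def using fin that by (rule Max_ge)
  ultimately have "\<forall>\<^sub>F \<Delta> in at_right 0. 0 < \<Delta> \<and> \<Delta> < t - m" by (intro eventually_at_right_0_small) simp
  then show ?thesis
  proof eventually_elim
    case (elim \<Delta>)
    then have *: "r < t - \<Delta>" if "r \<in> insert 0 u" for r using m[OF that] by simp
    show ?case using *[of 0] * elim assms(1) by (auto simp: time_sets_before_def)
  qed
qed

lemma markov_process_exists:
  fixes \<Omega> :: "(real \<Rightarrow> 'x::finite) set"
  assumes path_space: "path_space \<Omega>" and T: "transition_family \<Q> T" and p: "p \<in> \<M>"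
  obtains P where "P \<in> processes_WM \<Omega> \<Q> \<M>"
    "\<And>u (xu :: real \<Rightarrow> 'x) t s. u \<in> time_sets_before t \<Longrightarrow> xu \<in> states_at u \<Longrightarrow> 0 \<le> t \<Longrightarrow> t \<le> s \<Longrightarrow>
      trans_mat \<Omega> P u xu t s = T t s"
proof -
  \<comment> \<open>A negative start time draws the state at 0 from \<open>p\<close> and evolves it.
    The maxima keep the kernel stochastic for all arguments, as the locale demands.\<close>
  define K where "K r s x y = (if r < 0 then \<Sum>z\<in>UNIV. pmf p z * T 0 (max 0 s) $ z $ y else T r (max r s) $ x $ y)"
    for r s x y
  have p_sum: "(\<Sum>z\<in>UNIV. pmf p z) = 1" by (rule sum_pmf_eq_1) auto
  interpret transition_kernel K \<Omega>
  proof
    show "0 \<le> K r s x y" for r s x y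
      by (auto simp: K_def intro!: sum_nonneg mult_nonneg_nonneg transition_family_nonneg[OF T])
    show K_sum: "(\<Sum>y\<in>UNIV. K r s x y) = 1" for r s x
    proof (cases "r < 0")
      case True
      have "(\<Sum>y\<in>UNIV. \<Sum>z\<in>UNIV. pmf p z * T 0 (max 0 s) $ z $ y) = 1"
        by (subst sum.swap) (simp add: transition_family_row_sum[OF T] p_sum flip: sum_distrib_left)
      then show ?thesis using True by (simp add: K_def)
    qed (simp add: K_def transition_family_row_sum[OF T])
    show "K r q x z = (\<Sum>y\<in>UNIV. K r s x y * K s q y z)" if rs: "r < s" "s < q" for r s q x z
    proof -
      consider "s < 0" | "r < 0" "0 \<le> s" | "0 \<le> r" using rs by linarith
      then show ?thesis
      proof cases
        case 1
        \<comment> \<open>With both \<open>r\<close> and \<open>s\<close> before the start, the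
          transition to \<open>q\<close> is the same from either time and from every state.\<close>
        then have "K s q y z = K r q x z" for y using rs by (simp add: K_def)
        then show ?thesis by (simp add: K_sum flip: sum_distrib_right)
      next
        case 2
        have "K r q x z = (\<Sum>w\<in>UNIV. \<Sum>y\<in>UNIV. pmf p w * (T 0 s $ w $ y * T s q $ y $ z))"
          using 2 rs by (simp add: K_def transition_family_chapman[OF T, of 0 s q] matrix_mult_component sum_distrib_left)
        also have "\<dots> = (\<Sum>y\<in>UNIV. K r s x y * K s q y z)"
          by (subst sum.swap) (use 2 rs in \<open>simp add: K_def sum_distrib_right mult.assoc\<close>)
        finally show ?thesis .
      next
        case 3
        then show ?thesis using rs by (simp add: K_def transition_family_chapman[OF T, of r s q] matrix_mult_component)
      qed
    qed
    show "K (- 1) s x = K (- 1) s x'" for s x x' by (simp add: K_def fun_eq_iff)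
  qed (rule path_space)
  have trans: "trans_mat \<Omega> process u xu t s = T t s"
    if u: "u \<in> time_sets_before t" "xu \<in> states_at u" and t: "0 \<le> t" "t \<le> s" for u t s and xu :: "real \<Rightarrow> 'x"
  proof -
    have tu: "t \<notin> u" using time_sets_before_notin[OF u(1)] .
    have ins: "insert t u \<in> time_sets" "xu(t := x) \<in> states_at (insert t u)" for x
      using u t states_at_insert[OF u(2)] by (auto simp: time_sets_before_def time_sets_def)
    have last: "last_time (insert t u) = t"
      unfolding last_time_def using u t
      by (intro Max_eqI) (auto simp: time_sets_before_def time_sets_def less_imp_le)
    have "process (ev \<Omega> s y, evs \<Omega> (insert t u) (xu(t := x))) = T t s $ x $ y" for x y
    proof (cases "t = s")
      case True
      then show ?thesis using process_ev_present[OF ins] by (simp add: transition_family_same[OF T] mat_def)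
    next
      case False
      then have "r < s" if "r \<in> insert t u" for r using that u t by (auto simp: time_sets_before_def)
      from process_ev[OF ins _ this] show ?thesis using t by (simp add: last K_def)
    qed
    then show ?thesis by (simp add: trans_mat_def ev_Int_evs[OF tu] vec_eq_iff)
  qed
  have right: "\<exists>Q\<in>\<Q>. ((\<lambda>\<Delta>. (1 / \<Delta>) *\<^sub>R (trans_mat \<Omega> process u xu t (t + \<Delta>) - mat 1)) \<longlongrightarrow> Q) (at_right 0)"
    if u: "u \<in> time_sets_before t" "xu \<in> states_at u" "0 \<le> t" for u t and xu :: "real \<Rightarrow> 'x"
  proof -
    obtain Q where "Q \<in> \<Q>" "((\<lambda>\<Delta>. (1 / \<Delta>) *\<^sub>R (T t (t + \<Delta>) - mat 1)) \<longlongrightarrow> Q) (at_right 0)"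
      using transition_family_right[OF T, of t] by blast
    moreover from this(2) have "((\<lambda>\<Delta>. (1 / \<Delta>) *\<^sub>R (trans_mat \<Omega> process u xu t (t + \<Delta>) - mat 1)) \<longlongrightarrow> Q) (at_right 0)"
      by (rule Lim_transform_eventually)
        (use eventually_at_right_less[of "0::real"] in \<open>eventually_elim, simp add: trans u\<close>)
    ultimately show ?thesis by blast
  qed
  have left: "\<exists>Q\<in>\<Q>. ((\<lambda>\<Delta>. (1 / \<Delta>) *\<^sub>R (trans_mat \<Omega> process u xu (t - \<Delta>) t - mat 1)) \<longlongrightarrow> Q) (at_right 0)"
    if u: "u \<in> time_sets_before t" "xu \<in> states_at u" "0 < t" for u t and xu :: "real \<Rightarrow> 'x"
  proof -
    obtain Q where "Q \<in> \<Q>" "((\<lambda>\<Delta>. (1 / \<Delta>) *\<^sub>R (T (t - \<Delta>) t - mat 1)) \<longlongrightarrow> Q) (at_right 0)"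
      using transition_family_left[OF T, of t] by blast
    moreover from this(2) have "((\<lambda>\<Delta>. (1 / \<Delta>) *\<^sub>R (trans_mat \<Omega> process u xu (t - \<Delta>) t - mat 1)) \<longlongrightarrow> Q) (at_right 0)"
      by (rule Lim_transform_eventually)
        (use time_sets_before_earlier[OF u(1,3)] in \<open>eventually_elim, simp add: trans u\<close>)
    ultimately show ?thesis by blast
  qed
  have "well_behaved \<Omega> process"
    unfolding well_behaved_def
  proof (intro allI ballI impI conjI)
    fix t :: real and u and xu :: "real \<Rightarrow> 'x" assume u: "u \<in> time_sets_before t" "xu \<in> states_at u"
    show "Limsup (at_right 0) (\<lambda>\<Delta>. ereal (1 / \<Delta> * matnorm (trans_mat \<Omega> process u xu t (t + \<Delta>) - mat 1))) < \<infinity>"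
      if "0 \<le> t" by (rule bexE[OF right[OF u that]]) (rule Limsup_matnorm_quotient_finite)
    show "Limsup (at_right 0) (\<lambda>\<Delta>. ereal (1 / \<Delta> * matnorm (trans_mat \<Omega> process u xu (t - \<Delta>) t - mat 1))) < \<infinity>"
      if "0 < t" by (rule bexE[OF left[OF u that]]) (rule Limsup_matnorm_quotient_finite)
  qed
  moreover have "consistent_rates \<Omega> process \<Q>"
    unfolding consistent_rates_def
  proof (intro allI ballI impI subsetI)
    fix t :: real and u Q and xu :: "real \<Rightarrow> 'x"
    assume t: "0 \<le> t" and u: "u \<in> time_sets_before t" "xu \<in> states_at u" and "Q \<in> outer_derivative \<Omega> process u xu t"
    then obtain d where d: "\<And>i::nat. 0 < d i" "d \<longlonglongrightarrow> 0" and disj: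
      "(\<lambda>i. (1 / d i) *\<^sub>R (trans_mat \<Omega> process u xu t (t + d i) - mat 1)) \<longlonglongrightarrow> Q \<or>
         t > 0 \<and> (\<lambda>i. (1 / d i) *\<^sub>R (trans_mat \<Omega> process u xu (t - d i) t - mat 1)) \<longlonglongrightarrow> Q"
      by (auto simp: outer_derivative_def)
    have d_lim: "filterlim d (at_right 0) sequentially"
      using d less_imp_neq[OF d(1)] by (auto simp: filterlim_at)
    \<comment> \<open>The one-sided quotients converge, so each subsequential limit in the outer
      derivative is their limit, which lies in \<open>\<Q>\<close>.\<close>
    have unique: "Q \<in> \<Q>"
      if ex: "\<exists>R\<in>\<Q>. (F \<longlongrightarrow> R) (at_right 0)" and lim: "(\<lambda>i. F (d i)) \<longlonglongrightarrow> Q" for F :: "real \<Rightarrow> real^'x^'x"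
    proof -
      obtain R where R: "R \<in> \<Q>" "(F \<longlongrightarrow> R) (at_right 0)" using ex by (rule bexE)
      have "Q = R" by (rule LIMSEQ_unique[OF lim filterlim_compose[OF R(2) d_lim]])
      with R(1) show ?thesis by simp
    qed
    from disj show "Q \<in> \<Q>"
      using unique[OF right[OF u t]] unique[OF left[OF u]] by blast
  qed
  moreover have "consistent_initial \<Omega> process \<M>"
  proof -
    have \<Omega>: "\<Omega> = evs \<Omega> {} (\<lambda>_. undefined)" by (simp add: evs_def)
    have "process (ev \<Omega> 0 x, \<Omega>) = pmf p x" for x
    proof -
      have "process (ev \<Omega> 0 x, evs \<Omega> {} (\<lambda>_. undefined)) = (\<Sum>z\<in>UNIV. pmf p z * (mat 1 :: real^_^_) $ z $ x)"
        by (subst process_ev) (auto simp: time_sets_def states_at_def last_time_def K_def transition_family_same[OF T])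
      then show ?thesis using \<Omega> by (simp add: mat_def if_distrib cong: if_cong)
    qed
    then show ?thesis using p by (auto simp: consistent_initial_def)
  qed
  moreover have "markov \<Omega> process"
    unfolding markov_def
  proof (intro allI ballI impI)
    fix t s :: real and u x y and xu :: "real \<Rightarrow> 'x"
    assume t: "0 \<le> t" "t \<le> s" and u: "u \<in> time_sets_before t" "xu \<in> states_at u"
    have "{} \<in> time_sets_before t" "(\<lambda>_. undefined :: 'x) \<in> states_at {}"
      by (auto simp: time_sets_before_def time_sets_def states_at_def)
    then have "trans_mat \<Omega> process u xu t s $ x $ y = trans_mat \<Omega> process {} (\<lambda>_. undefined) t s $ x $ y"
      using trans t u by simp
    moreover have "ev \<Omega> t x \<inter> evs \<Omega> {} (\<lambda>_. undefined) = ev \<Omega> t x" by (auto simp: ev_def evs_def)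
    ultimately show "process (ev \<Omega> s y, ev \<Omega> t x \<inter> evs \<Omega> u xu) = process (ev \<Omega> s y, ev \<Omega> t x)"
      by (simp add: trans_mat_def)
  qed
  ultimately have "process \<in> processes_WM \<Omega> \<Q> \<M>"
    using stochastic_process_process by (simp add: processes_WM_def processes_W_def)
  then show ?thesis using trans by (rule that)
qed

theorem corollary8p3:
  fixes \<Omega> :: "(real \<Rightarrow> 'x::finite) set"
    and \<M> :: "'x pmf set"
    and \<Q> :: "(real^'x^'x) set"
    and t s :: real
    and u :: "real set"
    and xu :: "real \<Rightarrow> 'x"
    and xt :: 'x
    and f :: "real^'x"
  assumes "path_space \<Omega>"
    and "\<M> \<noteq> {}"
    and "\<Q> \<noteq> {}"
    and "\<Q> \<subseteq> rate_matrices"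
    and "bounded_rates \<Q>"
    and "separately_specified_rows \<Q>"
    and "0 \<le> t" and "t \<le> s"
    and "u \<in> time_sets_before t"
    and "xu \<in> states_at u"
  shows "lower_expectation_W \<Omega> \<Q> \<M> f s t xt u xu = lower_expectation_WM \<Omega> \<Q> \<M> f s t xt u xu
    \<and> lower_expectation_WM \<Omega> \<Q> \<M> f s t xt u xu = lower_transition (lower_envelope \<Q>) t s f $ xt"
proof -
  obtain M where M: "\<And>Q. Q \<in> \<Q> \<Longrightarrow> matnorm Q \<le> M"
    using assms(5) by (auto simp: bounded_rates_def bdd_above_def)
  interpret rate_matrix_set \<Q> M
    using assms(3,4) order_trans[OF abs_entry_le_matnorm M] by unfold_locales
  define J where "J P = cond_expectation \<Omega> P f s t xt u xu" for P
  \<comment> \<open>From here on \<open>L\<close> is the value claimed by the theorem, no longer the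
    Lipschitz constant.\<close>
  define L where "L = lower_transition (lower_envelope \<Q>) t s f $ xt"
  have L: "L = V (s - t) f $ xt" using lower_transition_eq_flow[OF assms(8)] by (simp add: L_def)
  have lower: "L \<le> J P" if "P \<in> processes_W \<Omega> \<Q> \<M>" for P
    unfolding L J_def by (rule process_lower_bound) (use assms that in auto)
  have upper: "\<exists>P\<in>processes_WM \<Omega> \<Q> \<M>. J P \<le> L + e" if e: "0 < e" for e
  proof -
    define \<epsilon> where "\<epsilon> = e / (s - t + 1)"
    have \<epsilon>: "0 < \<epsilon>" "\<epsilon> * (s - t) \<le> e" using e assms(8) by (auto simp: \<epsilon>_def field_simps)
    obtain T where T: "transition_family \<Q> T" "\<And>x. (T t s *v f) $ x \<le> V (s - t) f $ x + \<epsilon> * (s - t)"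
      using transition_family_upper_bound[OF assms(6) \<epsilon>(1) assms(8)] by blast
    obtain p where "p \<in> \<M>" using assms(2) by blast
    from markov_process_exists[OF assms(1) T(1) this]
    obtain P where P: "P \<in> processes_WM \<Omega> \<Q> \<M>"
      "\<And>u xu t s. u \<in> time_sets_before t \<Longrightarrow> xu \<in> states_at u \<Longrightarrow> 0 \<le> t \<Longrightarrow> t \<le> s \<Longrightarrow> trans_mat \<Omega> P u xu t s = T t s"
      by blast
    have "J P = (trans_mat \<Omega> P u xu t s *v f) $ xt"
      by (simp add: J_def cond_expectation_def trans_mat_def matrix_vector_mult_def mult.commute)
    then have "J P \<le> L + e" using P(2)[OF assms(9,10,7,8)] T(2)[of xt] \<epsilon>(2) L by simp
    then show ?thesis using P(1) by blast
  qed
  \<comment> \<open>\<open>L\<close> bounds all processes from below and is approached by Markov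
    chains, so every set of processes in between has infimum \<open>L\<close>. The bound for error 1
    also shows that such a set is nonempty.\<close>
  have Inf: "(INF P\<in>S. J P) = L" if S: "processes_WM \<Omega> \<Q> \<M> \<subseteq> S" "S \<subseteq> processes_W \<Omega> \<Q> \<M>" for S
  proof (rule antisym)
    show "L \<le> (INF P\<in>S. J P)"
      using S lower upper[of 1] by (intro cINF_greatest) auto
    show "(INF P\<in>S. J P) \<le> L"
    proof (rule field_le_epsilon)
      fix e :: real assume "0 < e"
      then obtain P where "P \<in> S" "J P \<le> L + e" using upper S by blast
      moreover have "bdd_below (J ` S)" using S lower by (auto intro!: bdd_belowI2[of _ L])
      ultimately show "(INF P\<in>S. J P) \<le> L + e" using cINF_lower2 by metis
    qed
  qed
  have "processes_WM \<Omega> \<Q> \<M> \<subseteq> processes_W \<Omega> \<Q> \<M>" by (auto simp: processes_WM_def)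
  then show ?thesis
    using Inf[of "processes_W \<Omega> \<Q> \<M>"] Inf[of "processes_WM \<Omega> \<Q> \<M>"]
    by (simp add: lower_expectation_W_def lower_expectation_WM_def J_def L_def)
qed

end
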